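(* Let $k$ be a field and let $\Delta$ be a simplicial complex with at least one vertex, with facets $A_1,\dots,A_r$. Then $$\operatorname{depth} k[\Delta]=\inf\{\,i+j \;:\; \tilde H_i(N_j(\Delta);k)\neq 0\,\},$$ where $i$ ranges over integers $i\ge -1$ and $j$ over integers $j\ge 1$.
   Context: For an integer $i$, the $i$-th nerve complex of $\Delta$ is the simplicial complex on vertex set $[r]$ given by $N_i(\Delta)=\{F\subseteq[r] : |\bigcap_{j\in F}A_j|\ge i\}$ (the empty set is always a face, so $N_i(\Delta)=\{\varnothing\}$ when $i$ exceeds the maximal facet size). $k[\Delta]$ is the Stanley–Reisner ring of $\Delta$ over $k$ and $\operatorname{depth}$ is its depth with respect to the homogeneous maximal ideal. $\tilde H_i$ denotes reduced simplicial homology with coefficients in $k$ (so $\tilde H_{-1}(\{\varnothing\})=k$). *)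

theory Defs
  imports
    "HOL-Algebra.Algebra"
    "HOL-Library.Poly_Mapping"
    "HOL-Library.Extended_Real"
begin

text \<open>A complex is given by its set of faces; its vertex set is \<open>\<Union>\<Delta>\<close>.\<close>

definition abstract_simplicial_complex :: "'v set set \<Rightarrow> bool" where
  "abstract_simplicial_complex \<Delta> \<longleftrightarrow>
     finite (\<Union>\<Delta>) \<and> {} \<in> \<Delta> \<and> (\<forall>F\<in>\<Delta>. \<forall>G. G \<subseteq> F \<longrightarrow> G \<in> \<Delta>)"

definition facets :: "'v set set \<Rightarrow> 'v set set" where
  "facets \<Delta> = {F \<in> \<Delta>. \<forall>G\<in>\<Delta>. F \<subseteq> G \<longrightarrow> G = F}"

text \<open>The intersection over the empty index set is \<open>UNIV\<close> in HOL, whose \<^const>\<open>card\<close> is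
  not meaningful here; the empty face is therefore treated separately, by fiat.\<close>

definition nerve_complex :: "nat \<Rightarrow> (nat \<Rightarrow> 'v set) \<Rightarrow> int \<Rightarrow> nat set set" where
  "nerve_complex r A i =
     {F. F \<subseteq> {1..r} \<and> (F = {} \<or> int (card (\<Inter>j\<in>F. A j)) \<ge> i)}"

text \<open>Throughout, the argument of type \<open>'k itself\<close> only serves to name the coefficient field.
  An \<open>i\<close>-chain is a finitely supported \<open>'k\<close>-valued function on the faces with \<open>i + 1\<close> vertices;
  the empty face is included, in degree \<open>- 1\<close>, so the homology below is the reduced one.\<close>

definition simplicial_chains :: "'k::field itself \<Rightarrow> 'a set set \<Rightarrow> int \<Rightarrow> ('a set \<Rightarrow>\<^sub>0 'k) set" where
  "simplicial_chains _ K i =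
     {c. \<forall>F \<in> Poly_Mapping.keys c. F \<in> K \<and> finite F \<and> int (card F) = i + 1}"

text \<open>Faces are oriented by the order of the vertices: \<open>card {w \<in> F. w < v}\<close> is the position
  of \<open>v\<close> in \<open>F\<close>. The boundary of the empty face is the empty sum.\<close>

definition simplicial_boundary ::
  "('a::linorder set \<Rightarrow>\<^sub>0 'k::field) \<Rightarrow> ('a set \<Rightarrow>\<^sub>0 'k)" where
  "simplicial_boundary c =
     (\<Sum>F\<in>Poly_Mapping.keys c. \<Sum>v\<in>F.
        Poly_Mapping.single (F - {v}) ((- 1) ^ card {w \<in> F. w < v} * Poly_Mapping.lookup c F))"

definition cycle_group ::
  "'k::field itself \<Rightarrow> 'a::linorder set set \<Rightarrow> int \<Rightarrow> ('a set \<Rightarrow>\<^sub>0 'k) monoid" where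
  "cycle_group k K i =
     \<lparr>carrier = {c \<in> simplicial_chains k K i. simplicial_boundary c = 0},
      monoid.mult = (+), one = 0\<rparr>"

definition reduced_homology ::
  "'k::field itself \<Rightarrow> 'a::linorder set set \<Rightarrow> int \<Rightarrow> ('a set \<Rightarrow>\<^sub>0 'k) set monoid" where
  "reduced_homology k K i =
     cycle_group k K i Mod (simplicial_boundary ` simplicial_chains k K (i + 1))"

text \<open>A polynomial is a finitely supported function from exponent vectors \<open>'v \<Rightarrow>\<^sub>0 nat\<close>
  to coefficients; multiplication in \<^theory>\<open>HOL-Library.Poly_Mapping\<close> is the convolution
  product.\<close>

definition polynomial_ring ::
  "'k::field itself \<Rightarrow> 'v set \<Rightarrow> (('v \<Rightarrow>\<^sub>0 nat) \<Rightarrow>\<^sub>0 'k) ring" where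
  "polynomial_ring _ V =
     \<lparr>carrier = {p. \<forall>m \<in> Poly_Mapping.keys p. Poly_Mapping.keys m \<subseteq> V},
      monoid.mult = (*), one = 1, ring.zero = 0, add = (+)\<rparr>"

definition poly_var :: "'v \<Rightarrow> ('v \<Rightarrow>\<^sub>0 nat) \<Rightarrow>\<^sub>0 'k::field" where
  "poly_var v = Poly_Mapping.single (Poly_Mapping.single v 1) 1"

definition stanley_reisner_ideal ::
  "'k::field itself \<Rightarrow> 'v set set \<Rightarrow> (('v \<Rightarrow>\<^sub>0 nat) \<Rightarrow>\<^sub>0 'k) set" where
  "stanley_reisner_ideal k \<Delta> =
     Idl\<^bsub>polynomial_ring k (\<Union>\<Delta>)\<^esub> {\<Prod>v\<in>F. poly_var v | F. F \<subseteq> \<Union>\<Delta> \<and> F \<notin> \<Delta>}"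

definition stanley_reisner_ring ::
  "'k::field itself \<Rightarrow> 'v set set \<Rightarrow> (('v \<Rightarrow>\<^sub>0 nat) \<Rightarrow>\<^sub>0 'k) set ring" where
  "stanley_reisner_ring k \<Delta> = polynomial_ring k (\<Union>\<Delta>) Quot stanley_reisner_ideal k \<Delta>"

definition homogeneous_maximal_ideal ::
  "'k::field itself \<Rightarrow> 'v set set \<Rightarrow> (('v \<Rightarrow>\<^sub>0 nat) \<Rightarrow>\<^sub>0 'k) set set" where
  "homogeneous_maximal_ideal k \<Delta> =
     Idl\<^bsub>stanley_reisner_ring k \<Delta>\<^esub>
       ((\<lambda>v. stanley_reisner_ideal k \<Delta> +>\<^bsub>polynomial_ring k (\<Union>\<Delta>)\<^esub> poly_var v) ` \<Union>\<Delta>)"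

text \<open>The middle condition says that each \<open>fs ! i\<close> is a nonzerodivisor on the quotient of \<open>R\<close> by
  the ideal generated by its predecessors, the last one that \<open>R / (fs)\<close> is not zero.\<close>

definition regular_sequence :: "('a, 'm) ring_scheme \<Rightarrow> 'a list \<Rightarrow> bool" where
  "regular_sequence R fs \<longleftrightarrow>
     set fs \<subseteq> carrier R \<and>
     (\<forall>i < length fs. \<forall>a \<in> carrier R.
        fs ! i \<otimes>\<^bsub>R\<^esub> a \<in> Idl\<^bsub>R\<^esub> (set (take i fs)) \<longrightarrow> a \<in> Idl\<^bsub>R\<^esub> (set (take i fs))) \<and>
     Idl\<^bsub>R\<^esub> (set fs) \<noteq> carrier R"

definition depth :: "('a, 'm) ring_scheme \<Rightarrow> 'a set \<Rightarrow> enat" where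
  "depth R I = Sup {enat (length fs) | fs. set fs \<subseteq> I \<and> regular_sequence R fs}"

end

theory Submission
  imports Defs
begin

text \<open>Multigraded pieces of the Koszul complex of the variables on \<open>k[\<Delta>]\<close> and chain complexes of nerves
  are both cochain complexes of families of finite sets, namely relative cochains of simplicial
  complexes. By Rees' theorem, the depth of \<open>k[\<Delta>]\<close> is the least degree in which the Koszul
  cohomology does not vanish. Its piece in degree \<open>- W\<close>, for a set \<open>W\<close> of vertices, is computed by
  the sets \<open>G\<close> with \<open>W \<subseteq> G\<close> and \<open>G - W \<in> \<Delta>\<close>. The double complex of pairs \<open>(F, G)\<close> with
  \<open>G - W \<subseteq> A\<^sub>F\<close>, where \<open>A\<^sub>F\<close> is the intersection of the facets indexed by \<open>F\<close>, identifies this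
  with the cohomology of the family of all \<open>F \<noteq> {}\<close> with \<open>A\<^sub>F \<subseteq> W\<close>. Filtering by \<open>A\<^sub>F\<close>, the vanishing
  of these groups below a given total degree is equivalent to the vanishing of the cohomology of the
  families \<open>A\<^sub>F = W\<close>, hence of the relative cohomology of the pairs \<open>(N\<^sub>q, N\<^sub>q\<^sub>+\<^sub>1)\<close> of higher nerves.
  Since \<open>N\<^sub>0\<close> is a full simplex, the long exact sequences turn this into the vanishing of the
  reduced cohomology of the \<open>N\<^sub>j\<close> with \<open>j \<ge> 1\<close>.\<close>

text \<open>Only vanishing below a bound has to be compared, so neither homology groups nor spectral
  sequences are built: \<open>cochain_exact\<close> records vanishing at one level, and every
  comparison is a piece of a long exact sequence, a cone, or a finite filtration. The step between
  \<open>A_F \<subseteq> W\<close> and \<open>A_F = W\<close> works only for all \<open>W\<close> at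
  once: passing to a proper subset of \<open>W\<close> may raise the level by one but lowers the
  cardinality by at least one, so a bound on their sum survives. Signs depend on an order of the
  vertices; numbering these by naturals above \<open>r\<close> lets the union of \<open>F\<close>
  and \<open>G\<close> stand for the pair, so that the double complex is again a family of sets.
  Cochains fit the Koszul side; homology of the nerves is reached at the end by duality of finite
  matrices over the field. The regular sequences in the definition of depth may be inhomogeneous, so
  nonzerodivisors are produced by prime avoidance in a noetherian ring and not by a graded
  argument.\<close>

abbreviation lookup :: "('a \<Rightarrow>\<^sub>0 'b::zero) \<Rightarrow> 'a \<Rightarrow> 'b" where
  "lookup \<equiv> Poly_Mapping.lookup"

abbreviation keys :: "('a \<Rightarrow>\<^sub>0 'b::zero) \<Rightarrow> 'a set" where
  "keys \<equiv> Poly_Mapping.keys"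

abbreviation single :: "'a \<Rightarrow> 'b::zero \<Rightarrow> 'a \<Rightarrow>\<^sub>0 'b" where
  "single \<equiv> Poly_Mapping.single"

type_synonym ('v, 'k) mpoly = "('v \<Rightarrow>\<^sub>0 nat) \<Rightarrow>\<^sub>0 'k"

section \<open>Cochains on families of finite sets\<close>

definition face_sign :: "'a::linorder set \<Rightarrow> 'a \<Rightarrow> 'b::comm_ring_1" where
  "face_sign G v = (- 1) ^ card {w \<in> G. w < v}"

text \<open>One formula for two complexes: with \<open>x\<close> constantly 1 it is the simplicial
  coboundary, with \<open>x\<close> the variables it is the Koszul differential in cohomological
  form. Signs, \<open>d d = 0\<close> and contractions are thus treated once.\<close>

definition koszul_diff ::
  "('a::linorder \<Rightarrow> 'b::comm_ring_1) \<Rightarrow> ('a set \<Rightarrow> 'b) \<Rightarrow> 'a set \<Rightarrow> 'b" where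
  "koszul_diff x z G = (\<Sum>v\<in>G. face_sign G v * x v * z (G - {v}))"

lemma face_sign_mult_self [simp]: "face_sign G v * face_sign G v = (1 :: 'b::comm_ring_1)"
  by (simp add: face_sign_def flip: power_mult_distrib)

lemma face_sign_mult_self_left [simp]:
  "face_sign G v * (face_sign G v * a) = (a :: 'b::comm_ring_1)"
  by (simp flip: mult.assoc)

lemma face_sign_remove_less:
  assumes "finite G" "v \<in> G" "v < w"
  shows "face_sign (G - {v}) w = (- face_sign G w :: 'b::comm_ring_1)"
proof -
  have "{u \<in> G. u < w} = insert v {u \<in> G - {v}. u < w}"
    using assms by auto
  then have "card {u \<in> G. u < w} = Suc (card {u \<in> G - {v}. u < w})"
    using assms by simp
  then show ?thesis by (simp add: face_sign_def)
qed

lemma face_sign_remove_greater: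
  assumes "w < v"
  shows "face_sign (G - {v}) w = face_sign G w"
proof -
  have "{u \<in> G. u < w} = {u \<in> G - {v}. u < w}"
    using assms by auto
  then show ?thesis by (simp add: face_sign_def)
qed

lemma face_sign_swap:
  assumes "finite G" "v \<in> G" "w \<in> G" "v \<noteq> w"
  shows "face_sign G v * face_sign (G - {v}) w =
    (- (face_sign G w * face_sign (G - {w}) v) :: 'b::comm_ring_1)"
proof (cases "v < w")
  case True
  then show ?thesis
    using assms by (simp add: face_sign_remove_less face_sign_remove_greater mult.commute)
next
  case False
  then have "w < v" using assms by simp
  then show ?thesis
    using assms by (simp add: face_sign_remove_less face_sign_remove_greater mult.commute)
qed

lemma koszul_diff_add: "koszul_diff x (\<lambda>G. a G + b G) G = koszul_diff x a G + koszul_diff x b G"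
  by (simp add: koszul_diff_def algebra_simps sum.distrib)

lemma koszul_diff_minus: "koszul_diff x (\<lambda>G. a G - b G) G = koszul_diff x a G - koszul_diff x b G"
  by (simp add: koszul_diff_def algebra_simps sum_subtractf)

lemma koszul_diff_cmult: "koszul_diff x (\<lambda>G. c * a G) G = c * koszul_diff x a G"
  by (simp add: koszul_diff_def sum_distrib_left mult_ac)

lemma koszul_diff_0 [simp]: "koszul_diff x (\<lambda>G. 0) G = 0"
  by (simp add: koszul_diff_def)

lemma koszul_diff_empty [simp]: "koszul_diff x z {} = 0"
  by (simp add: koszul_diff_def)

lemma koszul_diff_cong:
  assumes "\<And>v. v \<in> G \<Longrightarrow> a (G - {v}) = b (G - {v})"
  shows "koszul_diff x a G = koszul_diff x b G"
  unfolding koszul_diff_def by (rule sum.cong) (use assms in auto)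

text \<open>Removing \<open>v\<close> then \<open>w\<close> and removing \<open>w\<close> then
  \<open>v\<close> reach the same set with opposite signs, so the sum over ordered pairs cancels
  under \<open>prod.swap\<close>.\<close>

lemma koszul_diff_diff: "koszul_diff x (koszul_diff x z) G = 0"
proof (cases "finite G")
  case True
  define t where "t p = (case p of (v, w) \<Rightarrow>
    face_sign G v * x v * (face_sign (G - {v}) w * x w * z (G - {v} - {w})))" for p
  let ?L = "{(v, w). v \<in> G \<and> w \<in> G \<and> v < w}" and ?U = "{(v, w). v \<in> G \<and> w \<in> G \<and> w < v}"
  have fin: "finite ?L" "finite ?U"
    by (rule finite_subset[of _ "G \<times> G"]; use True in auto)+
  have "koszul_diff x (koszul_diff x z) G = (\<Sum>v\<in>G. \<Sum>w\<in>G - {v}. t (v, w))"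
    by (simp add: koszul_diff_def t_def sum_distrib_left)
  also have "\<dots> = sum t (SIGMA v:G. G - {v})"
    by (subst sum.Sigma) (use True in auto)
  also have "(SIGMA v:G. G - {v}) = ?L \<union> ?U" by auto
  also have "sum t (?L \<union> ?U) = sum t ?L + sum t ?U"
    by (rule sum.union_disjoint[OF fin]) auto
  also have "sum t ?U = (\<Sum>p\<in>?L. - t p)"
  proof (rule sum.reindex_bij_witness[of _ prod.swap prod.swap])
    fix p assume "p \<in> ?U"
    then obtain v w where p: "p = (v, w)" "v \<in> G" "w \<in> G" "w < v" by auto
    have "face_sign G v * face_sign (G - {v}) w * x v * x w * z (G - {v} - {w}) =
        - (face_sign G w * face_sign (G - {w}) v) * x v * x w * z (G - {v} - {w})"
      using p True by (subst face_sign_swap) auto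
    then show "- t (prod.swap p) = t p"
      unfolding t_def p by (simp add: mult_ac Diff_insert2[symmetric] insert_commute)
  qed auto
  finally show ?thesis by (simp add: sum_negf)
qed (simp add: koszul_diff_def)

abbreviation coboundary :: "('a::linorder set \<Rightarrow> 'b::comm_ring_1) \<Rightarrow> 'a set \<Rightarrow> 'b" where
  "coboundary \<equiv> koszul_diff (\<lambda>_. 1)"

definition supported_on :: "'a set \<Rightarrow> ('a \<Rightarrow> 'b::zero) \<Rightarrow> bool" where
  "supported_on K z \<longleftrightarrow> (\<forall>G. G \<notin> K \<longrightarrow> z G = 0)"

definition restrict0 :: "'a set \<Rightarrow> ('a \<Rightarrow> 'b::zero) \<Rightarrow> 'a \<Rightarrow> 'b" where
  "restrict0 K z G = (if G \<in> K then z G else 0)"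

text \<open>The index \<open>n\<close> is the cardinality of the sets, hence simplicial degree
  \<open>n - 1\<close>. Cochains are total functions vanishing off \<open>K\<close>, and both
  conditions are tested at members of \<open>K\<close> only: for a simplicial complex this gives
  reduced cohomology, for a difference of two complexes relative cohomology.\<close>

definition cochain_exact :: "'b::comm_ring_1 itself \<Rightarrow> 'a::linorder set set \<Rightarrow> nat \<Rightarrow> bool" where
  "cochain_exact _ K n \<longleftrightarrow>
     (\<forall>z :: 'a set \<Rightarrow> 'b. supported_on K z \<longrightarrow>
        (\<forall>G\<in>K. card G = Suc n \<longrightarrow> coboundary z G = 0) \<longrightarrow>
        (\<exists>u. supported_on K u \<and> (\<forall>G\<in>K. card G = n \<longrightarrow> z G = coboundary u G)))"

lemma cochain_exactD:
  fixes k :: "'b::comm_ring_1 itself" and z :: "'a::linorder set \<Rightarrow> 'b"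
  assumes "cochain_exact k K n" "supported_on K z"
    and "\<And>G. G \<in> K \<Longrightarrow> card G = Suc n \<Longrightarrow> coboundary z G = 0"
  shows "\<exists>u. supported_on K u \<and> (\<forall>G. G \<in> K \<longrightarrow> card G = n \<longrightarrow> z G = coboundary u G)"
  using assms unfolding cochain_exact_def by blast

text \<open>These are the differences of two simplicial complexes. Closure under intermediate sets
  keeps the truncated coboundary a differential.\<close>

definition convex_family :: "'a set set \<Rightarrow> bool" where
  "convex_family K \<longleftrightarrow> (\<forall>F\<in>K. \<forall>H\<in>K. \<forall>G. F \<subseteq> G \<longrightarrow> G \<subseteq> H \<longrightarrow> G \<in> K)"

text \<open>Extension by zero from \<open>K - D\<close> and restriction to \<open>D\<close> form a
  short exact sequence \<open>0 -> C(K - D) -> C(K) -> C(D) -> 0\<close>.\<close>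

definition down_in :: "'a set set \<Rightarrow> 'a set set \<Rightarrow> bool" where
  "down_in K D \<longleftrightarrow> D \<subseteq> K \<and> (\<forall>G\<in>D. \<forall>H\<in>K. H \<subseteq> G \<longrightarrow> H \<in> D)"

lemma supported_on_restrict0 [simp]: "supported_on K (restrict0 K z)"
  by (simp add: supported_on_def restrict0_def)

lemma restrict0_in [simp]: "G \<in> K \<Longrightarrow> restrict0 K z G = z G"
  by (simp add: restrict0_def)

lemma supported_onD: "supported_on K z \<Longrightarrow> G \<notin> K \<Longrightarrow> z G = 0"
  by (simp add: supported_on_def)

lemma supported_on_mono: "supported_on K z \<Longrightarrow> K \<subseteq> Y \<Longrightarrow> supported_on Y z"
  by (auto simp: supported_on_def)

lemma supported_on_add:
  "supported_on K (a :: _ \<Rightarrow> 'b::comm_ring_1) \<Longrightarrow> supported_on K b \<Longrightarrow> supported_on K (\<lambda>G. a G + b G)"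
  "supported_on K a \<Longrightarrow> supported_on K b \<Longrightarrow> supported_on K (\<lambda>G. a G - b G)"
  by (auto simp: supported_on_def)

text \<open>If \<open>G - {v}\<close> leaves \<open>K\<close>, convexity excludes every
  \<open>G - {v} - {w}\<close> from \<open>K\<close> as well, so truncating
  \<open>coboundary u\<close> to \<open>K\<close> discards only zeros and
  \<open>koszul_diff_diff\<close> applies.\<close>

lemma coboundary_restrict0_coboundary:
  fixes u :: "'a::linorder set \<Rightarrow> 'b::comm_ring_1"
  assumes "convex_family K" "supported_on K u" "G \<in> K"
  shows "coboundary (restrict0 K (coboundary u)) G = 0"
proof -
  have "coboundary (restrict0 K (coboundary u)) G = coboundary (coboundary u) G"
  proof (rule koszul_diff_cong)
    fix v assume v: "v \<in> G"
    show "restrict0 K (coboundary u) (G - {v}) = coboundary u (G - {v})"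
    proof (cases "G - {v} \<in> K")
      case False
      have "u (G - {v} - {w}) = 0" for w
      proof (rule supported_onD[OF assms(2)])
        show "G - {v} - {w} \<notin> K"
          using False assms(1,3) unfolding convex_family_def by (metis Diff_subset)
      qed
      then show ?thesis using False by (simp add: restrict0_def koszul_diff_def)
    qed simp
  qed
  then show ?thesis by (simp add: koszul_diff_diff)
qed

lemma coboundary_restrict0_down:
  assumes "down_in K D" "supported_on K z" "G \<in> D"
  shows "coboundary (restrict0 D z) G = coboundary z G"
proof (rule koszul_diff_cong)
  fix v
  have "G - {v} \<notin> D \<Longrightarrow> G - {v} \<notin> K"
    using assms by (auto simp: down_in_def)
  then show "restrict0 D z (G - {v}) = z (G - {v})"
    using assms(2) by (auto simp: restrict0_def supported_on_def)
qed

lemma coboundary_up_eq_0: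
  assumes "down_in K D" "supported_on (K - D) z" "G \<in> D"
  shows "coboundary z G = 0"
proof -
  have "coboundary z G = coboundary (\<lambda>_. 0) G"
  proof (rule koszul_diff_cong)
    fix v
    have "G - {v} \<notin> K - D"
      using assms by (auto simp: down_in_def)
    then show "z (G - {v}) = 0" using assms(2) by (auto simp: supported_on_def)
  qed
  then show ?thesis by simp
qed

section \<open>Vanishing pieces of the long exact sequence of a lower part\<close>

lemma cochain_exact_extension:
  assumes cx: "convex_family K" and dn: "down_in K D"
    and eD: "cochain_exact k D n" and eU: "cochain_exact k (K - D) n"
  shows "cochain_exact (k :: 'b::comm_ring_1 itself) K n"
  unfolding cochain_exact_def
proof (intro allI impI)
  fix z :: "_ \<Rightarrow> 'b"
  assume z: "supported_on K z" and dz: "\<forall>G\<in>K. card G = Suc n \<longrightarrow> coboundary z G = 0"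
  have DK: "D \<subseteq> K" using dn by (simp add: down_in_def)
  have dz1: "coboundary (restrict0 D z) G = 0" if "G \<in> D" "card G = Suc n" for G
    using coboundary_restrict0_down[OF dn z] dz DK that by auto
  obtain u1 where u1: "supported_on D u1"
      "\<And>G. G \<in> D \<Longrightarrow> card G = n \<Longrightarrow> z G = coboundary u1 G"
    using cochain_exactD[OF eD supported_on_restrict0, OF dz1] by (metis restrict0_in)
  \<comment> \<open>Once \<open>coboundary u1\<close> is subtracted, the values of \<open>z\<close>
    at level \<open>n\<close> on \<open>D\<close> are gone, so what remains is a cocycle of
    \<open>K - D\<close>.\<close>
  define y where "y = restrict0 (K - D) (\<lambda>G. z G - coboundary u1 G)"
  have sy: "supported_on (K - D) y" by (simp add: y_def)
  have dy: "coboundary y G = 0" if G: "G \<in> K - D" "card G = Suc n" for G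
  proof -
    have "coboundary y G = coboundary (\<lambda>G. z G - restrict0 K (coboundary u1) G) G"
    proof (rule koszul_diff_cong)
      fix v assume "v \<in> G"
      then have "card (G - {v}) = n" using G(2) by simp
      then show "y (G - {v}) = z (G - {v}) - restrict0 K (coboundary u1) (G - {v})"
        using u1(2)[of "G - {v}"] z by (auto simp: y_def restrict0_def supported_on_def)
    qed
    also have "\<dots> = 0"
      using dz G coboundary_restrict0_coboundary[OF cx supported_on_mono[OF u1(1) DK], of G]
      by (simp add: koszul_diff_minus)
    finally show ?thesis .
  qed
  obtain u2 where u2: "supported_on (K - D) u2"
      "\<And>G. G \<in> K - D \<Longrightarrow> card G = n \<Longrightarrow> y G = coboundary u2 G"
    using cochain_exactD[OF eU sy, OF dy] by blast
  show "\<exists>u. supported_on K u \<and> (\<forall>G\<in>K. card G = n \<longrightarrow> z G = coboundary u G)"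
  proof (intro exI conjI ballI impI)
    show "supported_on K (\<lambda>G. u1 G + u2 G)"
      using u1(1) u2(1) DK by (auto simp: supported_on_def)
    fix G assume G: "G \<in> K" "card G = n"
    show "z G = coboundary (\<lambda>G. u1 G + u2 G) G"
    proof (cases "G \<in> D")
      case True
      then show ?thesis
        using u1(2)[of G] G coboundary_up_eq_0[OF dn u2(1)] by (simp add: koszul_diff_add)
    next
      case False
      then show ?thesis
        using u2(2)[of G] G by (simp add: koszul_diff_add y_def diff_eq_eq add.commute)
    qed
  qed
qed

text \<open>Exactness of \<open>H^n(K) -> H^n(D) -> H^(n+1)(K - D)\<close> in the middle.\<close>

lemma cochain_exact_down:
  assumes cx: "convex_family K" and dn: "down_in K D"
    and eK: "cochain_exact k K n" and eU: "cochain_exact k (K - D) (Suc n)"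
  shows "cochain_exact (k :: 'b::comm_ring_1 itself) D n"
  unfolding cochain_exact_def
proof (intro allI impI)
  fix z :: "_ \<Rightarrow> 'b"
  assume z: "supported_on D z" and dz: "\<forall>G\<in>D. card G = Suc n \<longrightarrow> coboundary z G = 0"
  have DK: "D \<subseteq> K" using dn by (simp add: down_in_def)
  have zK: "supported_on K z" using z DK by (rule supported_on_mono)
  \<comment> \<open>The connecting homomorphism: extend \<open>z\<close> by zero and take the
    coboundary, which at level \<open>Suc n\<close> lives on \<open>K - D\<close> because
    \<open>z\<close> is a cocycle on \<open>D\<close>.\<close>
  define y where "y = restrict0 (K - D) (coboundary z)"
  have sy: "supported_on (K - D) y" by (simp add: y_def)
  have dy: "coboundary y G = 0" if G: "G \<in> K - D" "card G = Suc (Suc n)" for G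
  proof -
    have "coboundary y G = coboundary (restrict0 K (coboundary z)) G"
    proof (rule koszul_diff_cong)
      fix v assume "v \<in> G"
      then have "card (G - {v}) = Suc n" using G(2) by simp
      then show "y (G - {v}) = restrict0 K (coboundary z) (G - {v})"
        using dz by (auto simp: y_def restrict0_def)
    qed
    also have "\<dots> = 0"
      using coboundary_restrict0_coboundary[OF cx zK] G by simp
    finally show ?thesis .
  qed
  obtain u where u: "supported_on (K - D) u"
      "\<And>G. G \<in> K - D \<Longrightarrow> card G = Suc n \<Longrightarrow> y G = coboundary u G"
    using cochain_exactD[OF eU sy, OF dy] by blast
  have zu: "supported_on K (\<lambda>G. z G - u G)"
    by (rule supported_on_add[OF zK supported_on_mono[OF u(1)]]) auto
  have dzu: "coboundary (\<lambda>G. z G - u G) G = 0" if G: "G \<in> K" "card G = Suc n" for G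
  proof (cases "G \<in> D")
    case True
    then show ?thesis using dz G coboundary_up_eq_0[OF dn u(1)] by (simp add: koszul_diff_minus)
  next
    case False
    then show ?thesis using u(2)[of G] G by (simp add: koszul_diff_minus y_def)
  qed
  obtain w where w: "supported_on K w"
      "\<And>G. G \<in> K \<Longrightarrow> card G = n \<Longrightarrow> z G - u G = coboundary w G"
    using cochain_exactD[OF eK zu, OF dzu] by blast
  show "\<exists>u. supported_on D u \<and> (\<forall>G\<in>D. card G = n \<longrightarrow> z G = coboundary u G)"
  proof (intro exI conjI ballI impI)
    show "supported_on D (restrict0 D w)" by simp
    fix G assume G: "G \<in> D" "card G = n"
    have "u G = 0" using u(1) G by (auto simp: supported_on_def)
    then show "z G = coboundary (restrict0 D w) G"
      using w(2)[of G] G DK coboundary_restrict0_down[OF dn w(1)] by auto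
  qed
qed

text \<open>Exactness of \<open>H^n(D) -> H^(n+1)(K - D) -> H^(n+1)(K)\<close> in the
  middle.\<close>

lemma cochain_exact_up:
  assumes cx: "convex_family K" and dn: "down_in K D"
    and eK: "cochain_exact k K (Suc n)" and eD: "cochain_exact k D n"
  shows "cochain_exact (k :: 'b::comm_ring_1 itself) (K - D) (Suc n)"
  unfolding cochain_exact_def
proof (intro allI impI)
  fix z :: "_ \<Rightarrow> 'b"
  assume z: "supported_on (K - D) z"
    and dz: "\<forall>G\<in>K - D. card G = Suc (Suc n) \<longrightarrow> coboundary z G = 0"
  have DK: "D \<subseteq> K" using dn by (simp add: down_in_def)
  have zK: "supported_on K z" using z by (rule supported_on_mono) auto
  have dzK: "coboundary z G = 0" if "G \<in> K" "card G = Suc (Suc n)" for G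
    using dz coboundary_up_eq_0[OF dn z, of G] that by blast
  obtain w where w: "supported_on K w"
      "\<And>G. G \<in> K \<Longrightarrow> card G = Suc n \<Longrightarrow> z G = coboundary w G"
    using cochain_exactD[OF eK zK, OF dzK] by blast
  \<comment> \<open>The primitive \<open>w\<close> over \<open>K\<close> need not vanish on
    \<open>D\<close>, but it is a cocycle there because \<open>z\<close> is zero on
    \<open>D\<close>; subtracting a coboundary moves it into \<open>K - D\<close>.\<close>
  have dw: "coboundary (restrict0 D w) G = 0" if "G \<in> D" "card G = Suc n" for G
    using coboundary_restrict0_down[OF dn w(1), of G] w(2)[of G] DK that supported_onD[OF z, of G]
    by auto
  obtain v where v: "supported_on D v"
      "\<And>G. G \<in> D \<Longrightarrow> card G = n \<Longrightarrow> w G = coboundary v G"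
    using cochain_exactD[OF eD supported_on_restrict0, OF dw] by (metis restrict0_in)
  show "\<exists>u. supported_on (K - D) u \<and> (\<forall>G\<in>K - D. card G = Suc n \<longrightarrow> z G = coboundary u G)"
  proof (intro exI conjI ballI impI)
    let ?u = "restrict0 (K - D) (\<lambda>G. w G - coboundary v G)"
    show "supported_on (K - D) ?u" by simp
    fix G assume G: "G \<in> K - D" "card G = Suc n"
    have "coboundary ?u G = coboundary (\<lambda>G. w G - restrict0 K (coboundary v) G) G"
    proof (rule koszul_diff_cong)
      fix a assume "a \<in> G"
      then have "card (G - {a}) = n" using G(2) by simp
      then show "?u (G - {a}) = w (G - {a}) - restrict0 K (coboundary v) (G - {a})"
        using v(2)[of "G - {a}"] w(1) by (auto simp: restrict0_def supported_on_def)
    qed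
    also have "\<dots> = z G"
      using w(2)[of G] G coboundary_restrict0_coboundary[OF cx supported_on_mono[OF v(1) DK], of G]
      by (simp add: koszul_diff_minus)
    finally show "z G = coboundary ?u G" by simp
  qed
qed

section \<open>Contractions, filtrations and direct sums\<close>

definition cone_homotopy :: "'a::linorder \<Rightarrow> ('a set \<Rightarrow> 'b::comm_ring_1) \<Rightarrow> 'a set \<Rightarrow> 'b" where
  "cone_homotopy v z H = (if v \<in> H then 0 else face_sign (insert v H) v * z (insert v H))"

text \<open>Together with the next lemma this is \<open>d h + h d = x v\<close> for the contraction
  \<open>h = cone_homotopy v\<close>; at sets containing \<open>v\<close> the term
  \<open>h d\<close> is zero.\<close>

lemma koszul_diff_cone_homotopy_in:
  assumes "finite G" "v \<in> G"
  shows "koszul_diff x (cone_homotopy v z) G = x v * z G"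
proof -
  have "koszul_diff x (cone_homotopy v z) G =
      (\<Sum>u\<in>{v}. face_sign G u * x u * cone_homotopy v z (G - {u}))"
    unfolding koszul_diff_def
    by (rule sum.mono_neutral_right) (use assms in \<open>auto simp: cone_homotopy_def\<close>)
  also have "\<dots> = x v * z G"
    using assms by (simp add: cone_homotopy_def insert_absorb mult_ac)
  finally show ?thesis .
qed

lemma koszul_diff_cone_homotopy_notin:
  assumes "finite G" "v \<notin> G"
  shows "koszul_diff x (cone_homotopy v z) G =
    x v * z G - face_sign (insert v G) v * koszul_diff x z (insert v G)"
proof -
  have eq: "insert v G - {u} = insert v (G - {u})" if "u \<in> G" for u using that assms by auto
  \<comment> \<open>This compares the two orders of removing \<open>u\<close> and \<open>v\<close>
    from \<open>insert v G\<close>; as signs are their own inverses, \<open>face_sign_swap\<close>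
    can be brought into this form.\<close>
  have sg: "face_sign G u * face_sign (insert v (G - {u})) v =
      (- (face_sign (insert v G) v * face_sign (insert v G) u) :: 'b)" if u: "u \<in> G" for u
  proof -
    have "face_sign (insert v G) v * face_sign (insert v G - {v}) u =
        (- (face_sign (insert v G) u * face_sign (insert v G - {u}) v) :: 'b)"
      using u assms by (intro face_sign_swap) auto
    then have *: "face_sign (insert v G) v * face_sign G u =
        (- (face_sign (insert v G) u * face_sign (insert v (G - {u})) v) :: 'b)"
      using eq[OF u] assms by simp
    have "face_sign G u * face_sign (insert v (G - {u})) v =
      (face_sign (insert v G) u * face_sign G u) *
        (face_sign (insert v G) u * face_sign (insert v (G - {u})) v :: 'b)"
      by (simp add: mult_ac)
    also have "\<dots> = - (face_sign (insert v G) u * face_sign G u) *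
        (face_sign (insert v G) v * face_sign G u :: 'b)"
      using * by simp
    also have "\<dots> = - (face_sign (insert v G) v * face_sign (insert v G) u)"
      by (simp add: mult_ac)
    finally show ?thesis .
  qed
  have "koszul_diff x (cone_homotopy v z) G = (\<Sum>u\<in>G. - (face_sign (insert v G) v *
      (face_sign (insert v G) u * x u * z (insert v G - {u}))))"
    unfolding koszul_diff_def
  proof (rule sum.cong[OF refl])
    fix u assume u: "u \<in> G"
    then have "cone_homotopy v z (G - {u}) = face_sign (insert v (G - {u})) v * z (insert v G - {u})"
      using assms eq by (auto simp: cone_homotopy_def)
    then have "face_sign G u * x u * cone_homotopy v z (G - {u}) =
        (face_sign G u * face_sign (insert v (G - {u})) v) * x u * z (insert v G - {u})"
      by (simp add: mult_ac)
    then show "face_sign G u * x u * cone_homotopy v z (G - {u}) =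
        - (face_sign (insert v G) v * (face_sign (insert v G) u * x u * z (insert v G - {u})))"
      using sg[OF u] by (simp add: mult_ac)
  qed
  moreover have "koszul_diff x z (insert v G) = face_sign (insert v G) v * x v * z G +
      (\<Sum>u\<in>G. face_sign (insert v G) u * x u * z (insert v G - {u}))"
    using assms by (simp add: koszul_diff_def)
  ultimately show ?thesis
    by (simp add: sum_negf sum_distrib_left distrib_left mult_ac)
qed

text \<open>With \<open>x\<close> constantly 1 the contraction is a primitive of every cocycle, and
  closure under inserting and removing \<open>v\<close> keeps it supported on
  \<open>K\<close>.\<close>

lemma cochain_exact_cone:
  assumes fin: "\<And>G. G \<in> K \<Longrightarrow> finite G"
    and ins: "\<And>G. G \<in> K \<Longrightarrow> insert v G \<in> K" and rem: "\<And>G. G \<in> K \<Longrightarrow> G - {v} \<in> K"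
  shows "cochain_exact (k :: 'b::comm_ring_1 itself) K n"
  unfolding cochain_exact_def
proof (intro allI impI)
  fix z :: "_ \<Rightarrow> 'b"
  assume z: "supported_on K z" and dz: "\<forall>G\<in>K. card G = Suc n \<longrightarrow> coboundary z G = 0"
  show "\<exists>u. supported_on K u \<and> (\<forall>G\<in>K. card G = n \<longrightarrow> z G = coboundary u G)"
  proof (intro exI conjI ballI impI)
    have "insert v G \<notin> K" if "v \<notin> G" "G \<notin> K" for G
      using rem[of "insert v G"] that by auto
    then show "supported_on K (cone_homotopy v z)"
      using z by (auto simp: supported_on_def cone_homotopy_def)
    fix G assume G: "G \<in> K" "card G = n"
    show "z G = coboundary (cone_homotopy v z) G"
    proof (cases "v \<in> G")
      case True
      then show ?thesis using fin[OF G(1)] by (simp add: koszul_diff_cone_homotopy_in)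
    next
      case False
      then show ?thesis using fin[OF G(1)] dz ins[OF G(1)] G
        by (simp add: koszul_diff_cone_homotopy_notin)
    qed
  qed
qed

lemma convex_family_subset_down:
  assumes "convex_family K" "down_in K D"
  shows "convex_family D" "convex_family (K - D)"
  using assms unfolding convex_family_def down_in_def by (blast, blast)

text \<open>The fibre over a maximal value is an upper part of \<open>K\<close> and the rest is a
  lower part with one value fewer, so \<open>cochain_exact_extension\<close> adds the fibres one at
  a time.\<close>

lemma cochain_exact_fibres:
  fixes g :: "'a::linorder set \<Rightarrow> 'c::order"
  assumes "convex_family K" "finite (g ` K)"
    and "\<And>G H. G \<in> K \<Longrightarrow> H \<in> K \<Longrightarrow> G \<subseteq> H \<Longrightarrow> g G \<le> g H"
    and "\<And>c. c \<in> g ` K \<Longrightarrow> cochain_exact k {G \<in> K. g G = c} n"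
  shows "cochain_exact (k :: 'b::comm_ring_1 itself) K n"
  using assms
proof (induction "card (g ` K)" arbitrary: K)
  case 0
  then have "K = {}" by simp
  then show ?case by (auto simp: cochain_exact_def supported_on_def)
next
  case (Suc m)
  then have "g ` K \<noteq> {}" by auto
  then obtain c where c: "c \<in> g ` K" "\<And>a. a \<in> g ` K \<Longrightarrow> c \<le> a \<Longrightarrow> a = c"
    using finite_has_maximal[OF Suc.prems(2)] by metis
  define D where "D = {G \<in> K. g G \<noteq> c}"
  have dn: "down_in K D"
    unfolding down_in_def
  proof (intro conjI ballI impI)
    fix G H assume G: "G \<in> D" and H: "H \<in> K" "H \<subseteq> G"
    then have "g H \<le> g G" using Suc.prems(3)[of H G] by (simp add: D_def)
    then show "H \<in> D" using c(2)[of "g G"] G H by (auto simp: D_def)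
  qed (auto simp: D_def)
  have im: "g ` D = g ` K - {c}" by (auto simp: D_def)
  have fib: "{G \<in> D. g G = a} = {G \<in> K. g G = a}" if "a \<in> g ` D" for a
    using that by (auto simp: D_def)
  have "cochain_exact k D n"
  proof (rule Suc.hyps(1))
    show "m = card (g ` D)" using Suc.hyps(2) c(1) Suc.prems(2) by (simp add: im)
    show "convex_family D" using convex_family_subset_down[OF Suc.prems(1) dn] by simp
    show "finite (g ` D)" using Suc.prems(2) by (simp add: im)
    show "g G \<le> g H" if "G \<in> D" "H \<in> D" "G \<subseteq> H" for G H
      using Suc.prems(3) that by (simp add: D_def)
    show "cochain_exact k {G \<in> D. g G = a} n" if "a \<in> g ` D" for a
      using Suc.prems(4)[of a] that fib[OF that] im by simp
  qed
  moreover have "K - D = {G \<in> K. g G = c}" by (auto simp: D_def)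
  ultimately show ?case
    using cochain_exact_extension[OF Suc.prems(1) dn] Suc.prems(4)[OF c(1)] by simp
qed

text \<open>Under \<open>iso\<close> both \<open>Y\<close> and its complement are lower parts, so
  the cochains of \<open>K\<close> split as a direct sum and primitives can be restricted to
  \<open>Y\<close>.\<close>

lemma cochain_exact_summand:
  assumes "Y \<subseteq> K" and iso: "\<And>G H. G \<in> K \<Longrightarrow> H \<in> K \<Longrightarrow> G \<subseteq> H \<Longrightarrow> G \<in> Y \<longleftrightarrow> H \<in> Y"
    and eK: "cochain_exact k K n"
  shows "cochain_exact (k :: 'b::comm_ring_1 itself) Y n"
  unfolding cochain_exact_def
proof (intro allI impI)
  fix z :: "_ \<Rightarrow> 'b"
  assume z: "supported_on Y z" and dz: "\<forall>G\<in>Y. card G = Suc n \<longrightarrow> coboundary z G = 0"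
  have dn: "down_in K Y" and dn': "down_in K (K - Y)"
    using assms(1) iso unfolding down_in_def by blast+
  have KKY: "K - (K - Y) = Y" using assms(1) by auto
  have dzK: "coboundary z G = 0" if "G \<in> K" "card G = Suc n" for G
    using dz coboundary_up_eq_0[OF dn', unfolded KKY, OF z, of G] that by blast
  obtain u where u: "supported_on K u"
      "\<And>G. G \<in> K \<Longrightarrow> card G = n \<Longrightarrow> z G = coboundary u G"
    using cochain_exactD[OF eK supported_on_mono[OF z assms(1)], OF dzK] by blast
  then show "\<exists>u. supported_on Y u \<and> (\<forall>G\<in>Y. card G = n \<longrightarrow> z G = coboundary u G)"
    using coboundary_restrict0_down[OF dn u(1)] assms(1)
    by (intro exI[of _ "restrict0 Y u"]) auto
qed

section \<open>Reduced homology over a field\<close>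

text \<open>Gaussian elimination on the unknowns indexed by \<open>I\<close>. Solvability is tested
  on relations among the rows, which is the form needed to dualise exactness.\<close>

lemma fredholm_alternative:
  fixes b :: "'j \<Rightarrow> 'i \<Rightarrow> 'k::field"
  assumes "finite I" "finite J"
    and "\<And>x. (\<And>i. i \<in> I \<Longrightarrow> (\<Sum>j\<in>J. x j * b j i) = 0) \<Longrightarrow> (\<Sum>j\<in>J. x j * y j) = 0"
  shows "\<exists>w. \<forall>j\<in>J. y j = (\<Sum>i\<in>I. b j i * w i)"
  using assms
proof (induction I arbitrary: J b y rule: finite_induct)
  case empty
  have "y j = 0" if "j \<in> J" for j
  proof -
    have "(\<Sum>i\<in>J. (if i = j then 1 else 0) * y i) = 0"
      by (rule empty.prems(2)) auto
    then show ?thesis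
      using that \<open>finite J\<close> by (simp add: if_distrib[of "\<lambda>t. t * _"] cong: if_cong)
  qed
  then show ?case by simp
next
  case (insert i0 I)
  show ?case
  proof (cases "\<forall>j\<in>J. b j i0 = 0")
    case True
    have "\<exists>w. \<forall>j\<in>J. y j = (\<Sum>i\<in>I. b j i * w i)"
      by (rule insert.IH[OF insert.prems(1)], rule insert.prems(2)) (use True in auto)
    then obtain w where w: "\<forall>j\<in>J. y j = (\<Sum>i\<in>I. b j i * w i)" by blast
    show ?thesis
      by (rule exI[of _ w]) (use w True insert.hyps in auto)
  next
    case False
    then obtain j0 where j0: "j0 \<in> J" "b j0 i0 \<noteq> 0" by blast
    define p where "p = b j0 i0"
    have p: "p \<noteq> 0" using j0 by (simp add: p_def)
    define b' where "b' j i = b j i - b j i0 / p * b j0 i" for j i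
    define y' where "y' j = y j - b j i0 / p * y j0" for j
    have "\<exists>w. \<forall>j\<in>J - {j0}. y' j = (\<Sum>i\<in>I. b' j i * w i)"
    proof (rule insert.IH)
      show "finite (J - {j0})" using insert.prems(1) by simp
      fix x assume x: "\<And>i. i \<in> I \<Longrightarrow> (\<Sum>j\<in>J - {j0}. x j * b' j i) = 0"
      \<comment> \<open>A relation among the reduced rows extends to all rows: the coefficient
        \<open>- (s / p)\<close> of the pivot row is chosen to cancel column
        \<open>i0\<close>.\<close>
      define s where "s = (\<Sum>j\<in>J - {j0}. x j * b j i0)"
      define x' where "x' j = (if j = j0 then - (s / p) else x j)" for j
      have x': "(\<Sum>j\<in>J. x' j * h j) = (\<Sum>j\<in>J - {j0}. x j * (h j - b j i0 / p * h j0))" for h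
      proof -
        have "(\<Sum>j\<in>J. x' j * h j) = - (s / p) * h j0 + (\<Sum>j\<in>J - {j0}. x' j * h j)"
          using j0 insert.prems(1) by (subst sum.remove[of _ j0]) (auto simp: x'_def)
        also have "(\<Sum>j\<in>J - {j0}. x' j * h j) = (\<Sum>j\<in>J - {j0}. x j * h j)"
          by (rule sum.cong) (auto simp: x'_def)
        also have "- (s / p) * h j0 = (\<Sum>j\<in>J - {j0}. - (x j * (b j i0 / p * h j0)))"
          unfolding s_def sum_divide_distrib sum_negf[symmetric] sum_distrib_right
          by (rule sum.cong) auto
        finally show ?thesis
          by (simp add: sum.distrib[symmetric] algebra_simps)
      qed
      have "(\<Sum>j\<in>J. x' j * y j) = 0"
      proof (rule insert.prems(2))
        fix i assume "i \<in> insert i0 I"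
        then show "(\<Sum>j\<in>J. x' j * b j i) = 0"
          using x[of i] p unfolding x' by (auto simp: b'_def p_def)
      qed
      then show "(\<Sum>j\<in>J - {j0}. x j * y' j) = 0"
        unfolding x' y'_def .
    qed
    then obtain w where w: "\<And>j. j \<in> J \<Longrightarrow> j \<noteq> j0 \<Longrightarrow> y' j = (\<Sum>i\<in>I. b' j i * w i)" by blast
    \<comment> \<open>Back substitution: the pivot equation determines the remaining
      unknown.\<close>
    define q where "q = (y j0 - (\<Sum>i\<in>I. b j0 i * w i)) / p"
    define w' where "w' i = (if i = i0 then q else w i)" for i
    have sum_w': "(\<Sum>i\<in>insert i0 I. b j i * w' i) = b j i0 * q + (\<Sum>i\<in>I. b j i * w i)" for j
    proof -
      have "(\<Sum>i\<in>I. b j i * w' i) = (\<Sum>i\<in>I. b j i * w i)"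
        by (rule sum.cong) (use insert.hyps in \<open>auto simp: w'_def\<close>)
      then show ?thesis using insert.hyps by (simp add: w'_def)
    qed
    have "y j = (\<Sum>i\<in>insert i0 I. b j i * w' i)" if j: "j \<in> J" for j
    proof (cases "j = j0")
      case True
      then show ?thesis unfolding sum_w' using p by (simp add: q_def p_def)
    next
      case False
      have "(\<Sum>i\<in>I. b' j i * w i) = (\<Sum>i\<in>I. b j i * w i) - b j i0 / p * (\<Sum>i\<in>I. b j0 i * w i)"
        by (simp add: b'_def sum_distrib_left sum_subtractf algebra_simps)
      then have "y j = b j i0 / p * y j0 + ((\<Sum>i\<in>I. b j i * w i) - b j i0 / p * (\<Sum>i\<in>I. b j0 i * w i))"
        using w[OF j False] by (simp add: y'_def algebra_simps)
      then show ?thesis unfolding sum_w' q_def using p by (simp add: field_simps)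
    qed
    then show ?thesis by blast
  qed
qed

text \<open>The common matrix of boundary and coboundary, which makes them visibly transposes of
  each other.\<close>

definition incidence :: "'a::linorder set \<Rightarrow> 'a set \<Rightarrow> 'k::comm_ring_1" where
  "incidence F H = (\<Sum>v\<in>F. if F - {v} = H then face_sign F v else 0)"

lemma incidence_nonzeroD:
  assumes "incidence F H \<noteq> (0 :: 'k::comm_ring_1)"
  shows "finite F" "H \<subseteq> F" "card F = Suc (card H)"
proof -
  show fin: "finite F"
    by (rule ccontr) (use assms in \<open>simp add: incidence_def\<close>)
  obtain v where "v \<in> F" "F - {v} = H"
  proof (rule ccontr)
    assume "\<not> thesis"
    then have "incidence F H = (0 :: 'k)"
      unfolding incidence_def by (intro sum.neutral) (use that in auto)
    then show False using assms by simp
  qed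
  then show "H \<subseteq> F" "card F = Suc (card H)"
    using fin card_Suc_Diff1[of F v] by auto
qed

lemma coboundary_eq_incidence:
  assumes "finite K" "supported_on K z"
  shows "coboundary z G = (\<Sum>H\<in>K. incidence G H * z H)"
proof (cases "finite G")
  case True
  have "(\<Sum>H\<in>K. incidence G H * z H) = (\<Sum>H\<in>K. \<Sum>v\<in>G. if G - {v} = H then face_sign G v * z H else 0)"
    by (simp add: incidence_def sum_distrib_right if_distrib[of "\<lambda>t. t * _"] cong: if_cong)
  also have "\<dots> = (\<Sum>v\<in>G. \<Sum>H\<in>K. if G - {v} = H then face_sign G v * z H else 0)"
    by (rule sum.swap)
  also have "\<dots> = coboundary z G"
    unfolding koszul_diff_def
    by (rule sum.cong) (use assms in \<open>auto simp: supported_on_def\<close>)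
  finally show ?thesis by simp
qed (simp add: koszul_diff_def incidence_def)

text \<open>The index set is free as long as it contains the support, so chains with different
  supports can be expanded over the same faces.\<close>

lemma lookup_simplicial_boundary:
  fixes c :: "'a::linorder set \<Rightarrow>\<^sub>0 'k::field"
  assumes "finite K" "keys c \<subseteq> K"
  shows "lookup (simplicial_boundary c) H =
    (\<Sum>F\<in>K. lookup c F * incidence F H)"
proof -
  have "lookup (simplicial_boundary c) H =
      (\<Sum>F\<in>keys c. lookup c F * incidence F H)"
    by (simp add: simplicial_boundary_def incidence_def lookup_sum lookup_single when_def
        face_sign_def sum_distrib_left if_distrib[of "\<lambda>t. _ * t"] mult.commute cong: if_cong)
  also have "\<dots> = (\<Sum>F\<in>K. lookup c F * incidence F H)"
    by (rule sum.mono_neutral_left) (use assms in \<open>auto simp: in_keys_iff\<close>)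
  finally show ?thesis .
qed

lemma lookup_sum_single:
  assumes "finite J"
  shows "lookup (\<Sum>F\<in>J. single F (f F)) H = (if H \<in> J then f H else 0)"
  using assms by (simp add: lookup_sum lookup_single when_def)

lemma simplicial_boundary_add:
  "simplicial_boundary (c + d) = simplicial_boundary c + simplicial_boundary d"
proof (rule poly_mapping_eqI)
  fix H
  let ?K = "keys c \<union> keys d"
  have "keys (c + d) \<subseteq> ?K" by (rule keys_add)
  moreover have "finite ?K" by simp
  ultimately show "lookup (simplicial_boundary (c + d)) H =
      lookup (simplicial_boundary c + simplicial_boundary d) H"
    using lookup_simplicial_boundary[of ?K "c + d" H] lookup_simplicial_boundary[of ?K c H]
      lookup_simplicial_boundary[of ?K d H]
    by (simp add: lookup_add sum.distrib distrib_right)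
qed

lemma keys_uminus: "keys (- c) = keys (c :: 'a \<Rightarrow>\<^sub>0 'b::ab_group_add)"
  by (auto simp: in_keys_iff)

lemma simplicial_boundary_uminus: "simplicial_boundary (- c) = - simplicial_boundary c"
  using lookup_simplicial_boundary[of "keys c" c]
    lookup_simplicial_boundary[of "keys c" "- c"]
  by (intro poly_mapping_eqI) (simp add: keys_uminus sum_negf)

lemma simplicial_chains_add:
  "c \<in> simplicial_chains k K i \<Longrightarrow> d \<in> simplicial_chains k K i \<Longrightarrow> c + d \<in> simplicial_chains k K i"
  unfolding simplicial_chains_def using keys_add[of c d] by blast

lemma simplicial_chains_uminus:
  "c \<in> simplicial_chains k K i \<Longrightarrow> - c \<in> simplicial_chains k K i"
  unfolding simplicial_chains_def by (simp add: keys_uminus)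

lemma image_eq_singleton_iff: "S \<noteq> {} \<Longrightarrow> f ` S = {b} \<longleftrightarrow> (\<forall>c\<in>S. f c = b)"
  by auto

text \<open>Elements of the factor group are cosets of the boundaries, and the coset of
  \<open>c\<close> is the trivial one exactly if \<open>c\<close> is itself a boundary.\<close>

lemma reduced_homology_trivial_iff:
  "carrier (reduced_homology k K i) = {\<one>\<^bsub>reduced_homology k K i\<^esub>} \<longleftrightarrow>
     (\<forall>c \<in> simplicial_chains k K i. simplicial_boundary c = 0 \<longrightarrow>
        c \<in> simplicial_boundary ` simplicial_chains k K (i + 1))"
proof -
  let ?B = "simplicial_boundary ` simplicial_chains k K (i + 1)"
  let ?Z = "{c \<in> simplicial_chains k K i. simplicial_boundary c = 0}"
  have B0: "0 \<in> ?B"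
    by (rule image_eqI[of _ _ 0]) (auto simp: simplicial_boundary_def simplicial_chains_def)
  have Badd: "a + b \<in> ?B" if "a \<in> ?B" "b \<in> ?B" for a b
    using that by (auto intro!: imageI simplicial_chains_add simp flip: simplicial_boundary_add)
  have Bneg: "- a \<in> ?B" if "a \<in> ?B" for a
    using that by (auto intro!: imageI simplicial_chains_uminus simp flip: simplicial_boundary_uminus)
  have coset: "(\<lambda>h. h + c) ` ?B = ?B \<longleftrightarrow> c \<in> ?B" for c
  proof
    assume "(\<lambda>h. h + c) ` ?B = ?B"
    moreover have "c \<in> (\<lambda>h. h + c) ` ?B" by (rule image_eqI[of _ _ 0, OF _ B0]) simp
    ultimately show "c \<in> ?B" by simp
  next
    assume c: "c \<in> ?B"
    show "(\<lambda>h. h + c) ` ?B = ?B"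
    proof (intro equalityI subsetI)
      fix b assume "b \<in> ?B"
      then have "b + - c \<in> ?B" using Badd Bneg c by blast
      then show "b \<in> (\<lambda>h. h + c) ` ?B" by (rule image_eqI[of _ _ "b + - c", rotated]) simp
    qed (use Badd c in auto)
  qed
  have car: "carrier (reduced_homology k K i) = (\<lambda>c. (\<lambda>h. h + c) ` ?B) ` ?Z"
    by (auto simp: reduced_homology_def FactGroup_def RCOSETS_def r_coset_def cycle_group_def)
  have one: "\<one>\<^bsub>reduced_homology k K i\<^esub> = ?B"
    by (simp add: reduced_homology_def FactGroup_def)
  have "0 \<in> ?Z" by (simp add: simplicial_chains_def simplicial_boundary_def)
  then have "?Z \<noteq> {}" by blast
  then have "carrier (reduced_homology k K i) = {?B} \<longleftrightarrow> (\<forall>c\<in>?Z. (\<lambda>h. h + c) ` ?B = ?B)"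
    unfolding car by (rule image_eq_singleton_iff)
  then show ?thesis unfolding one coset by auto
qed

text \<open>Over a field, chains and cochains of a finite complex are dual vector spaces, so exactness
  passes from one to the other.\<close>

lemma reduced_homology_trivial_iff_cochain_exact:
  fixes k :: "'k::field itself" and K :: "'a::linorder set set"
  assumes fin: "finite K" "\<And>F. F \<in> K \<Longrightarrow> finite F"
    and down: "\<And>F H. F \<in> K \<Longrightarrow> H \<subseteq> F \<Longrightarrow> H \<in> K"
  shows "carrier (reduced_homology k K (int n - 1)) = {\<one>\<^bsub>reduced_homology k K (int n - 1)\<^esub>} \<longleftrightarrow>
    cochain_exact k K n"
proof -
  define I where "I = {F \<in> K. card F = Suc n}"
  define J where "J = {F \<in> K. card F = n}"
  \<comment> \<open>Written with \<open>Suc\<close> so that there is nothing below level 0.\<close>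
  define L where "L = {F \<in> K. Suc (card F) = n}"
  have finI: "finite I" and finJ: "finite J" and finL: "finite L"
    using fin(1) by (simp_all add: I_def J_def L_def)
  have chJ: "c \<in> simplicial_chains k K (int n - 1) \<longleftrightarrow> keys c \<subseteq> J" for c
    using fin(2) by (auto simp: simplicial_chains_def J_def)
  have chI: "c \<in> simplicial_chains k K (int n) \<longleftrightarrow> keys c \<subseteq> I" for c
    using fin(2) by (auto simp: simplicial_chains_def I_def)
  have inc_I: "incidence F H = (0 :: 'k)" if "F \<in> I" "H \<notin> J" for F H
    using incidence_nonzeroD(2,3)[of F H, where ?'k = 'k] that down
    by (fastforce simp: I_def J_def)
  have inc_J: "incidence F H = (0 :: 'k)" if "F \<in> J" "H \<notin> L" for F H
    using incidence_nonzeroD(2,3)[of F H, where ?'k = 'k] that down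
    by (fastforce simp: J_def L_def)
  have cobI: "coboundary z G = (\<Sum>H\<in>J. incidence G H * z H)"
    if "supported_on K z" "G \<in> I" for z :: "'a set \<Rightarrow> 'k" and G
    unfolding coboundary_eq_incidence[OF fin(1) that(1)]
    by (rule sum.mono_neutral_right) (use inc_I that fin(1) in \<open>auto simp: J_def\<close>)
  have cobJ: "coboundary z G = (\<Sum>H\<in>L. incidence G H * z H)"
    if "supported_on K z" "G \<in> J" for z :: "'a set \<Rightarrow> 'k" and G
    unfolding coboundary_eq_incidence[OF fin(1) that(1)]
    by (rule sum.mono_neutral_right) (use inc_J that fin(1) in \<open>auto simp: L_def\<close>)
  have keys: "keys (\<Sum>F\<in>S. single F (f F)) \<subseteq> S"
    if "finite S" for S and f :: "'a set \<Rightarrow> 'k"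
    using that by (auto simp: in_keys_iff lookup_sum_single split: if_splits)
  have "(\<forall>c. keys c \<subseteq> J \<longrightarrow> simplicial_boundary c = 0 \<longrightarrow>
          (\<exists>d. keys d \<subseteq> I \<and> c = simplicial_boundary (d :: 'a set \<Rightarrow>\<^sub>0 'k))) \<longleftrightarrow>
      cochain_exact k K n" (is "?L \<longleftrightarrow> ?R")
  proof
    assume L: ?L
    show ?R
      unfolding cochain_exact_def
    proof (intro allI impI)
      fix z :: "'a set \<Rightarrow> 'k"
      assume z: "supported_on K z" and dz: "\<forall>G\<in>K. card G = Suc n \<longrightarrow> coboundary z G = 0"
      \<comment> \<open>A relation \<open>x\<close> is a cycle, hence a boundary by assumption, and
        the cocycle \<open>z\<close> pairs to zero with boundaries.\<close>
      have "\<exists>w. \<forall>j\<in>J. z j = (\<Sum>i\<in>L. incidence j i * w i)"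
      proof (rule fredholm_alternative[OF finL finJ])
        fix x :: "'a set \<Rightarrow> 'k" assume x: "\<And>i. i \<in> L \<Longrightarrow> (\<Sum>j\<in>J. x j * incidence j i) = 0"
        define c where "c = (\<Sum>F\<in>J. single F (x F))"
        have lc: "lookup c F = x F" if "F \<in> J" for F
          using that finJ by (simp add: c_def lookup_sum_single)
        have kc: "keys c \<subseteq> J" unfolding c_def by (rule keys[OF finJ])
        have "simplicial_boundary c = 0"
        proof (rule poly_mapping_eqI)
          fix H
          have "(\<Sum>F\<in>J. lookup c F * incidence F H) = 0"
          proof (cases "H \<in> L")
            case True
            then show ?thesis using x[OF True] lc by simp
          qed (simp add: inc_J)
          then show "lookup (simplicial_boundary c) H = lookup 0 H"
            by (simp add: lookup_simplicial_boundary[OF finJ kc])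
        qed
        then obtain d :: "'a set \<Rightarrow>\<^sub>0 'k" where d: "keys d \<subseteq> I" "c = simplicial_boundary d"
          using L kc by blast
        have "(\<Sum>j\<in>J. x j * z j) = (\<Sum>j\<in>J. \<Sum>F\<in>I. lookup d F * (incidence F j * z j))"
          using lc by (simp add: d(2) lookup_simplicial_boundary[OF finI d(1)] sum_distrib_right mult.assoc
            flip: lc)
        also have "\<dots> = (\<Sum>F\<in>I. lookup d F * (\<Sum>j\<in>J. incidence F j * z j))"
          by (subst sum.swap) (simp add: sum_distrib_left)
        also have "\<dots> = 0"
          using dz cobI[OF z] by (intro sum.neutral) (auto simp: I_def)
        finally show "(\<Sum>j\<in>J. x j * z j) = 0" .
      qed
      then obtain w where w: "\<And>j. j \<in> J \<Longrightarrow> z j = (\<Sum>i\<in>L. incidence j i * w i)" by blast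
      have sup: "supported_on K (restrict0 L w)"
        by (rule supported_on_mono[OF supported_on_restrict0]) (auto simp: L_def)
      have "z G = coboundary (restrict0 L w) G" if "G \<in> J" for G
        using w[OF that] by (simp add: cobJ[OF sup that])
      then show "\<exists>u. supported_on K u \<and> (\<forall>G\<in>K. card G = n \<longrightarrow> z G = coboundary u G)"
        using sup by (intro exI[of _ "restrict0 L w"]) (auto simp: J_def)
    qed
  next
    assume R: ?R
    show ?L
    proof (intro allI impI)
      fix c :: "'a set \<Rightarrow>\<^sub>0 'k" assume c: "keys c \<subseteq> J" "simplicial_boundary c = 0"
      \<comment> \<open>Dually, a relation \<open>x\<close> is now a cocycle, hence a coboundary,
        and pairs to zero with the cycle \<open>c\<close>.\<close>
      have "\<exists>w. \<forall>j\<in>J. lookup c j = (\<Sum>i\<in>I. incidence i j * w i)"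
      proof (rule fredholm_alternative[OF finI finJ])
        fix x :: "'a set \<Rightarrow> 'k" assume x: "\<And>i. i \<in> I \<Longrightarrow> (\<Sum>j\<in>J. x j * incidence i j) = 0"
        have sup: "supported_on K (restrict0 J x)"
          by (rule supported_on_mono[OF supported_on_restrict0]) (auto simp: J_def)
        have "coboundary (restrict0 J x) G = 0" if "G \<in> K" "card G = Suc n" for G
        proof -
          have "G \<in> I" using that by (simp add: I_def)
          then show ?thesis using x[of G] by (simp add: cobI[OF sup] mult.commute)
        qed
        from cochain_exactD[OF R sup this] obtain u where u: "supported_on K u"
            "\<And>G. G \<in> J \<Longrightarrow> x G = coboundary u G"
          by (auto simp: J_def restrict0_def)
        have "(\<Sum>j\<in>J. x j * lookup c j) =
            (\<Sum>j\<in>J. \<Sum>H\<in>L. u H * (lookup c j * incidence j H))"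
          using u(2) cobJ[OF u(1)] by (simp add: sum_distrib_left mult_ac)
        also have "\<dots> = (\<Sum>H\<in>L. u H * lookup (simplicial_boundary c) H)"
          by (subst sum.swap) (simp add: sum_distrib_left lookup_simplicial_boundary[OF finJ c(1)])
        also have "\<dots> = 0" by (simp add: c(2))
        finally show "(\<Sum>j\<in>J. x j * lookup c j) = 0" .
      qed
      then obtain w where w: "\<And>j. j \<in> J \<Longrightarrow> lookup c j = (\<Sum>i\<in>I. incidence i j * w i)"
        by blast
      define d where "d = (\<Sum>F\<in>I. single F (w F))"
      have kd: "keys d \<subseteq> I" unfolding d_def by (rule keys[OF finI])
      have "c = simplicial_boundary d"
      proof (rule poly_mapping_eqI)
        fix H
        have "lookup (simplicial_boundary d) H = (\<Sum>F\<in>I. w F * incidence F H)"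
          unfolding lookup_simplicial_boundary[OF finI kd]
          by (rule sum.cong) (simp_all add: d_def lookup_sum_single[OF finI])
        moreover have "lookup c H = (\<Sum>F\<in>I. w F * incidence F H)"
        proof (cases "H \<in> J")
          case True
          then show ?thesis by (simp add: w mult.commute)
        next
          case False
          then have "lookup c H = 0" using c(1) by (auto simp: in_keys_iff)
          then show ?thesis using False by (simp add: inc_I)
        qed
        ultimately show "lookup c H = lookup (simplicial_boundary d) H" by simp
      qed
      then show "\<exists>d. keys d \<subseteq> I \<and> c = simplicial_boundary d" using kd by blast
    qed
  qed
  then show ?thesis
    unfolding reduced_homology_trivial_iff Ball_def chJ by (auto simp: image_iff chI Bex_def)
qed

section \<open>Nerves of the facet cover\<close>

lemma cochain_exact_empty_level:
  assumes "\<And>G. G \<in> K \<Longrightarrow> card G \<noteq> n"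
  shows "cochain_exact k K n"
  unfolding cochain_exact_def using assms by (auto simp: supported_on_def intro: exI[of _ "\<lambda>_. 0"])

lemma face_sign_union_greater:
  assumes "\<And>w. w \<in> W \<Longrightarrow> v < w"
  shows "face_sign (F \<union> W) v = face_sign F v"
proof -
  have "{w \<in> F \<union> W. w < v} = {w \<in> F. w < v}" using assms by force
  then show ?thesis by (simp add: face_sign_def)
qed

text \<open>Removing a vertex of \<open>W\<close> leaves the family, and the vertices of
  \<open>W\<close> come after those of \<open>F\<close>, so the coboundary at
  \<open>F \<union> W\<close> is the one at \<open>F\<close> with the same signs.\<close>

lemma cochain_exact_join_simplex:
  fixes K :: "'a::linorder set set" and k :: "'b::comm_ring_1 itself"
  assumes W: "finite W" and less: "\<And>F v w. F \<in> K \<Longrightarrow> v \<in> F \<Longrightarrow> w \<in> W \<Longrightarrow> v < w"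
    and fin: "\<And>F. F \<in> K \<Longrightarrow> finite F"
  shows "cochain_exact k ((\<lambda>F. F \<union> W) ` K) (n + card W) \<longleftrightarrow> cochain_exact k K n"
proof -
  let ?J = "(\<lambda>F. F \<union> W) ` K"
  have disj: "F \<inter> W = {}" if "F \<in> K" for F using less[OF that] by blast
  have cd: "card (F \<union> W) = card F + card W" if "F \<in> K" for F
    using disj[OF that] W fin[OF that] by (simp add: card_Un_disjoint)
  have un_diff: "F \<union> W - W = F" if "F \<in> K" for F using disj[OF that] by blast
  have bd: "coboundary y (F \<union> W) = coboundary z F"
    if y: "supported_on ?J y" and z: "supported_on K z" and eq: "\<And>F. F \<in> K \<Longrightarrow> y (F \<union> W) = z F"
      and F: "F \<in> K" for y z :: "'a set \<Rightarrow> 'b" and F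
  proof -
    have "coboundary y (F \<union> W) = (\<Sum>v\<in>F. face_sign (F \<union> W) v * 1 * y (F \<union> W - {v}))"
      unfolding koszul_diff_def
    proof (rule sum.mono_neutral_right)
      show "\<forall>v\<in>F \<union> W - F. face_sign (F \<union> W) v * 1 * y (F \<union> W - {v}) = 0"
      proof
        fix v assume "v \<in> F \<union> W - F"
        then have "F \<union> W - {v} \<notin> ?J" by auto
        then show "face_sign (F \<union> W) v * 1 * y (F \<union> W - {v}) = 0" using supported_onD[OF y] by simp
      qed
    qed (use W fin[OF F] in auto)
    also have "\<dots> = coboundary z F"
      unfolding koszul_diff_def
    proof (rule sum.cong[OF refl])
      fix v assume v: "v \<in> F"
      have e: "F \<union> W - {v} = (F - {v}) \<union> W" using disj[OF F] v by blast
      have "y ((F - {v}) \<union> W) = z (F - {v})"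
      proof (cases "F - {v} \<in> K")
        case False
        have "(F - {v}) \<union> W \<notin> ?J"
        proof
          assume "(F - {v}) \<union> W \<in> ?J"
          then obtain F' where F': "F' \<in> K" "(F - {v}) \<union> W = F' \<union> W" by auto
          then have "F - {v} = F'" using disj[OF F] disj[OF F'(1)] by blast
          then show False using False F' by simp
        qed
        then show ?thesis using False supported_onD[OF y] supported_onD[OF z] by simp
      qed (rule eq)
      then show "face_sign (F \<union> W) v * 1 * y (F \<union> W - {v}) = face_sign F v * 1 * z (F - {v})"
        using less[OF F v] by (simp add: e face_sign_union_greater)
    qed
    finally show ?thesis .
  qed
  define up :: "('a set \<Rightarrow> 'b) \<Rightarrow> 'a set \<Rightarrow> 'b" where "up z = restrict0 ?J (\<lambda>G. z (G - W))" for z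
  define dn :: "('a set \<Rightarrow> 'b) \<Rightarrow> 'a set \<Rightarrow> 'b" where "dn y = restrict0 K (\<lambda>F. y (F \<union> W))" for y
  have up: "supported_on ?J (up z)" "F \<in> K \<Longrightarrow> up z (F \<union> W) = z F" for z F
    by (simp_all add: up_def un_diff)
  have dn: "supported_on K (dn z)" "F \<in> K \<Longrightarrow> z (F \<union> W) = dn z F" for z F
    by (simp_all add: dn_def)
  show ?thesis
  proof
    assume J: "cochain_exact k ?J (n + card W)"
    show "cochain_exact k K n"
      unfolding cochain_exact_def
    proof (intro allI impI)
      fix z :: "'a set \<Rightarrow> 'b"
      assume z: "supported_on K z" and dz: "\<forall>G\<in>K. card G = Suc n \<longrightarrow> coboundary z G = 0"
      have c0: "coboundary (up z) G = 0" if "G \<in> ?J" "card G = Suc (n + card W)" for G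
        using that dz bd[OF up(1) z up(2)] cd by auto
      obtain u where u: "supported_on ?J u"
          "\<And>G. G \<in> ?J \<Longrightarrow> card G = n + card W \<Longrightarrow> up z G = coboundary u G"
        using cochain_exactD[OF J up(1) c0] by blast
      show "\<exists>u. supported_on K u \<and> (\<forall>G\<in>K. card G = n \<longrightarrow> z G = coboundary u G)"
      proof (intro exI[of _ "dn u"] conjI ballI impI dn(1))
        fix G assume G: "G \<in> K" "card G = n"
        have "z G = up z (G \<union> W)" using G up(2) by simp
        also have "\<dots> = coboundary u (G \<union> W)" using u(2)[of "G \<union> W"] G cd by auto
        also have "\<dots> = coboundary (dn u) G" by (rule bd[OF u(1) dn(1) dn(2) G(1)])
        finally show "z G = coboundary (dn u) G" .
      qed
    qed
  next
    assume K: "cochain_exact k K n"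
    show "cochain_exact k ?J (n + card W)"
      unfolding cochain_exact_def
    proof (intro allI impI)
      fix y :: "'a set \<Rightarrow> 'b"
      assume y: "supported_on ?J y"
        and dy: "\<forall>G\<in>?J. card G = Suc (n + card W) \<longrightarrow> coboundary y G = 0"
      have c0: "coboundary (dn y) F = 0" if "F \<in> K" "card F = Suc n" for F
        using that dy bd[OF y dn(1) dn(2)] cd by auto
      obtain u where u: "supported_on K u"
          "\<And>G. G \<in> K \<Longrightarrow> card G = n \<Longrightarrow> dn y G = coboundary u G"
        using cochain_exactD[OF K dn(1) c0] by blast
      show "\<exists>u. supported_on ?J u \<and> (\<forall>G\<in>?J. card G = n + card W \<longrightarrow> y G = coboundary u G)"
      proof (intro exI[of _ "up u"] conjI ballI impI up(1))
        fix G assume G: "G \<in> ?J" "card G = n + card W"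
        then obtain F where F: "F \<in> K" "G = F \<union> W" by auto
        then have "card F = n" using G cd by auto
        then show "y G = coboundary (up u) G"
          using u(2)[OF F(1)] bd[OF up(1) u(1) up(2) F(1)] dn(2)[OF F(1)] F by simp
      qed
    qed
  qed
qed

lemma cochain_exact_up_iff:
  assumes "convex_family K" "down_in K D" "\<And>n. cochain_exact k K n"
  shows "cochain_exact (k :: 'b::comm_ring_1 itself) (K - D) (Suc n) \<longleftrightarrow> cochain_exact k D n"
  using assms cochain_exact_up cochain_exact_down by metis

text \<open>The long exact sequence with an acyclic lower part. At level 0, which has no preceding
  term, both sides hold because no set of cardinality 0 is present.\<close>

lemma cochain_exact_minus_iff:
  assumes "convex_family K" "down_in K D" "\<And>n. cochain_exact k D n"
    and "\<And>G. G \<in> K \<Longrightarrow> card G \<noteq> 0"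
  shows "cochain_exact (k :: 'b::comm_ring_1 itself) (K - D) n \<longleftrightarrow> cochain_exact k K n"
proof (cases n)
  case 0
  have "cochain_exact k K' 0" if "K' \<subseteq> K" for K'
    by (rule cochain_exact_empty_level) (use that assms(4) in auto)
  then show ?thesis using 0 by blast
next
  case (Suc m)
  then show ?thesis
    using assms cochain_exact_up[OF assms(1,2)] cochain_exact_extension[OF assms(1,2)] by metis
qed

text \<open>The vertices lie above the indices \<open>{1..r}\<close>, so \<open>F\<close> and
  \<open>G\<close> can be recovered from \<open>F \<union> G\<close>, and \<open>F\<close> precedes
  \<open>G\<close> in the orientation. The sets \<open>A j\<close> will be the facets.\<close>

locale covered_complex =
  fixes r :: nat and N :: "nat set" and \<Delta> :: "nat set set" and A :: "nat \<Rightarrow> nat set"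
  assumes finN: "finite N" and above: "\<And>v. v \<in> N \<Longrightarrow> r < v"
    and r_pos: "r \<ge> 1"
    and A_sub: "\<And>j. j \<in> {1..r} \<Longrightarrow> A j \<subseteq> N"
    and \<Delta>_iff: "\<And>U. U \<in> \<Delta> \<longleftrightarrow> (\<exists>j\<in>{1..r}. U \<subseteq> A j)"
begin

definition common :: "nat set \<Rightarrow> nat set" where
  "common F = (\<Inter>j\<in>F. A j)"

definition stars :: "nat set \<Rightarrow> nat set set" where
  "stars W = {G. W \<subseteq> G \<and> G \<subseteq> N \<and> G - W \<in> \<Delta>}"

text \<open>The empty index set is left out: \<open>common {}\<close> is \<open>UNIV\<close>, and
  its contribution to the double complex is \<open>stars W\<close> itself.\<close>

definition nerve_part :: "(nat set \<Rightarrow> bool) \<Rightarrow> nat set set" where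
  "nerve_part P = {F. F \<subseteq> {1..r} \<and> F \<noteq> {} \<and> P (common F)}"

lemma common_antimono: "F \<subseteq> F' \<Longrightarrow> common F' \<subseteq> common F"
  by (auto simp: common_def)

lemma common_sub: "F \<subseteq> {1..r} \<Longrightarrow> F \<noteq> {} \<Longrightarrow> common F \<subseteq> N"
  using A_sub unfolding common_def by (meson INF_lower2 equals0I subsetD)

lemma finite_common: "F \<subseteq> {1..r} \<Longrightarrow> F \<noteq> {} \<Longrightarrow> finite (common F)"
  using common_sub finN by (rule finite_subset)

lemma finite_nerve_part: "finite (nerve_part P)"
  by (rule finite_subset[of _ "Pow {1..r}"]) (auto simp: nerve_part_def)

lemma disjoint_N: "{1..r} \<inter> N = {}"
  using above by force

text \<open>The family of pairs \<open>(G, F)\<close> with \<open>G - W \<subseteq> common F\<close>, encoded as unions \<open>F \<union> G\<close>. Filtering it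
  by \<open>G\<close> exhibits it as acyclic, filtering its part with \<open>F \<noteq> {}\<close> by \<open>F\<close> reduces that part to
  \<open>G = W\<close>.\<close>

definition pairs :: "nat set \<Rightarrow> nat set set" where
  "pairs W = {H. H \<subseteq> {1..r} \<union> N \<and> H \<inter> N \<in> stars W \<and> H \<inter> N - W \<subseteq> common (H \<inter> {1..r})}"

lemma stars_down: "G \<in> stars W \<Longrightarrow> W \<subseteq> H \<Longrightarrow> H \<subseteq> G \<Longrightarrow> H \<in> stars W"
  unfolding stars_def \<Delta>_iff by blast

lemma convex_pairs: "convex_family (pairs W)"
  unfolding convex_family_def
proof (intro ballI allI impI)
  fix F H G assume F: "F \<in> pairs W" and H: "H \<in> pairs W" and FG: "F \<subseteq> G" and GH: "G \<subseteq> H"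
  have "W \<subseteq> G \<inter> N" using F FG by (auto simp: pairs_def stars_def)
  then have "G \<inter> N \<in> stars W" using H GH by (auto simp: pairs_def intro: stars_down[of "H \<inter> N"])
  moreover have "common (H \<inter> {1..r}) \<subseteq> common (G \<inter> {1..r})" using GH by (intro common_antimono) auto
  ultimately show "G \<in> pairs W" using H GH by (auto simp: pairs_def)
qed

lemma finite_pairs: "H \<in> pairs W \<Longrightarrow> finite H" "finite (pairs W)"
proof -
  have "finite ({1..r} \<union> N)" using finN by simp
  then show "finite (pairs W)" "H \<in> pairs W \<Longrightarrow> finite H"
    by (auto simp: pairs_def intro: finite_subset[of _ "Pow ({1..r} \<union> N)"] rev_finite_subset)
qed

text \<open>Over a fixed \<open>G\<close> the admissible index sets are all subsets of
  \<open>{j. G - W \<subseteq> A j}\<close>, the empty one included. Some such \<open>j\<close>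
  exists because \<open>G - W\<close> is a face, and it is a cone point.\<close>

lemma pairs_exact: "cochain_exact (k :: 'k::field itself) (pairs W) n"
proof (rule cochain_exact_fibres[OF convex_pairs, where g = "\<lambda>H. H \<inter> N"])
  show "finite ((\<lambda>H. H \<inter> N) ` pairs W)" using finite_pairs by simp
  fix G assume "G \<in> (\<lambda>H. H \<inter> N) ` pairs W"
  then have G: "G \<in> stars W" "G \<subseteq> N" by (auto simp: pairs_def)
  then obtain j where j: "j \<in> {1..r}" "G - W \<subseteq> A j" by (auto simp: stars_def \<Delta>_iff)
  then have "j \<notin> N" using disjoint_N by blast
  have common_ins: "common (insert j F) = A j \<inter> common F" for F by (auto simp: common_def)
  show "cochain_exact k {H \<in> pairs W. H \<inter> N = G} n"
  proof (rule cochain_exact_cone[of _ j])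
    fix H assume H: "H \<in> {H \<in> pairs W. H \<inter> N = G}"
    then show "finite H" using finite_pairs by blast
    have e: "insert j H \<inter> N = H \<inter> N" "(H - {j}) \<inter> N = H \<inter> N" using \<open>j \<notin> N\<close> by auto
    have e2: "insert j H \<inter> {1..r} = insert j (H \<inter> {1..r})" using j by auto
    have "common (H \<inter> {1..r}) \<subseteq> common ((H - {j}) \<inter> {1..r})" by (rule common_antimono) auto
    then show "H - {j} \<in> {H \<in> pairs W. H \<inter> N = G}"
      using H unfolding pairs_def mem_Collect_eq e by auto
    show "insert j H \<in> {H \<in> pairs W. H \<inter> N = G}"
      using H j unfolding pairs_def mem_Collect_eq e e2 common_ins by auto
  qed
qed auto

text \<open>\<open>stars W\<close> is the part \<open>F = {}\<close> of the acyclic family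
  \<open>pairs W\<close>, so its cohomology is that of the complement one level higher; this is the
  origin of \<open>Suc i\<close>.\<close>

lemma stars_exact_iff:
  assumes W: "W \<subseteq> N"
  shows "cochain_exact (k :: 'k::field itself) (stars W) i \<longleftrightarrow>
    cochain_exact k ((\<lambda>F. F \<union> W) ` nerve_part (\<lambda>B. B \<subseteq> W)) (Suc i)"
proof -
  define U where "U = pairs W - stars W"
  have stars_pairs: "stars W = {H \<in> pairs W. H \<inter> {1..r} = {}}"
  proof (intro equalityI subsetI)
    fix H assume H: "H \<in> stars W"
    then have "H \<inter> N = H" "H \<inter> {1..r} = {}" using disjoint_N by (auto simp: stars_def)
    then show "H \<in> {H \<in> pairs W. H \<inter> {1..r} = {}}"
      using H by (auto simp: pairs_def common_def)
  next
    fix H assume H: "H \<in> {H \<in> pairs W. H \<inter> {1..r} = {}}"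
    then have "H \<inter> N = H" by (auto simp: pairs_def)
    then show "H \<in> stars W" using H by (simp add: pairs_def)
  qed
  have dn: "down_in (pairs W) (stars W)"
    unfolding stars_pairs down_in_def by blast
  have "cochain_exact k (stars W) i \<longleftrightarrow> cochain_exact k U (Suc i)"
    unfolding U_def using cochain_exact_up_iff[OF convex_pairs dn pairs_exact] by blast
  \<comment> \<open>The pairs with \<open>common F\<close> not inside \<open>W\<close> form a lower
    part, since enlarging \<open>F\<close> shrinks \<open>common F\<close>. It is acyclic: over a
    fixed \<open>F\<close>, a vertex of \<open>common F - W\<close> may be inserted into
    \<open>G\<close> or removed from it.\<close>
  also have "\<dots> \<longleftrightarrow> cochain_exact k (U - {H \<in> U. \<not> common (H \<inter> {1..r}) \<subseteq> W}) (Suc i)"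
  proof (rule cochain_exact_minus_iff[symmetric])
    let ?D = "{H \<in> U. \<not> common (H \<inter> {1..r}) \<subseteq> W}"
    show cU: "convex_family U"
      unfolding U_def by (rule convex_family_subset_down(2)[OF convex_pairs dn])
    show dD: "down_in U ?D"
      unfolding down_in_def
    proof (intro conjI ballI impI)
      fix G H assume G: "G \<in> ?D" and H: "H \<in> U" "H \<subseteq> G"
      have "common (G \<inter> {1..r}) \<subseteq> common (H \<inter> {1..r})" using H by (intro common_antimono) auto
      then show "H \<in> ?D" using G H by auto
    qed auto
    show "card G \<noteq> 0" if "G \<in> U" for G
      using that finite_pairs unfolding U_def stars_pairs by auto
    show "cochain_exact k ?D n" for n
    proof (rule cochain_exact_fibres[where g = "\<lambda>H. H \<inter> {1..r}"])
      show "convex_family ?D" by (rule convex_family_subset_down(1)[OF cU dD])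
      show "finite ((\<lambda>H. H \<inter> {1..r}) ` ?D)"
        using finite_pairs(2)[of W] by (intro finite_imageI) (simp add: U_def)
      fix F assume "F \<in> (\<lambda>H. H \<inter> {1..r}) ` ?D"
      then have F: "F \<subseteq> {1..r}" "F \<noteq> {}" "\<not> common F \<subseteq> W"
        by (auto simp: U_def stars_pairs)
      then obtain v where v: "v \<in> common F" "v \<notin> W" by auto
      then have vN: "v \<in> N" using common_sub F by blast
      then have vr: "v \<notin> {1..r}" using disjoint_N by blast
      obtain j where j: "j \<in> F" using F by auto
      show "cochain_exact k {H \<in> ?D. H \<inter> {1..r} = F} n"
      proof (rule cochain_exact_cone[of _ v])
        fix H assume H: "H \<in> {H \<in> ?D. H \<inter> {1..r} = F}"
        then show "finite H" using finite_pairs unfolding U_def by blast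
        have e: "insert v H \<inter> {1..r} = H \<inter> {1..r}" "(H - {v}) \<inter> {1..r} = H \<inter> {1..r}"
          using vr by auto
        have HF: "H \<inter> {1..r} = F" "H \<in> pairs W" using H by (auto simp: U_def)
        have "insert v H \<in> pairs W"
        proof -
          have sub: "insert v H \<inter> N - W \<subseteq> common F"
            using HF v by (auto simp: pairs_def)
          then have "insert v H \<inter> N - W \<subseteq> A j" using j by (auto simp: common_def)
          then have "insert v H \<inter> N \<in> stars W"
            using HF(2) F j unfolding pairs_def stars_def \<Delta>_iff by blast
          then show ?thesis using sub HF vN unfolding pairs_def mem_Collect_eq e by auto
        qed
        then show "insert v H \<in> {H \<in> ?D. H \<inter> {1..r} = F}"
          using H unfolding U_def stars_pairs mem_Collect_eq Diff_iff e by auto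
        have HN: "H \<inter> N \<in> stars W" using HF(2) by (simp add: pairs_def)
        then have "W \<subseteq> (H - {v}) \<inter> N" using v by (auto simp: stars_def)
        then have "(H - {v}) \<inter> N \<in> stars W" by (rule stars_down[OF HN]) auto
        then have "H - {v} \<in> pairs W"
          using HF unfolding pairs_def mem_Collect_eq e by auto
        then show "H - {v} \<in> {H \<in> ?D. H \<inter> {1..r} = F}"
          using H unfolding U_def stars_pairs mem_Collect_eq Diff_iff e by auto
      qed
    qed auto
  qed
  \<comment> \<open>What is left satisfies \<open>G - W \<subseteq> common F \<subseteq> W\<close>,
    which forces \<open>G = W\<close>.\<close>
  also have "U - {H \<in> U. \<not> common (H \<inter> {1..r}) \<subseteq> W} = (\<lambda>F. F \<union> W) ` nerve_part (\<lambda>B. B \<subseteq> W)"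
  proof (intro equalityI subsetI)
    fix H assume "H \<in> U - {H \<in> U. \<not> common (H \<inter> {1..r}) \<subseteq> W}"
    then have H: "H \<in> pairs W" "H \<inter> {1..r} \<noteq> {}" "common (H \<inter> {1..r}) \<subseteq> W"
      by (auto simp: U_def stars_pairs)
    then have "H = (H \<inter> {1..r}) \<union> W" by (auto simp: pairs_def stars_def)
    then show "H \<in> (\<lambda>F. F \<union> W) ` nerve_part (\<lambda>B. B \<subseteq> W)"
      by (rule image_eqI) (use H in \<open>auto simp: nerve_part_def\<close>)
  next
    fix H assume "H \<in> (\<lambda>F. F \<union> W) ` nerve_part (\<lambda>B. B \<subseteq> W)"
    then obtain F where F: "H = F \<union> W" "F \<subseteq> {1..r}" "F \<noteq> {}" "common F \<subseteq> W"
      by (auto simp: nerve_part_def)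
    have e: "H \<inter> {1..r} = F" "H \<inter> N = W" using F W disjoint_N by auto
    have "W \<in> stars W" using W r_pos by (auto simp: stars_def \<Delta>_iff)
    then have HP: "H \<in> pairs W"
      unfolding pairs_def mem_Collect_eq e using F(1,2) W by auto
    show "H \<in> U - {H \<in> U. \<not> common (H \<inter> {1..r}) \<subseteq> W}"
      using F HP unfolding U_def stars_pairs Diff_iff mem_Collect_eq e by simp
  qed
  finally show ?thesis .
qed

lemma nerve_part_less:
  assumes "W \<subseteq> N" "F \<in> nerve_part P" "v \<in> F" "w \<in> W"
  shows "v < w"
  using assms above[of w] by (force simp: nerve_part_def)

text \<open>The sets \<open>F \<union> W\<close> at level \<open>Suc i\<close> have
  \<open>card F + card W = Suc i\<close>, which turns the strict bound on \<open>i\<close> into a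
  weak one on \<open>n + card W\<close>.\<close>

lemma all_stars_exact_iff:
  "(\<forall>W i. W \<subseteq> N \<longrightarrow> i < d \<longrightarrow> cochain_exact (k :: 'k::field itself) (stars W) i) \<longleftrightarrow>
   (\<forall>W n. W \<subseteq> N \<longrightarrow> n + card W \<le> d \<longrightarrow> cochain_exact k (nerve_part (\<lambda>B. B \<subseteq> W)) n)"
proof -
  have step: "cochain_exact k (stars W) i \<longleftrightarrow>
      (\<forall>n. n + card W = Suc i \<longrightarrow> cochain_exact k (nerve_part (\<lambda>B. B \<subseteq> W)) n)"
    if W: "W \<subseteq> N" for W i
  proof -
    have fW: "finite W" using W finN by (rule finite_subset)
    have fF: "finite F" if "F \<in> nerve_part P" for F P
      using that by (auto simp: nerve_part_def intro: finite_subset)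
    have join: "cochain_exact k ((\<lambda>F. F \<union> W) ` nerve_part P) (n + card W) \<longleftrightarrow>
        cochain_exact k (nerve_part P) n" for n P
      by (rule cochain_exact_join_simplex[OF fW nerve_part_less[OF W] fF])
    show ?thesis
    proof (cases "card W \<le> Suc i")
      case True
      then obtain n where n: "Suc i = n + card W" by (metis le_add_diff_inverse2)
      then show ?thesis unfolding stars_exact_iff[OF W] n join by auto
    next
      \<comment> \<open>Every set of the joined family contains \<open>W\<close>, which is already
        too large, so both sides are vacuous.\<close>
      case False
      have "card G \<noteq> Suc i" if "G \<in> (\<lambda>F. F \<union> W) ` nerve_part P" for G P
      proof -
        have "finite G" using that fW fF by auto
        then have "card W \<le> card G" using that by (intro card_mono) auto
        then show ?thesis using False by simp
      qed
      then have "cochain_exact k ((\<lambda>F. F \<union> W) ` nerve_part (\<lambda>B. B \<subseteq> W)) (Suc i)"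
        by (intro cochain_exact_empty_level)
      then show ?thesis using False unfolding stars_exact_iff[OF W] by auto
    qed
  qed
  \<comment> \<open>Level 0 has no counterpart \<open>i\<close> when \<open>W\<close> is empty; it
    is exact because all members of \<open>nerve_part\<close> are nonempty.\<close>
  have zero: "cochain_exact k (nerve_part P) 0" for P
    by (rule cochain_exact_empty_level) (auto simp: nerve_part_def dest: finite_subset)
  show ?thesis
  proof (intro iffI allI impI)
    fix W n
    assume *: "\<forall>W i. W \<subseteq> N \<longrightarrow> i < d \<longrightarrow> cochain_exact k (stars W) i"
      and W: "W \<subseteq> N" "n + card W \<le> d"
    show "cochain_exact k (nerve_part (\<lambda>B. B \<subseteq> W)) n"
    proof (cases n)
      case (Suc m)
      then have "m + card W < d" using W by simp
      then have "cochain_exact k (stars W) (m + card W)" using * W by blast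
      then show ?thesis using step[OF W(1)] Suc by simp
    qed (simp add: zero)
  next
    fix W i
    assume *: "\<forall>W n. W \<subseteq> N \<longrightarrow> n + card W \<le> d \<longrightarrow> cochain_exact k (nerve_part (\<lambda>B. B \<subseteq> W)) n"
      and W: "W \<subseteq> N" "i < d"
    then show "cochain_exact k (stars W) i" using step[OF W(1)] by simp
  qed
qed

section \<open>Filtering index sets by the intersection of their facets\<close>

lemma convex_nerve_part:
  assumes "\<And>B C D. P B \<Longrightarrow> P D \<Longrightarrow> B \<subseteq> C \<Longrightarrow> C \<subseteq> D \<Longrightarrow> P C"
  shows "convex_family (nerve_part P)"
  unfolding convex_family_def
proof (intro ballI allI impI)
  fix F H G assume F: "F \<in> nerve_part P" and H: "H \<in> nerve_part P" and FG: "F \<subseteq> G" and GH: "G \<subseteq> H"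
  have "P (common G)"
    using assms[of "common H" "common F" "common G"] F H common_antimono[OF FG] common_antimono[OF GH]
    by (simp add: nerve_part_def)
  then show "G \<in> nerve_part P" using F H FG GH by (auto simp: nerve_part_def)
qed

lemma nerve_part_exact_fibres:
  assumes "\<And>B C D. P B \<Longrightarrow> P D \<Longrightarrow> B \<subseteq> C \<Longrightarrow> C \<subseteq> D \<Longrightarrow> P C"
    and ex: "\<And>B. B \<subseteq> N \<Longrightarrow> P B \<Longrightarrow> cochain_exact k (nerve_part (\<lambda>C. C = B)) n"
  shows "cochain_exact (k :: 'k::field itself) (nerve_part P) n"
\<comment> \<open>The complement is taken because \<open>common F\<close> shrinks as
  \<open>F\<close> grows, while the filtering map has to be monotone.\<close>
proof (rule cochain_exact_fibres[where g = "\<lambda>F. N - common F"])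
  show "convex_family (nerve_part P)" using assms(1) by (rule convex_nerve_part)
  show "finite ((\<lambda>F. N - common F) ` nerve_part P)" using finite_nerve_part by simp
  show "N - common G \<subseteq> N - common H" if "G \<subseteq> H" for G H using common_antimono[OF that] by blast
  fix c assume "c \<in> (\<lambda>F. N - common F) ` nerve_part P"
  then obtain F where F: "F \<in> nerve_part P" "c = N - common F" by auto
  then have mN: "common F \<subseteq> N" "P (common F)" using common_sub by (auto simp: nerve_part_def)
  have "{G \<in> nerve_part P. N - common G = c} = nerve_part (\<lambda>C. C = common F)"
    using F mN common_sub by (auto simp: nerve_part_def) blast+
  then show "cochain_exact k {G \<in> nerve_part P. N - common G = c} n" using ex[OF mN] by simp
qed

text \<open>From right to left one filters by the value of \<open>common F\<close>, and the bound
  only improves. From left to right, \<open>common F = W\<close> is a lower part of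
  \<open>common F \<subseteq> W\<close>; its exactness at \<open>n\<close> needs the part
  \<open>common F \<subset> W\<close> at \<open>Suc n\<close>, which stays within the bound since
  proper subsets of \<open>W\<close> are smaller.\<close>

lemma all_nerve_part_le_iff_eq:
  "(\<forall>W n. W \<subseteq> N \<longrightarrow> n + card W \<le> d \<longrightarrow> cochain_exact (k :: 'k::field itself) (nerve_part (\<lambda>B. B \<subseteq> W)) n)
   \<longleftrightarrow> (\<forall>W n. W \<subseteq> N \<longrightarrow> n + card W \<le> d \<longrightarrow> cochain_exact k (nerve_part (\<lambda>B. B = W)) n)"
proof (intro iffI allI impI)
  fix W n
  assume *: "\<forall>W n. W \<subseteq> N \<longrightarrow> n + card W \<le> d \<longrightarrow> cochain_exact k (nerve_part (\<lambda>B. B = W)) n"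
    and W: "W \<subseteq> N" "n + card W \<le> d"
  show "cochain_exact k (nerve_part (\<lambda>B. B \<subseteq> W)) n"
  proof (rule nerve_part_exact_fibres)
    fix B assume B: "B \<subseteq> N" "B \<subseteq> W"
    then have "card B \<le> card W" using finN finite_subset[OF W(1)] by (intro card_mono) auto
    then show "cochain_exact k (nerve_part (\<lambda>C. C = B)) n" using * B W by simp
  qed auto
next
  fix W n
  assume *: "\<forall>W n. W \<subseteq> N \<longrightarrow> n + card W \<le> d \<longrightarrow> cochain_exact k (nerve_part (\<lambda>B. B \<subseteq> W)) n"
  show "W \<subseteq> N \<Longrightarrow> n + card W \<le> d \<Longrightarrow> cochain_exact k (nerve_part (\<lambda>B. B = W)) n"
  proof (induction "card W" arbitrary: W n rule: less_induct)
    case less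
    let ?K = "nerve_part (\<lambda>B. B \<subseteq> W)" and ?D = "nerve_part (\<lambda>B. B = W)"
    let ?U = "nerve_part (\<lambda>B. B \<subset> W)"
    have KU: "?K - ?U = ?D" by (auto simp: nerve_part_def)
    have dU: "down_in ?K ?D"
      unfolding down_in_def
    proof (intro conjI ballI impI)
      fix G H assume "G \<in> ?D" and H: "H \<in> ?K" "H \<subseteq> G"
      then show "H \<in> ?D" using common_antimono[OF H(2)] by (auto simp: nerve_part_def)
    qed (auto simp: nerve_part_def)
    have KD: "?K - ?D = ?U" by (auto simp: nerve_part_def)
    have cK: "convex_family ?K" by (rule convex_nerve_part) auto
    have eU: "cochain_exact k ?U (Suc n)"
    proof (rule nerve_part_exact_fibres)
      fix B assume B: "B \<subseteq> N" "B \<subset> W"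
      then have "card B < card W" using finN finite_subset[OF less.prems(1)] by (intro psubset_card_mono) auto
      then show "cochain_exact k (nerve_part (\<lambda>C. C = B)) (Suc n)"
        using less.hyps[of B "Suc n"] B less.prems by simp
    qed auto
    show ?case
      using cochain_exact_down[OF cK dU, of k n] * less.prems eU unfolding KD by blast
  qed
qed

text \<open>Nested index sets whose intersections have equal cardinality have equal intersections,
  so the family for \<open>q\<close> is a disjoint union, without inclusions across, of the families
  for the \<open>W\<close> with \<open>card W = q\<close>.\<close>

lemma all_nerve_part_eq_iff_card:
  "(\<forall>W n. W \<subseteq> N \<longrightarrow> n + card W \<le> d \<longrightarrow> cochain_exact (k :: 'k::field itself) (nerve_part (\<lambda>B. B = W)) n)
   \<longleftrightarrow> (\<forall>q n. n + q \<le> d \<longrightarrow> cochain_exact k (nerve_part (\<lambda>B. card B = q)) n)"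
proof (intro iffI allI impI)
  fix q n
  assume *: "\<forall>W n. W \<subseteq> N \<longrightarrow> n + card W \<le> d \<longrightarrow> cochain_exact k (nerve_part (\<lambda>B. B = W)) n"
    and q: "n + q \<le> d"
  have eq: "nerve_part (\<lambda>B. card B = q) = nerve_part (\<lambda>B. B \<subseteq> N \<and> card B = q)"
    using common_sub by (auto simp: nerve_part_def)
  show "cochain_exact k (nerve_part (\<lambda>B. card B = q)) n"
    unfolding eq
  proof (rule nerve_part_exact_fibres)
    fix B C D assume "B \<subseteq> N \<and> card B = q" "D \<subseteq> N \<and> card D = q" and BC: "B \<subseteq> C" "C \<subseteq> D"
    then have B: "B \<subseteq> N" "card B = q" and D: "D \<subseteq> N" "card D = q" by auto
    have "finite D" using D finN finite_subset by blast
    then have "B = D" using B D BC by (intro card_subset_eq) auto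
    then show "C \<subseteq> N \<and> card C = q" using BC B by auto
  qed (use * q in auto)
next
  fix W n
  assume *: "\<forall>q n. n + q \<le> d \<longrightarrow> cochain_exact k (nerve_part (\<lambda>B. card B = q)) n"
    and W: "W \<subseteq> N" "n + card W \<le> d"
  show "cochain_exact k (nerve_part (\<lambda>B. B = W)) n"
  proof (rule cochain_exact_summand)
    show "cochain_exact k (nerve_part (\<lambda>B. card B = card W)) n" using * W by blast
    fix G H assume GH: "G \<in> nerve_part (\<lambda>B. card B = card W)" "H \<in> nerve_part (\<lambda>B. card B = card W)" "G \<subseteq> H"
    have "finite (common G)" using GH finite_common by (auto simp: nerve_part_def)
    then have "common H = common G"
      using GH common_antimono[OF GH(3)] by (intro card_subset_eq) (auto simp: nerve_part_def)
    then show "G \<in> nerve_part (\<lambda>B. B = W) \<longleftrightarrow> H \<in> nerve_part (\<lambda>B. B = W)"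
      using GH by (simp add: nerve_part_def)
  qed (auto simp: nerve_part_def)
qed

section \<open>Relative cohomology of consecutive higher nerves\<close>

definition higher_nerve :: "nat \<Rightarrow> nat set set" where
  "higher_nerve j = {F. F \<subseteq> {1..r} \<and> (F = {} \<or> j \<le> card (common F))}"

lemma higher_nerve_down: "F \<in> higher_nerve j \<Longrightarrow> H \<subseteq> F \<Longrightarrow> H \<in> higher_nerve j"
proof -
  assume F: "F \<in> higher_nerve j" and H: "H \<subseteq> F"
  have "card (common F) \<le> card (common H)" if "H \<noteq> {}"
  proof (rule card_mono)
    show "finite (common H)" using that F H by (intro finite_common) (auto simp: higher_nerve_def)
  qed (rule common_antimono[OF H])
  then show ?thesis
    using F H unfolding higher_nerve_def by (cases "H = {}") (auto dest: order_trans)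
qed

text \<open>Consecutive nerves differ by the sets with \<open>card (common F) = j\<close>, the empty
  face lying in both. Vanishing is carried from one nerve to the next, starting at
  \<open>higher_nerve 0\<close>, a full simplex and hence a cone.\<close>

lemma all_nerve_part_card_iff_higher_nerve:
  "(\<forall>q n. n + q \<le> d \<longrightarrow> cochain_exact (k :: 'k::field itself) (nerve_part (\<lambda>B. card B = q)) n)
   \<longleftrightarrow> (\<forall>j n. 1 \<le> j \<longrightarrow> n + j \<le> d \<longrightarrow> cochain_exact k (higher_nerve j) n)"
proof -
  have cx: "convex_family (higher_nerve j)" for j
    using higher_nerve_down unfolding convex_family_def by blast
  have dn: "down_in (higher_nerve j) (higher_nerve (Suc j))" for j
    unfolding down_in_def
  proof (intro conjI ballI impI)
    show "higher_nerve (Suc j) \<subseteq> higher_nerve j" by (auto simp: higher_nerve_def)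
  qed (rule higher_nerve_down)
  have diff: "higher_nerve j - higher_nerve (Suc j) = nerve_part (\<lambda>B. card B = j)" for j
  proof (rule Set.set_eqI)
    fix F
    have "j \<le> card (common F) \<and> \<not> Suc j \<le> card (common F) \<longleftrightarrow> card (common F) = j"
      by linarith
    then show "F \<in> higher_nerve j - higher_nerve (Suc j) \<longleftrightarrow> F \<in> nerve_part (\<lambda>B. card B = j)"
      unfolding higher_nerve_def nerve_part_def by blast
  qed
  have e0: "cochain_exact k (higher_nerve 0) n" for n
    by (rule cochain_exact_cone[of _ 1]) (use r_pos in \<open>auto simp: higher_nerve_def intro: finite_subset\<close>)
  show ?thesis
  proof (intro iffI allI impI)
    fix j n :: nat
    assume *: "\<forall>q n. n + q \<le> d \<longrightarrow> cochain_exact k (nerve_part (\<lambda>B. card B = q)) n"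
    show "n + j \<le> d \<Longrightarrow> cochain_exact k (higher_nerve j) n"
    proof (induction j)
      case (Suc j)
      then show ?case
        using cochain_exact_down[OF cx dn, of k j n] * unfolding diff by simp
    qed (rule e0)
  next
    fix q n :: nat
    assume *: "\<forall>j n. 1 \<le> j \<longrightarrow> n + j \<le> d \<longrightarrow> cochain_exact k (higher_nerve j) n"
      and q: "n + q \<le> d"
    show "cochain_exact k (nerve_part (\<lambda>B. card B = q)) n"
    proof (cases n)
      case 0
      show ?thesis
        unfolding 0 by (rule cochain_exact_empty_level) (auto simp: nerve_part_def dest: finite_subset)
    next
      case (Suc m)
      \<comment> \<open>Of the two nerves required, one has its index higher by one and its level
        lower by one, so both respect the bound on the total.\<close>
      have "cochain_exact k (higher_nerve q) (Suc m)"
        by (cases "q = 0") (use e0 * q Suc in auto)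
      moreover have "cochain_exact k (higher_nerve (Suc q)) m" using * q Suc by simp
      ultimately show ?thesis using cochain_exact_up[OF cx dn, of k q m] unfolding diff Suc by blast
    qed
  qed
qed

lemma stars_exact_iff_higher_nerve:
  "(\<forall>W i. W \<subseteq> N \<longrightarrow> i < d \<longrightarrow> cochain_exact (k :: 'k::field itself) (stars W) i) \<longleftrightarrow>
   (\<forall>j n. 1 \<le> j \<longrightarrow> n + j \<le> d \<longrightarrow> cochain_exact k (higher_nerve j) n)"
  unfolding all_stars_exact_iff all_nerve_part_le_iff_eq all_nerve_part_eq_iff_card
    all_nerve_part_card_iff_higher_nerve ..

end

section \<open>Regular sequences and Koszul complexes\<close>

text \<open>Subrings of a ring type, so that identities are proved by type class algebra and only
  membership has to be tracked. The instance used later is \<open>polys V\<close>.\<close>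

locale carrier_ring =
  fixes A :: "'b::comm_ring_1 set"
  assumes zero_in: "0 \<in> A" and one_in: "1 \<in> A"
    and add_in: "a \<in> A \<Longrightarrow> b \<in> A \<Longrightarrow> a + b \<in> A"
    and mult_in: "a \<in> A \<Longrightarrow> b \<in> A \<Longrightarrow> a * b \<in> A"
    and uminus_in: "a \<in> A \<Longrightarrow> - a \<in> A"
begin

lemma minus_in: "a \<in> A \<Longrightarrow> b \<in> A \<Longrightarrow> a - b \<in> A"
  using add_in[of a "- b"] uminus_in by simp

lemma sum_in: "(\<And>i. i \<in> S \<Longrightarrow> f i \<in> A) \<Longrightarrow> sum f S \<in> A"
  by (induction S rule: infinite_finite_induct) (auto simp: zero_in add_in)

lemma prod_in: "(\<And>i. i \<in> S \<Longrightarrow> f i \<in> A) \<Longrightarrow> prod f S \<in> A"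
  by (induction S rule: infinite_finite_induct) (auto simp: one_in mult_in)

definition ideal_in :: "'b set \<Rightarrow> bool" where
  "ideal_in J \<longleftrightarrow> J \<subseteq> A \<and> 0 \<in> J \<and> (\<forall>a\<in>J. \<forall>b\<in>J. a + b \<in> J) \<and> (\<forall>a\<in>A. \<forall>b\<in>J. a * b \<in> J)"

lemma ideal_inI:
  assumes "J \<subseteq> A" "0 \<in> J" "\<And>a b. a \<in> J \<Longrightarrow> b \<in> J \<Longrightarrow> a + b \<in> J"
    and "\<And>a b. a \<in> A \<Longrightarrow> b \<in> J \<Longrightarrow> a * b \<in> J"
  shows "ideal_in J"
  using assms by (auto simp: ideal_in_def)

lemma ideal_inD:
  assumes "ideal_in J"
  shows "a \<in> J \<Longrightarrow> a \<in> A" "0 \<in> J" "a \<in> J \<Longrightarrow> b \<in> J \<Longrightarrow> a + b \<in> J"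
    "c \<in> A \<Longrightarrow> b \<in> J \<Longrightarrow> c * b \<in> J" "a \<in> J \<Longrightarrow> - a \<in> J"
    "a \<in> J \<Longrightarrow> b \<in> J \<Longrightarrow> a - b \<in> J" "c \<in> A \<Longrightarrow> b \<in> J \<Longrightarrow> b * c \<in> J"
proof -
  show *: "a \<in> J \<Longrightarrow> a \<in> A" "0 \<in> J" "\<And>a b. a \<in> J \<Longrightarrow> b \<in> J \<Longrightarrow> a + b \<in> J"
    "\<And>c b. c \<in> A \<Longrightarrow> b \<in> J \<Longrightarrow> c * b \<in> J"
    using assms by (auto simp: ideal_in_def)
  show neg: "- a \<in> J" if "a \<in> J" for a
    using *(4)[OF uminus_in[OF one_in] that] by simp
  show "a \<in> J \<Longrightarrow> b \<in> J \<Longrightarrow> a - b \<in> J" using *(3)[of a "- b"] neg by simp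
  show "c \<in> A \<Longrightarrow> b \<in> J \<Longrightarrow> b * c \<in> J" using *(4)[of c b] by (simp add: mult.commute)
qed

lemma ideal_in_sum: "ideal_in J \<Longrightarrow> (\<And>i. i \<in> S \<Longrightarrow> f i \<in> J) \<Longrightarrow> sum f S \<in> J"
  by (induction S rule: infinite_finite_induct) (auto simp: ideal_inD)

lemma ideal_in_prod:
  assumes "ideal_in J" "finite S" "s \<in> S" "f s \<in> J" "\<And>i. i \<in> S \<Longrightarrow> f i \<in> A"
  shows "prod f S \<in> J"
proof -
  have "prod f S = prod f (S - {s}) * f s"
    using assms(2,3) by (simp add: prod.remove mult.commute)
  moreover have "prod f (S - {s}) \<in> A" by (rule prod_in) (use assms(5) in auto)
  ultimately show ?thesis using ideal_inD(4)[OF assms(1)] assms(4) by simp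
qed

lemma ideal_in_carrier: "ideal_in A"
  by (rule ideal_inI) (auto simp: zero_in add_in mult_in)

lemma ideal_in_Inter:
  assumes "\<J> \<noteq> {}" "\<And>J. J \<in> \<J> \<Longrightarrow> ideal_in J"
  shows "ideal_in (\<Inter>\<J>)"
proof (rule ideal_inI)
  show "\<Inter>\<J> \<subseteq> A" using assms ideal_inD(1) by blast
qed (use assms ideal_inD(2-4) in auto)

definition gen :: "'b set \<Rightarrow> 'b set" where
  "gen S = \<Inter>{J. ideal_in J \<and> S \<subseteq> J}"

lemma gen_subset: "S \<subseteq> gen S"
  by (auto simp: gen_def)

lemma gen_least: "ideal_in J \<Longrightarrow> S \<subseteq> J \<Longrightarrow> gen S \<subseteq> J"
  by (auto simp: gen_def)

lemma ideal_in_gen: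
  assumes "S \<subseteq> A"
  shows "ideal_in (gen S)"
  unfolding gen_def by (rule ideal_in_Inter) (use assms ideal_in_carrier in auto)

lemma gen_mono: "S \<subseteq> T \<Longrightarrow> gen S \<subseteq> gen T"
  by (auto simp: gen_def)

definition noetherian :: bool where
  "noetherian \<longleftrightarrow> (\<forall>J. ideal_in J \<longrightarrow>
     (\<exists>G. finite G \<and> G \<subseteq> J \<and> (\<forall>J'. ideal_in J' \<longrightarrow> G \<subseteq> J' \<longrightarrow> J \<subseteq> J')))"

text \<open>The union of a chain is an ideal; its finitely many generators lie in one member, which
  therefore is the union.\<close>

lemma noetherian_maximal:
  assumes "noetherian" "\<S> \<noteq> {}" "\<And>J. J \<in> \<S> \<Longrightarrow> ideal_in J"
  shows "\<exists>J\<in>\<S>. \<forall>J'\<in>\<S>. J \<subseteq> J' \<longrightarrow> J' = J"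
proof (rule subset_Zorn_nonempty[OF assms(2)])
  fix \<C> assume ne: "\<C> \<noteq> {}" and ch: "subset.chain \<S> \<C>"
  have id: "ideal_in C" if "C \<in> \<C>" for C
    using ch that assms(3) by (auto simp: subset.chain_def)
  have tot: "C \<subseteq> D \<or> D \<subseteq> C" if "C \<in> \<C>" "D \<in> \<C>" for C D
    using ch that by (auto simp: subset.chain_def)
  have "ideal_in (\<Union>\<C>)"
  proof (rule ideal_inI)
    show "\<Union>\<C> \<subseteq> A" using id ideal_inD(1) by blast
    show "0 \<in> \<Union>\<C>" using ne id ideal_inD(2) by blast
    show "a * b \<in> \<Union>\<C>" if "a \<in> A" "b \<in> \<Union>\<C>" for a b using that id ideal_inD(4) by blast
    fix a b assume "a \<in> \<Union>\<C>" "b \<in> \<Union>\<C>"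
    then obtain C D where CD: "C \<in> \<C>" "D \<in> \<C>" "a \<in> C" "b \<in> D" by auto
    show "a + b \<in> \<Union>\<C>"
      using tot[OF CD(1,2)] CD ideal_inD(3)[OF id[OF CD(1)], of a b] ideal_inD(3)[OF id[OF CD(2)], of a b]
      by blast
  qed
  then obtain G where G: "finite G" "G \<subseteq> \<Union>\<C>" "\<And>J'. ideal_in J' \<Longrightarrow> G \<subseteq> J' \<Longrightarrow> \<Union>\<C> \<subseteq> J'"
    using assms(1) unfolding noetherian_def by meson
  obtain C where C: "C \<in> \<C>" "G \<subseteq> C"
    using finite_subset_Union_chain[OF G(1,2) ne ch] by blast
  then have "\<Union>\<C> = C" using G(3)[OF id[OF C(1)] C(2)] by blast
  then show "\<Union>\<C> \<in> \<S>" using C(1) ch by (auto simp: subset.chain_def)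
qed

lemma noetherian_finite_generators:
  assumes "noetherian" "S \<subseteq> A"
  shows "\<exists>T. finite T \<and> T \<subseteq> S \<and> S \<subseteq> gen T"
proof -
  let ?\<S> = "gen ` {T. finite T \<and> T \<subseteq> S}"
  have "\<exists>J\<in>?\<S>. \<forall>J'\<in>?\<S>. J \<subseteq> J' \<longrightarrow> J' = J"
    by (rule noetherian_maximal[OF assms(1)]) (use assms(2) ideal_in_gen in auto)
  then obtain T where T: "finite T" "T \<subseteq> S"
      "\<And>T'. finite T' \<Longrightarrow> T' \<subseteq> S \<Longrightarrow> gen T \<subseteq> gen T' \<Longrightarrow> gen T' = gen T"
    by auto
  have "s \<in> gen T" if "s \<in> S" for s
  proof -
    have "gen (insert s T) = gen T"
      by (rule T(3)) (use T that gen_mono[of T "insert s T"] in auto)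
    then show ?thesis using gen_subset[of "insert s T"] by auto
  qed
  then show ?thesis using T by blast
qed

section \<open>Prime avoidance and zero divisors\<close>

definition prime_in :: "'b set \<Rightarrow> bool" where
  "prime_in P \<longleftrightarrow> ideal_in P \<and> 1 \<notin> P \<and> (\<forall>a\<in>A. \<forall>b\<in>A. a * b \<in> P \<longrightarrow> a \<in> P \<or> b \<in> P)"

lemma prime_in_prodD:
  assumes "prime_in P" "finite S" "\<And>s. s \<in> S \<Longrightarrow> f s \<in> A" "prod f S \<in> P"
  shows "\<exists>s\<in>S. f s \<in> P"
  using assms(2,3,4)
proof (induction S)
  case empty
  then show ?case using assms(1) by (simp add: prime_in_def)
next
  case (insert s S)
  have "prod f S \<in> A" by (rule prod_in) (use insert.prems in auto)
  then have "f s \<in> P \<or> prod f S \<in> P"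
    using assms(1) insert unfolding prime_in_def by auto
  then show ?case using insert by auto
qed

lemma prime_avoidance:
  assumes "finite \<P>" "\<And>P. P \<in> \<P> \<Longrightarrow> prime_in P" "ideal_in M" "M \<subseteq> \<Union>\<P>"
  shows "\<exists>P\<in>\<P>. M \<subseteq> P"
  using assms(1,2,4)
proof (induction \<P> rule: finite_psubset_induct)
  case (psubset \<P>)
  show ?case
  proof (cases "\<exists>\<Q>. \<Q> \<subset> \<P> \<and> M \<subseteq> \<Union>\<Q>")
    case True
    then obtain \<Q> where Q: "\<Q> \<subset> \<P>" "M \<subseteq> \<Union>\<Q>" by blast
    have "\<exists>P\<in>\<Q>. M \<subseteq> P"
      by (rule psubset.IH[OF Q(1) _ Q(2)]) (use psubset.prems Q in auto)
    then show ?thesis using Q by blast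
  next
    case False
    have "\<exists>f\<in>M. f \<notin> \<Union>(\<P> - {P})" if "P \<in> \<P>" for P
    proof -
      have "\<P> - {P} \<subset> \<P>" using that by auto
      then show ?thesis using False by blast
    qed
    then obtain f where f: "\<And>P. P \<in> \<P> \<Longrightarrow> f P \<in> M" "\<And>P. P \<in> \<P> \<Longrightarrow> f P \<notin> \<Union>(\<P> - {P})"
      by metis
    have fP: "f P \<in> P" if "P \<in> \<P>" for P using f[OF that] psubset.prems(2) by blast
    have fA: "f P \<in> A" if "P \<in> \<P>" for P using f(1)[OF that] ideal_inD(1)[OF assms(3)] by blast
    obtain P0 where P0: "P0 \<in> \<P>" using ideal_inD(2)[OF assms(3)] psubset.prems(2) by blast
    show ?thesis
    proof (cases "\<P> = {P0}")
      case True
      then show ?thesis using psubset.prems(2) by auto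
    next
      case False
      then obtain P1 where P1: "P1 \<in> \<P> - {P0}" using P0 by blast
      let ?p = "prod f (\<P> - {P0})"
      have "?p \<in> M"
        by (rule ideal_in_prod[OF assms(3) _ P1]) (use psubset.hyps f fA P1 in auto)
      then have "f P0 + ?p \<in> M" using f(1)[OF P0] ideal_inD(3)[OF assms(3)] by blast
      then obtain P where P: "P \<in> \<P>" "f P0 + ?p \<in> P" using psubset.prems(2) by blast
      have idP: "ideal_in P" using psubset.prems(1)[OF P(1)] by (simp add: prime_in_def)
      have False
      proof (cases "P = P0")
        case True
        then have "?p \<in> P" using ideal_inD(6)[OF idP P(2), of "f P0"] fP[OF P0] by simp
        then have "\<exists>Q\<in>\<P> - {P0}. f Q \<in> P"
          by (intro prime_in_prodD[OF psubset.prems(1)[OF P(1)]]) (use psubset.hyps fA in auto)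
        then show False using f(2) True P(1) by blast
      next
        case False
        have "?p \<in> P"
          by (rule ideal_in_prod[OF idP, of _ P]) (use psubset.hyps P False fP fA in auto)
        then have "f P0 \<in> P" using ideal_inD(6)[OF idP P(2), of ?p] by simp
        then show False using f(2)[OF P0] P(1) False by blast
      qed
      then show ?thesis ..
    qed
  qed
qed

definition colon :: "'b set \<Rightarrow> 'b \<Rightarrow> 'b set" where
  "colon J a = {f \<in> A. f * a \<in> J}"

definition nonzerodivisor_mod :: "'b set \<Rightarrow> 'b \<Rightarrow> bool" where
  "nonzerodivisor_mod J f \<longleftrightarrow> (\<forall>a\<in>A. f * a \<in> J \<longrightarrow> a \<in> J)"

lemma ideal_in_colon:
  assumes "ideal_in J" "a \<in> A"
  shows "ideal_in (colon J a)"
  by (rule ideal_inI)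
    (use assms in \<open>auto simp: colon_def zero_in add_in mult_in ideal_inD distrib_right mult.assoc\<close>)

text \<open>The maximal members among the annihilators of nonzero elements of \<open>A/J\<close> are prime, and
  finitely many of them cover all zero divisors: if elements \<open>b\<close> with maximal annihilators lie in
  the ideal generated by \<open>T\<close>, then the intersection of the annihilators of \<open>T\<close> kills \<open>b\<close>.\<close>

lemma exists_nonzerodivisor_mod:
  assumes noeth: "noetherian" and J: "ideal_in J" and M: "ideal_in M"
    and socle: "\<And>a. a \<in> A \<Longrightarrow> (\<And>f. f \<in> M \<Longrightarrow> f * a \<in> J) \<Longrightarrow> a \<in> J"
  shows "\<exists>f\<in>M. nonzerodivisor_mod J f"
proof (rule ccontr)
  assume contra: "\<not> ?thesis"
  define S where "S = {b \<in> A - J. \<forall>c\<in>A - J. colon J b \<subseteq> colon J c \<longrightarrow> colon J c = colon J b}"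
  have S: "b \<in> A" "b \<notin> J" "\<And>c. c \<in> A \<Longrightarrow> c \<notin> J \<Longrightarrow> colon J b \<subseteq> colon J c \<Longrightarrow> colon J c = colon J b"
    if "b \<in> S" for b using that by (auto simp: S_def)
  have above: "\<exists>b\<in>S. colon J a \<subseteq> colon J b" if a: "a \<in> A" "a \<notin> J" for a
  proof -
    let ?\<S> = "colon J ` {b \<in> A - J. colon J a \<subseteq> colon J b}"
    have "\<exists>I\<in>?\<S>. \<forall>J'\<in>?\<S>. I \<subseteq> J' \<longrightarrow> J' = I"
      by (rule noetherian_maximal[OF noeth]) (use a ideal_in_colon[OF J] in auto)
    then obtain b where b: "b \<in> A - J" "colon J a \<subseteq> colon J b"
        "\<And>c. c \<in> A - J \<Longrightarrow> colon J a \<subseteq> colon J c \<Longrightarrow> colon J b \<subseteq> colon J c \<Longrightarrow> colon J c = colon J b"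
      by auto
    then have "b \<in> S" unfolding S_def by blast
    then show ?thesis using b(2) by blast
  qed
  have prime: "prime_in (colon J b)" if b: "b \<in> S" for b
    unfolding prime_in_def
  proof (intro conjI ballI impI)
    show "ideal_in (colon J b)" by (rule ideal_in_colon[OF J S(1)[OF b]])
    show "1 \<notin> colon J b" using S(2)[OF b] by (simp add: colon_def)
    fix f g assume fg: "f \<in> A" "g \<in> A" "f * g \<in> colon J b"
    show "f \<in> colon J b \<or> g \<in> colon J b"
    proof (cases "g * b \<in> J")
      case False
      \<comment> \<open>The annihilator of \<open>g * b\<close> contains that of \<open>b\<close>
        and equals it by maximality; as \<open>f\<close> kills \<open>g * b\<close>, it kills
        \<open>b\<close>.\<close>
      have "h * (g * b) \<in> J" if "h * b \<in> J" for h
        using ideal_inD(4)[OF J fg(2) that] by (simp add: mult.left_commute)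
      then have "colon J b \<subseteq> colon J (g * b)" by (auto simp: colon_def)
      then have "colon J (g * b) = colon J b"
        using S(3)[OF b _ False] mult_in[OF fg(2) S(1)[OF b]] by blast
      moreover have "f \<in> colon J (g * b)" using fg by (simp add: colon_def mult.assoc)
      ultimately show ?thesis by simp
    qed (use fg in \<open>simp add: colon_def\<close>)
  qed
  obtain T where T: "finite T" "T \<subseteq> S" "S \<subseteq> gen T"
    using noetherian_finite_generators[OF noeth, of S] by (auto simp: S_def)
  have cover: "\<exists>c\<in>T. colon J c = colon J b" if b: "b \<in> S" for b
  proof (rule ccontr)
    assume "\<not> ?thesis"
    then have "\<forall>c\<in>T. \<exists>f. f \<in> colon J c \<and> f \<notin> colon J b"
      using S(3) S(1,2)[OF b] T(2) by (metis subsetD subsetI)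
    then obtain f where f: "\<And>c. c \<in> T \<Longrightarrow> f c \<in> colon J c" "\<And>c. c \<in> T \<Longrightarrow> f c \<notin> colon J b"
      by metis
    have fA: "f c \<in> A" if "c \<in> T" for c using f(1)[OF that] by (simp add: colon_def)
    \<comment> \<open>The elements killed by all common annihilators of \<open>T\<close> form an
      ideal containing \<open>T\<close>, hence \<open>b\<close>. The product of the
      \<open>f c\<close> is such an annihilator, and primality puts one \<open>f c\<close> into
      \<open>colon J b\<close>.\<close>
    let ?K = "{a \<in> A. \<forall>g\<in>A. (\<forall>c\<in>T. g \<in> colon J c) \<longrightarrow> g * a \<in> J}"
    have "ideal_in ?K"
    proof (rule ideal_inI)
      show "0 \<in> ?K" using ideal_inD(2)[OF J] by (simp add: zero_in)
      show "a + c \<in> ?K" if "a \<in> ?K" "c \<in> ?K" for a c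
        using that ideal_inD(3)[OF J] by (auto simp: add_in distrib_left)
      show "a * c \<in> ?K" if "a \<in> A" "c \<in> ?K" for a c
        using that ideal_inD(4)[OF J] by (simp add: mult_in mult.left_commute[of _ a])
    qed auto
    moreover have "T \<subseteq> ?K" using T(2) S(1) by (auto simp: colon_def)
    ultimately have "b \<in> ?K" using gen_least T(3) b by blast
    moreover have "prod f T \<in> A" by (rule prod_in) (rule fA)
    moreover have "prod f T \<in> colon J c" if "c \<in> T" for c
      by (rule ideal_in_prod[OF ideal_in_colon[OF J] T(1) that]) (use f fA that S(1) T(2) in auto)
    ultimately have "prod f T \<in> colon J b" by (auto simp: colon_def)
    then have "\<exists>c\<in>T. f c \<in> colon J b" by (intro prime_in_prodD[OF prime[OF b] T(1) fA])
    then show False using f(2) by blast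
  qed
  have "M \<subseteq> \<Union>(colon J ` T)"
  proof
    fix g assume g: "g \<in> M"
    then obtain a where a: "a \<in> A" "g * a \<in> J" "a \<notin> J"
      using contra unfolding nonzerodivisor_mod_def by blast
    then have "g \<in> colon J a" using ideal_inD(1)[OF M g] by (simp add: colon_def)
    then show "g \<in> \<Union>(colon J ` T)" using above[OF a(1,3)] cover by blast
  qed
  then have "\<exists>P\<in>colon J ` T. M \<subseteq> P"
    by (intro prime_avoidance[OF _ _ M]) (use T prime in auto)
  then obtain c where c: "c \<in> T" "M \<subseteq> colon J c" by blast
  then have "c \<in> J" using socle[of c] S(1) T(2) by (auto simp: colon_def)
  then show False using S(2) T(2) c(1) by blast
qed

text \<open>The ideal generated by \<open>J\<close> and \<open>f\<close>, in the form that supplies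
  witnesses when cochains are lifted.\<close>

definition adjoin :: "'b set \<Rightarrow> 'b \<Rightarrow> 'b set" where
  "adjoin J f = {j + a * f | j a. j \<in> J \<and> a \<in> A}"

lemma ideal_in_adjoin:
  assumes "ideal_in J" "f \<in> A"
  shows "ideal_in (adjoin J f)"
proof (rule ideal_inI)
  show "adjoin J f \<subseteq> A"
    using assms ideal_inD(1)[OF assms(1)] by (auto simp: adjoin_def add_in mult_in)
  have "0 = 0 + 0 * f" by simp
  then show "0 \<in> adjoin J f" using ideal_inD(2)[OF assms(1)] zero_in unfolding adjoin_def by blast
  fix a b assume b: "b \<in> adjoin J f"
  then obtain j c where c: "b = j + c * f" "j \<in> J" "c \<in> A" by (auto simp: adjoin_def)
  { assume "a \<in> adjoin J f"
    then obtain i d where d: "a = i + d * f" "i \<in> J" "d \<in> A" by (auto simp: adjoin_def)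
    have "a + b = (i + j) + (d + c) * f" by (simp add: c d algebra_simps)
    then show "a + b \<in> adjoin J f"
      using c d ideal_inD(3)[OF assms(1)] add_in unfolding adjoin_def by blast }
  { assume "a \<in> A"
    moreover have "a * b = a * j + (a * c) * f" by (simp add: c algebra_simps)
    ultimately show "a * b \<in> adjoin J f"
      using c ideal_inD(4)[OF assms(1)] mult_in unfolding adjoin_def by blast }
qed

lemma adjoin_superset: "ideal_in J \<Longrightarrow> J \<subseteq> adjoin J f"
  using zero_in by (force simp: adjoin_def)

lemma adjoin_mem:
  assumes "ideal_in J"
  shows "f \<in> adjoin J f"
proof -
  have "f = 0 + 1 * f" by simp
  then show ?thesis using ideal_inD(2)[OF assms] one_in unfolding adjoin_def by blast
qed

lemma adjoin_least:
  assumes "ideal_in K" "J \<subseteq> K" "f \<in> K"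
  shows "adjoin J f \<subseteq> K"
  using assms by (auto simp: adjoin_def ideal_inD subset_iff)

text \<open>Cochains with values in \<open>A/J\<close> are represented by lifts to \<open>A\<close>.\<close>

definition koszul_exact :: "(nat \<Rightarrow> 'b) \<Rightarrow> nat set \<Rightarrow> 'b set \<Rightarrow> nat \<Rightarrow> bool" where
  "koszul_exact x N J i \<longleftrightarrow>
     (\<forall>z. (\<forall>G. z G \<in> A) \<longrightarrow> (\<forall>G. G \<subseteq> N \<longrightarrow> card G = Suc i \<longrightarrow> koszul_diff x z G \<in> J) \<longrightarrow>
        (\<exists>u. (\<forall>G. u G \<in> A) \<and> (\<forall>G. G \<subseteq> N \<longrightarrow> card G = i \<longrightarrow> z G - koszul_diff x u G \<in> J)))"

lemma koszul_exactD:
  assumes "koszul_exact x N J i" "\<And>G. z G \<in> A"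
    and "\<And>G. G \<subseteq> N \<Longrightarrow> card G = Suc i \<Longrightarrow> koszul_diff x z G \<in> J"
  shows "\<exists>u. (\<forall>G. u G \<in> A) \<and> (\<forall>G. G \<subseteq> N \<longrightarrow> card G = i \<longrightarrow> z G - koszul_diff x u G \<in> J)"
  using assms unfolding koszul_exact_def by blast

lemma face_sign_in: "face_sign G v \<in> A"
proof -
  have "(- 1) ^ n \<in> A" for n :: nat
    by (induction n) (auto simp: one_in mult_in uminus_in)
  then show ?thesis by (simp add: face_sign_def)
qed

lemma koszul_diff_in_ideal:
  assumes "ideal_in J" "\<And>v. v \<in> G \<Longrightarrow> x v \<in> A" "\<And>v. v \<in> G \<Longrightarrow> z (G - {v}) \<in> J"
  shows "koszul_diff x z G \<in> J"
  unfolding koszul_diff_def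
proof (rule ideal_in_sum[OF assms(1)])
  fix v assume "v \<in> G"
  then show "face_sign G v * x v * z (G - {v}) \<in> J"
    using assms face_sign_in[of G v] mult_in ideal_inD(4)[OF assms(1)] by simp
qed

text \<open>The multipliers \<open>f\<close> that turn \<open>z\<close> into a coboundary modulo
  \<open>J\<close> form an ideal, which contains every \<open>x v\<close> by contraction with
  \<open>v\<close>. So the variables annihilate Koszul cohomology.\<close>

lemma koszul_annihilated:
  assumes J: "ideal_in J" and N: "finite N" and x: "\<And>v. v \<in> N \<Longrightarrow> x v \<in> A"
    and z: "\<And>G. z G \<in> A"
    and dz: "\<And>G. G \<subseteq> N \<Longrightarrow> card G = Suc i \<Longrightarrow> koszul_diff x z G \<in> J"
    and f: "f \<in> gen (x ` N)"
  shows "\<exists>w. (\<forall>G. w G \<in> A) \<and> (\<forall>G. G \<subseteq> N \<longrightarrow> card G = i \<longrightarrow> f * z G - koszul_diff x w G \<in> J)"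
proof -
  define P where "P f w \<longleftrightarrow> (\<forall>G. w G \<in> A) \<and>
    (\<forall>G. G \<subseteq> N \<longrightarrow> card G = i \<longrightarrow> f * z G - koszul_diff x w G \<in> J)" for f w
  let ?K = "{f \<in> A. \<exists>w. P f w}"
  have "ideal_in ?K"
  proof (rule ideal_inI)
    have "P 0 (\<lambda>_. 0)" using ideal_inD(2)[OF J] by (simp add: P_def zero_in)
    then show "0 \<in> ?K" using zero_in by blast
  next
    fix a b assume a: "a \<in> ?K" and b: "b \<in> ?K"
    then obtain v w where "P a v" "P b w" by blast
    then have "P (a + b) (\<lambda>G. v G + w G)"
      using ideal_inD(3)[OF J] by (simp add: P_def koszul_diff_add add_in distrib_right add_diff_add)
    then show "a + b \<in> ?K" using a b add_in by blast
  next
    fix a b assume a: "a \<in> A" and b: "b \<in> ?K"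
    then obtain w where "P b w" by blast
    moreover have "a * b * z G - a * koszul_diff x w G = a * (b * z G - koszul_diff x w G)" for G
      by (simp add: algebra_simps)
    ultimately have "P (a * b) (\<lambda>G. a * w G)"
      using ideal_inD(4)[OF J a] a by (simp add: P_def koszul_diff_cmult mult_in)
    then show "a * b \<in> ?K" using a b mult_in by blast
  qed auto
  moreover have "x ` N \<subseteq> ?K"
  proof
    fix f assume "f \<in> x ` N"
    then obtain v where v: "v \<in> N" "f = x v" by auto
    have "P (x v) (cone_homotopy v z)"
      unfolding P_def
    proof (intro conjI allI impI)
      show "cone_homotopy v z G \<in> A" for G
        using z by (auto simp: cone_homotopy_def zero_in mult_in face_sign_in)
      fix G assume G: "G \<subseteq> N" "card G = i"
      have fG: "finite G" using G(1) N by (rule finite_subset)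
      show "x v * z G - koszul_diff x (cone_homotopy v z) G \<in> J"
      proof (cases "v \<in> G")
        case True
        then show ?thesis using fG ideal_inD(2)[OF J] by (simp add: koszul_diff_cone_homotopy_in)
      next
        case False
        then have "koszul_diff x z (insert v G) \<in> J" using dz G v fG by simp
        then show ?thesis
          using False fG ideal_inD(4)[OF J face_sign_in] by (simp add: koszul_diff_cone_homotopy_notin)
      qed
    qed
    then show "f \<in> ?K" using v x by blast
  qed
  ultimately show ?thesis using f gen_least unfolding P_def by blast
qed

text \<open>In the sequence \<open>0 -> A/J -> A/J -> A/(J, f) -> 0\<close> the first map is
  multiplication by \<open>f\<close>, which is zero on cohomology by
  \<open>koszul_annihilated\<close>. Hence \<open>H^i(A/J)\<close> is a quotient of
  \<open>H^(i-1)(A/(J, f))\<close>.\<close>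

lemma koszul_exact_of_adjoin:
  assumes J: "ideal_in J" and N: "finite N" and x: "\<And>v. v \<in> N \<Longrightarrow> x v \<in> A"
    and f: "f \<in> gen (x ` N)" "f \<in> A" and nzd: "nonzerodivisor_mod J f"
    and ex: "\<And>m. i = Suc m \<Longrightarrow> koszul_exact x N (adjoin J f) m"
  shows "koszul_exact x N J i"
  unfolding koszul_exact_def
proof (intro allI impI)
  fix z assume z: "\<forall>G. z G \<in> A"
    and dz: "\<forall>G. G \<subseteq> N \<longrightarrow> card G = Suc i \<longrightarrow> koszul_diff x z G \<in> J"
  obtain w where w: "\<And>G. w G \<in> A"
      "\<And>G. G \<subseteq> N \<Longrightarrow> card G = i \<Longrightarrow> f * z G - koszul_diff x w G \<in> J"
    using koszul_annihilated[OF J N x _ _ f(1), of z i] z dz by blast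
  show "\<exists>u. (\<forall>G. u G \<in> A) \<and> (\<forall>G. G \<subseteq> N \<longrightarrow> card G = i \<longrightarrow> z G - koszul_diff x u G \<in> J)"
  proof (cases i)
    case 0
    have "z {} \<in> J" using w(2)[of "{}"] z nzd 0 by (simp add: nonzerodivisor_mod_def)
    moreover have "G = {}" if "G \<subseteq> N" "card G = i" for G
      using that 0 N finite_subset by fastforce
    ultimately show ?thesis by (intro exI[of _ "\<lambda>_. 0"]) (auto simp: zero_in)
  next
    case (Suc m)
    \<comment> \<open>Modulo \<open>f\<close> the primitive \<open>w\<close> of \<open>f * z\<close>
      is a cocycle. Corrected by a coboundary it becomes a multiple of \<open>f\<close> modulo
      \<open>J\<close>, and cancelling \<open>f\<close> leaves a primitive of
      \<open>z\<close>.\<close>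
    have "koszul_diff x w G \<in> adjoin J f" if "G \<subseteq> N" "card G = Suc m" for G
    proof -
      have "- (f * z G - koszul_diff x w G) + z G * f \<in> adjoin J f"
        unfolding adjoin_def using w(2)[of G] that Suc ideal_inD(5)[OF J] z by blast
      then show ?thesis by (simp add: algebra_simps)
    qed
    from koszul_exactD[OF ex[OF Suc] w(1) this]
    obtain u where u: "\<And>G. u G \<in> A"
        "\<And>G. G \<subseteq> N \<Longrightarrow> card G = m \<Longrightarrow> w G - koszul_diff x u G \<in> adjoin J f" by blast
    have "\<exists>j a. j \<in> J \<and> a \<in> A \<and> (G \<subseteq> N \<longrightarrow> card G = m \<longrightarrow> w G - koszul_diff x u G = j + a * f)" for G
      using u(2)[of G] ideal_inD(2)[OF J] zero_in unfolding adjoin_def by blast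
    then obtain j v where j: "\<And>G. j G \<in> J" and v: "\<And>G. v G \<in> A"
      and jv: "\<And>G. G \<subseteq> N \<Longrightarrow> card G = m \<Longrightarrow> w G - koszul_diff x u G = j G + v G * f"
      by metis
    have "z G - koszul_diff x v G \<in> J" if G: "G \<subseteq> N" "card G = Suc m" for G
    proof -
      have "koszul_diff x w G = koszul_diff x (\<lambda>H. koszul_diff x u H + (j H + f * v H)) G"
      proof (rule koszul_diff_cong)
        fix a assume "a \<in> G"
        then show "w (G - {a}) = koszul_diff x u (G - {a}) + (j (G - {a}) + f * v (G - {a}))"
          using jv[of "G - {a}"] G by (auto simp: algebra_simps)
      qed
      also have "\<dots> = koszul_diff x j G + f * koszul_diff x v G"
        by (simp add: koszul_diff_add koszul_diff_cmult koszul_diff_diff)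
      finally have "f * (z G - koszul_diff x v G) = (f * z G - koszul_diff x w G) + koszul_diff x j G"
        by (simp add: algebra_simps)
      moreover have "koszul_diff x j G \<in> J"
        using koszul_diff_in_ideal[OF J, of G x j] x j G by blast
      ultimately have "f * (z G - koszul_diff x v G) \<in> J"
        using w(2)[of G] G Suc ideal_inD(3)[OF J] by simp
      moreover have "koszul_diff x v G \<in> A"
        using koszul_diff_in_ideal[OF ideal_in_carrier, of G x v] x v G by blast
      ultimately show ?thesis using nzd z minus_in by (auto simp: nonzerodivisor_mod_def)
    qed
    then show ?thesis using v Suc by blast
  qed
qed

text \<open>The same sequence at \<open>H^i(A/J) -> H^i(A/(J, f)) -> H^(i+1)(A/J)\<close>.\<close>

lemma koszul_exact_adjoin:
  assumes J: "ideal_in J" and x: "\<And>v. v \<in> N \<Longrightarrow> x v \<in> A"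
    and f: "f \<in> A" and nzd: "nonzerodivisor_mod J f"
    and ex: "koszul_exact x N J i" "koszul_exact x N J (Suc i)"
  shows "koszul_exact x N (adjoin J f) i"
  unfolding koszul_exact_def
proof (intro allI impI)
  fix z assume z: "\<forall>G. z G \<in> A"
    and dz: "\<forall>G. G \<subseteq> N \<longrightarrow> card G = Suc i \<longrightarrow> koszul_diff x z G \<in> adjoin J f"
  \<comment> \<open>The connecting homomorphism: \<open>w\<close> is the coboundary of the lift
    \<open>z\<close>, divided by \<open>f\<close> modulo \<open>J\<close>.\<close>
  have "\<exists>j a. j \<in> J \<and> a \<in> A \<and> (G \<subseteq> N \<longrightarrow> card G = Suc i \<longrightarrow> koszul_diff x z G = j + a * f)" for G
    using dz ideal_inD(2)[OF J] zero_in unfolding adjoin_def by blast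
  then obtain j w where j: "\<And>G. j G \<in> J" and w: "\<And>G. w G \<in> A"
    and jw: "\<And>G. G \<subseteq> N \<Longrightarrow> card G = Suc i \<Longrightarrow> koszul_diff x z G = j G + w G * f"
    by metis
  have "koszul_diff x w G \<in> J" if G: "G \<subseteq> N" "card G = Suc (Suc i)" for G
  proof -
    have "0 = koszul_diff x (koszul_diff x z) G" by (simp add: koszul_diff_diff)
    also have "\<dots> = koszul_diff x (\<lambda>H. j H + f * w H) G"
    proof (rule koszul_diff_cong)
      fix v assume "v \<in> G"
      then have "card (G - {v}) = Suc i" "G - {v} \<subseteq> N" using G by auto
      then show "koszul_diff x z (G - {v}) = j (G - {v}) + f * w (G - {v})"
        using jw[of "G - {v}"] by (simp add: mult.commute)
    qed
    also have "\<dots> = koszul_diff x j G + f * koszul_diff x w G"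
      by (simp add: koszul_diff_add koszul_diff_cmult)
    finally have "f * koszul_diff x w G = - koszul_diff x j G" by (simp add: eq_neg_iff_add_eq_0 add.commute)
    moreover have "koszul_diff x j G \<in> J"
      using koszul_diff_in_ideal[OF J, of G x j] x j G by blast
    moreover have "koszul_diff x w G \<in> A"
      using koszul_diff_in_ideal[OF ideal_in_carrier, of G x w] x w G by blast
    ultimately show ?thesis using nzd ideal_inD(5)[OF J] by (simp add: nonzerodivisor_mod_def)
  qed
  from koszul_exactD[OF ex(2) w this]
  obtain u where u: "\<And>G. u G \<in> A"
      "\<And>G. G \<subseteq> N \<Longrightarrow> card G = Suc i \<Longrightarrow> w G - koszul_diff x u G \<in> J" by blast
  have "koszul_diff x (\<lambda>G. z G - f * u G) G \<in> J" if G: "G \<subseteq> N" "card G = Suc i" for G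
  proof -
    have "koszul_diff x (\<lambda>G. z G - f * u G) G = j G + f * (w G - koszul_diff x u G)"
      using jw[OF G] by (simp add: koszul_diff_minus koszul_diff_cmult algebra_simps)
    then show ?thesis using j u(2)[OF G] ideal_inD(3,4)[OF J] f by simp
  qed
  from koszul_exactD[OF ex(1) _ this]
  obtain v where v: "\<And>G. v G \<in> A"
      "\<And>G. G \<subseteq> N \<Longrightarrow> card G = i \<Longrightarrow> z G - f * u G - koszul_diff x v G \<in> J"
    using z u(1) f minus_in mult_in by blast
  have "z G - koszul_diff x v G \<in> adjoin J f" if "G \<subseteq> N" "card G = i" for G
  proof -
    have "(z G - f * u G - koszul_diff x v G) + u G * f \<in> adjoin J f"
      unfolding adjoin_def using v(2)[OF that] u(1) by blast
    then show ?thesis by (simp add: algebra_simps)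
  qed
  then show "\<exists>u. (\<forall>G. u G \<in> A) \<and> (\<forall>G. G \<subseteq> N \<longrightarrow> card G = i \<longrightarrow> z G - koszul_diff x u G \<in> adjoin J f)"
    using v(1) by blast
qed

text \<open>The recursive form fits inductions that adjoin one entry at a time; properness of the
  final ideal is settled separately in \<open>depth_eq_Sup_koszul_exact\<close>.\<close>

fun regular_mod :: "'b set \<Rightarrow> 'b list \<Rightarrow> bool" where
  "regular_mod J [] \<longleftrightarrow> True"
| "regular_mod J (f # fs) \<longleftrightarrow> nonzerodivisor_mod J f \<and> regular_mod (adjoin J f) fs"

lemma regular_mod_imp_koszul_exact:
  assumes "ideal_in J" "finite N" "\<And>v. v \<in> N \<Longrightarrow> x v \<in> A"
    and "set fs \<subseteq> gen (x ` N)" "regular_mod J fs" "i < length fs"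
  shows "koszul_exact x N J i"
  using assms
proof (induction fs arbitrary: J i)
  case (Cons f fs)
  have "f \<in> A" using Cons.prems ideal_inD(1)[OF ideal_in_gen[of "x ` N"]] by auto
  show ?case
  proof (rule koszul_exact_of_adjoin)
    show "koszul_exact x N (adjoin J f) m" if "i = Suc m" for m
      by (rule Cons.IH) (use Cons.prems that \<open>f \<in> A\<close> ideal_in_adjoin in auto)
  qed (use Cons.prems \<open>f \<in> A\<close> in auto)
qed simp

text \<open>Exactness at level 0 says that nothing outside \<open>J\<close> is killed by all
  variables modulo \<open>J\<close>, which provides a nonzerodivisor. Adjoining it costs one level,
  so \<open>t\<close> levels yield \<open>t\<close> entries.\<close>

lemma koszul_exact_imp_regular_mod:
  assumes noetherian "ideal_in J" and x: "\<And>v. v \<in> N \<Longrightarrow> x v \<in> A"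
    and "\<And>i. i < t \<Longrightarrow> koszul_exact x N J i"
  shows "\<exists>fs. length fs = t \<and> set fs \<subseteq> gen (x ` N) \<and> regular_mod J fs"
  using assms(2,4)
proof (induction t arbitrary: J)
  case (Suc t)
  let ?M = "gen (x ` N)"
  have M: "ideal_in ?M" using x by (intro ideal_in_gen) auto
  have "\<exists>f\<in>?M. nonzerodivisor_mod J f"
  proof (rule exists_nonzerodivisor_mod[OF assms(1) Suc.prems(1) M])
    fix a assume a: "a \<in> A" "\<And>f. f \<in> ?M \<Longrightarrow> f * a \<in> J"
    \<comment> \<open>A constant cochain suffices, since level 0 looks at the empty set
      only.\<close>
    have "koszul_diff x (\<lambda>_. a) G \<in> J" if G: "G \<subseteq> N" "card G = Suc 0" for G
    proof -
      obtain v where v: "G = {v}" using G(2) by (auto simp: card_Suc_eq)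
      then have "x v \<in> ?M" using G gen_subset[of "x ` N"] by blast
      then have "x v * a \<in> J" by (rule a(2))
      then show ?thesis
        using ideal_inD(4)[OF Suc.prems(1) face_sign_in] by (simp add: v koszul_diff_def mult.assoc)
    qed
    from koszul_exactD[OF Suc.prems(2)[of 0] a(1) this]
    have "\<exists>u. a - koszul_diff x u {} \<in> J" by fastforce
    then show "a \<in> J" by simp
  qed
  then obtain f where f: "f \<in> ?M" "nonzerodivisor_mod J f" by blast
  have fA: "f \<in> A" using ideal_inD(1)[OF M f(1)] .
  have "\<exists>fs. length fs = t \<and> set fs \<subseteq> ?M \<and> regular_mod (adjoin J f) fs"
    by (rule Suc.IH[OF ideal_in_adjoin[OF Suc.prems(1) fA]])
      (rule koszul_exact_adjoin[OF Suc.prems(1) x fA f(2)]; use Suc.prems(2) in simp)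
  then obtain fs where "length fs = t" "set fs \<subseteq> ?M" "regular_mod (adjoin J f) fs" by blast
  then show ?case using f by (intro exI[of _ "f # fs"]) auto
qed simp

end

section \<open>Polynomial rings are noetherian\<close>

text \<open>Hilbert's basis theorem for a ring \<open>A'\<close> generated by \<open>y\<close> over \<open>A\<close>, where \<open>D n\<close> plays the
  role of the polynomials in \<open>y\<close> of degree less than \<open>n\<close>.\<close>

locale ring_extension = base: carrier_ring A + ext: carrier_ring A' for A A' :: "'b::comm_ring_1 set" +
  fixes y :: 'b and D :: "nat \<Rightarrow> 'b set"
  assumes A_sub: "A \<subseteq> A'" and y_in: "y \<in> A'"
    and D_0: "D 0 \<subseteq> {0}"
    and D_sub: "D n \<subseteq> A'" and D_zero: "0 \<in> D n"
    and D_add: "p \<in> D n \<Longrightarrow> q \<in> D n \<Longrightarrow> p + q \<in> D n"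
    and D_cmult: "a \<in> A \<Longrightarrow> p \<in> D n \<Longrightarrow> a * p \<in> D n"
    and D_y: "p \<in> D n \<Longrightarrow> y * p \<in> D (Suc n)"
    and D_cover: "p \<in> A' \<Longrightarrow> \<exists>n. p \<in> D n"
    and D_Suc: "p \<in> D (Suc n) \<Longrightarrow> \<exists>q\<in>A. \<exists>p'\<in>D n. p = q * y ^ n + p'"
begin

definition lead :: "'b set \<Rightarrow> nat \<Rightarrow> 'b set" where
  "lead J n = {q \<in> A. \<exists>p\<in>D n. q * y ^ n + p \<in> J}"

lemma ideal_in_lead:
  assumes J: "ext.ideal_in J"
  shows "base.ideal_in (lead J n)"
proof (rule base.ideal_inI)
  show "0 \<in> lead J n"
    using D_zero[of n] ext.ideal_inD(2)[OF J] base.zero_in by (force simp: lead_def)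
next
  fix a b assume a: "a \<in> lead J n" and b: "b \<in> lead J n"
  then obtain p q where pq: "p \<in> D n" "a * y ^ n + p \<in> J" "q \<in> D n" "b * y ^ n + q \<in> J"
    by (auto simp: lead_def)
  have "(a + b) * y ^ n + (p + q) = (a * y ^ n + p) + (b * y ^ n + q)" by (simp add: algebra_simps)
  then have "(a + b) * y ^ n + (p + q) \<in> J" using ext.ideal_inD(3)[OF J pq(2,4)] by metis
  then show "a + b \<in> lead J n"
    using a b D_add[OF pq(1,3)] base.add_in by (auto simp: lead_def)
next
  fix a b assume a: "a \<in> A" and b: "b \<in> lead J n"
  then obtain q where q: "q \<in> D n" "b * y ^ n + q \<in> J" by (auto simp: lead_def)
  have "a * b * y ^ n + a * q = a * (b * y ^ n + q)" by (simp add: algebra_simps)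
  then have "a * b * y ^ n + a * q \<in> J" using ext.ideal_inD(4)[OF J _ q(2), of a] a A_sub by auto
  then show "a * b \<in> lead J n"
    using a b D_cmult[OF a q(1)] base.mult_in by (auto simp: lead_def)
qed (auto simp: lead_def)

lemma lead_Suc:
  assumes J: "ext.ideal_in J"
  shows "lead J n \<subseteq> lead J (Suc n)"
proof
  fix a assume a: "a \<in> lead J n"
  then obtain p where p: "p \<in> D n" "a * y ^ n + p \<in> J" by (auto simp: lead_def)
  have "a * y ^ Suc n + y * p = y * (a * y ^ n + p)" by (simp add: algebra_simps)
  then have "a * y ^ Suc n + y * p \<in> J" using ext.ideal_inD(4)[OF J y_in p(2)] by simp
  then show "a \<in> lead J (Suc n)" using a D_y[OF p(1)] unfolding lead_def by blast
qed

lemma lead_mono: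
  assumes J: "ext.ideal_in J" and "m \<le> n"
  shows "lead J m \<subseteq> lead J n"
  using lift_Suc_mono_le[of "lead J", OF lead_Suc[OF J]] assms(2) by blast

text \<open>The increasing ideals \<open>lead J n\<close> are constant from some \<open>m\<close>
  on, because their union is finitely generated. Lifts of generators of \<open>lead J n\<close> for
  all \<open>n \<le> m\<close> then generate \<open>J\<close>.\<close>

lemma noetherian_extension:
  assumes noeth: "base.noetherian"
  shows "ext.noetherian"
  unfolding ext.noetherian_def
proof (intro allI impI)
  fix J assume J: "ext.ideal_in J"
  have "base.ideal_in (\<Union>n. lead J n)"
  proof (rule base.ideal_inI)
    fix a b assume "a \<in> (\<Union>n. lead J n)" "b \<in> (\<Union>n. lead J n)"
    then obtain m n where "a \<in> lead J m" "b \<in> lead J n" by auto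
    then have "a \<in> lead J (max m n)" "b \<in> lead J (max m n)"
      using lead_mono[OF J, of m "max m n"] lead_mono[OF J, of n "max m n"] by auto
    then show "a + b \<in> (\<Union>n. lead J n)"
      using base.ideal_inD(3)[OF ideal_in_lead[OF J]] by blast
  next
    show "0 \<in> (\<Union>n. lead J n)" using base.ideal_inD(2)[OF ideal_in_lead[OF J]] by blast
    show "a * b \<in> (\<Union>n. lead J n)" if "a \<in> A" "b \<in> (\<Union>n. lead J n)" for a b
      using that base.ideal_inD(4)[OF ideal_in_lead[OF J]] by blast
  qed (auto simp: lead_def)
  then obtain G where G: "finite G" "G \<subseteq> (\<Union>n. lead J n)"
      "\<And>J'. base.ideal_in J' \<Longrightarrow> G \<subseteq> J' \<Longrightarrow> (\<Union>n. lead J n) \<subseteq> J'"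
    using noeth unfolding base.noetherian_def by meson
  have "\<exists>m. G \<subseteq> lead J m"
    using G(1,2)
  proof (induction G rule: finite_induct)
    case (insert g G)
    then obtain m n where "G \<subseteq> lead J m" "g \<in> lead J n" by auto
    then have "insert g G \<subseteq> lead J (max m n)"
      using lead_mono[OF J, of m "max m n"] lead_mono[OF J, of n "max m n"] by auto
    then show ?case ..
  qed simp
  then obtain m where "G \<subseteq> lead J m" ..
  then have m: "lead J n \<subseteq> lead J m" for n
    using G(3)[OF ideal_in_lead[OF J, of m]] by blast
  have "\<forall>n. \<exists>G. finite G \<and> G \<subseteq> lead J n \<and> (\<forall>J'. base.ideal_in J' \<longrightarrow> G \<subseteq> J' \<longrightarrow> lead J n \<subseteq> J')"
    using noeth ideal_in_lead[OF J] unfolding base.noetherian_def by blast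
  then obtain H where H: "\<And>n. finite (H n)" "\<And>n. H n \<subseteq> lead J n"
      "\<And>n J'. base.ideal_in J' \<Longrightarrow> H n \<subseteq> J' \<Longrightarrow> lead J n \<subseteq> J'"
    by metis
  define e where "e n q = (SOME p. p \<in> D n \<and> q * y ^ n + p \<in> J)" for n q
  have e: "e n q \<in> D n" "q * y ^ n + e n q \<in> J" if "q \<in> H n" for n q
  proof -
    have "\<exists>p. p \<in> D n \<and> q * y ^ n + p \<in> J"
      using H(2)[of n] that by (auto simp: lead_def)
    from someI_ex[OF this] show "e n q \<in> D n" "q * y ^ n + e n q \<in> J" by (simp_all add: e_def)
  qed
  define \<Gamma> where "\<Gamma> = (\<Union>n\<in>{..m}. (\<lambda>q. q * y ^ n + e n q) ` H n)"
  have "finite \<Gamma>" using H(1) by (simp add: \<Gamma>_def)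
  moreover have "\<Gamma> \<subseteq> J" using e(2) by (auto simp: \<Gamma>_def)
  moreover have "J \<subseteq> J'" if J': "ext.ideal_in J'" "\<Gamma> \<subseteq> J'" for J'
  proof -
    \<comment> \<open>Intersecting with \<open>J\<close> keeps the remainders of the degree
      reduction inside \<open>J\<close>, where the induction hypothesis applies.\<close>
    let ?I = "J \<inter> J'"
    have I: "ext.ideal_in ?I" using ext.ideal_in_Inter[of "{J, J'}"] J J' by auto
    have low: "lead J n \<subseteq> lead ?I n" if "n \<le> m" for n
    proof (rule H(3)[OF ideal_in_lead[OF I]])
      show "H n \<subseteq> lead ?I n"
      proof
        fix q assume q: "q \<in> H n"
        then have "q * y ^ n + e n q \<in> \<Gamma>" using \<open>n \<le> m\<close> unfolding \<Gamma>_def by blast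
        then show "q \<in> lead ?I n"
          using q e[OF q] H(2)[of n] J'(2) unfolding lead_def by blast
      qed
    qed
    have lead: "lead J n \<subseteq> lead ?I n" for n
    proof (cases "n \<le> m")
      case False
      then show ?thesis using m[of n] low[of m] lead_mono[OF I, of m n] by auto
    qed (rule low)
    have "p \<in> ?I" if "p \<in> J" "p \<in> D n" for p n
      using that
    proof (induction n arbitrary: p)
      case 0
      then show ?case using D_0 ext.ideal_inD(2)[OF I] by auto
    next
      case (Suc n)
      obtain q p' where q: "q \<in> A" "p' \<in> D n" "p = q * y ^ n + p'" using D_Suc[OF Suc.prems(2)] by blast
      then have "q \<in> lead J n" using Suc.prems(1) by (auto simp: lead_def)
      then have "q \<in> lead ?I n" using lead by blast
      then obtain p'' where p'': "p'' \<in> D n" "q * y ^ n + p'' \<in> ?I" by (auto simp: lead_def)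
      have "- 1 * p'' \<in> D n" using D_cmult[OF base.uminus_in[OF base.one_in] p''(1)] .
      then have "p' - p'' \<in> D n" using D_add[OF q(2)] by fastforce
      moreover have "p - (q * y ^ n + p'') \<in> J" using ext.ideal_inD(6)[OF J Suc.prems(1)] p''(2) by blast
      then have "p' - p'' \<in> J" by (simp add: q(3))
      ultimately have "p' - p'' \<in> ?I" using Suc.IH by blast
      then have "(q * y ^ n + p'') + (p' - p'') \<in> ?I" by (rule ext.ideal_inD(3)[OF I p''(2)])
      then show ?case by (simp add: q(3))
    qed
    then show ?thesis using D_cover ext.ideal_inD(1)[OF J] by blast
  qed
  ultimately show "\<exists>G. finite G \<and> G \<subseteq> J \<and> (\<forall>J'. ext.ideal_in J' \<longrightarrow> G \<subseteq> J' \<longrightarrow> J \<subseteq> J')"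
    by blast
qed

end

section \<open>Polynomials in a finite set of variables\<close>

definition polys :: "'v set \<Rightarrow> ('v, 'k::field) mpoly set" where
  "polys V = {p. \<forall>m \<in> keys p. keys m \<subseteq> V}"

lemma keys_mult_subset:
  "m \<in> keys (p * q :: ('v, 'k::field) mpoly) \<Longrightarrow>
    \<exists>a b. a \<in> keys p \<and> b \<in> keys q \<and> m = a + b"
  using keys_mult[of p q] by blast

lemma keys_plus_nat: "keys (a + b :: 'v \<Rightarrow>\<^sub>0 nat) = keys a \<union> keys b"
  by (auto simp: in_keys_iff lookup_add)

lemma polys_carrier_ring: "carrier_ring (polys V :: ('v, 'k::field) mpoly set)"
proof
  fix a b :: "('v, 'k) mpoly"
  assume a: "a \<in> polys V"
  show "- a \<in> polys V" using a by (simp add: polys_def keys_uminus)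
  assume b: "b \<in> polys V"
  show "a + b \<in> polys V" using a b keys_add[of a b] unfolding polys_def by blast
  show "a * b \<in> polys V"
    unfolding polys_def
  proof (intro CollectI ballI)
    fix m assume "m \<in> keys (a * b)"
    then obtain i j where "i \<in> keys a" "j \<in> keys b" "m = i + j"
      using keys_mult_subset by blast
    then show "keys m \<subseteq> V" using a b by (simp add: polys_def keys_plus_nat)
  qed
qed (auto simp: polys_def)

interpretation polys: carrier_ring "polys V :: ('v, 'k::field) mpoly set" for V
  by (rule polys_carrier_ring)

lemma poly_eq_sum_singles:
  "(p :: 'a \<Rightarrow>\<^sub>0 'b::comm_monoid_add) = (\<Sum>m\<in>keys p. single m (lookup p m))"
  by (rule poly_mapping_eqI) (simp add: lookup_sum lookup_single when_def in_keys_iff)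

lemma poly_var_power:
  "(poly_var v :: ('v, 'k::field) mpoly) ^ n = single (single v n) 1"
proof (induction n)
  case (Suc n)
  then show ?case by (simp add: poly_var_def mult_single flip: single_add)
qed simp

lemma polys_mono: "V \<subseteq> W \<Longrightarrow> polys V \<subseteq> polys W"
  by (auto simp: polys_def)

lemma single_in_polys: "keys m \<subseteq> V \<Longrightarrow> single m c \<in> polys V"
  by (simp add: polys_def)

lemma poly_var_in_polys: "v \<in> V \<Longrightarrow> poly_var v \<in> polys V"
  unfolding poly_var_def by (rule single_in_polys) simp

text \<open>Without variables only constants remain, so a nonzero ideal contains an invertible
  element.\<close>

lemma noetherian_polys_empty:
  "carrier_ring.noetherian (polys {} :: ('v, 'k::field) mpoly set)"
  unfolding polys.noetherian_def
proof (intro allI impI)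
  fix J :: "('v, 'k) mpoly set"
  assume J: "polys.ideal_in {} J"
  show "\<exists>G. finite G \<and> G \<subseteq> J \<and> (\<forall>J'. polys.ideal_in {} J' \<longrightarrow> G \<subseteq> J' \<longrightarrow> J \<subseteq> J')"
  proof (cases "J \<subseteq> {0}")
    case True
    then show ?thesis using polys.ideal_inD(2) by (intro exI[of _ "{}"]) blast
  next
    case False
    then obtain p where p: "p \<in> J" "p \<noteq> 0" by blast
    have single: "m = 0" if "q \<in> polys {}" "m \<in> keys q" for q :: "('v, 'k) mpoly" and m
      using that by (auto simp: polys_def)
    have pc: "p \<in> polys {}" using polys.ideal_inD(1)[OF J p(1)] .
    define c where "c = lookup p 0"
    have pe: "p = single 0 c"
      using single[OF pc] by (intro poly_mapping_eqI) (auto simp: c_def lookup_single when_def in_keys_iff)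
    have "c \<noteq> 0" using p(2) pe by auto
    have "J \<subseteq> J'" if J': "polys.ideal_in {} J'" "p \<in> J'" for J'
    proof
      fix q assume q: "q \<in> J"
      have "single 0 (1 / c) * p = (1 :: ('v, 'k) mpoly)"
        using \<open>c \<noteq> 0\<close> by (simp add: pe mult_single)
      moreover have "single 0 (1 / c) * p \<in> J'"
        by (rule polys.ideal_inD(4)[OF J'(1) single_in_polys J'(2)]) simp
      ultimately have "1 \<in> J'" by simp
      then show "q \<in> J'"
        using polys.ideal_inD(4)[OF J'(1) polys.ideal_inD(1)[OF J q], of 1] by simp
    qed
    then show ?thesis using p(1) by (intro exI[of _ "{p}"]) auto
  qed
qed

text \<open>Degree is measured in \<open>v\<close> alone: the monomials with exponent exactly
  \<open>n\<close> at \<open>v\<close>, divided by the \<open>n\<close>-th power of that variable,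
  supply a coefficient in \<open>polys V\<close>.\<close>

lemma noetherian_polys_insert:
  assumes v: "v \<notin> V"
    and "carrier_ring.noetherian (polys V :: ('v, 'k::field) mpoly set)"
  shows "carrier_ring.noetherian (polys (insert v V) :: ('v, 'k) mpoly set)"
proof -
  define D :: "nat \<Rightarrow> ('v, 'k) mpoly set" where
    "D n = {p \<in> polys (insert v V). \<forall>m\<in>keys p. lookup m v < n}" for n
  interpret ring_extension "polys V :: ('v, 'k) mpoly set" "polys (insert v V)" "poly_var v" D
  proof
    show "polys V \<subseteq> polys (insert v V)" by (rule polys_mono) auto
    show "poly_var v \<in> polys (insert v V)" by (rule poly_var_in_polys) simp
    show "D 0 \<subseteq> {0}" by (auto simp: D_def)
    show "D n \<subseteq> polys (insert v V)" "0 \<in> D n" for n by (auto simp: D_def polys.zero_in)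
    show "p + q \<in> D n" if "p \<in> D n" "q \<in> D n" for p q n
      using that keys_add[of p q] polys.add_in unfolding D_def by blast
    show "a * p \<in> D n" if a: "a \<in> polys V" and p: "p \<in> D n" for a p n
      unfolding D_def
    proof (intro CollectI conjI ballI)
      show "a * p \<in> polys (insert v V)"
        by (rule polys.mult_in) (use a p polys_mono[of V "insert v V"] in \<open>auto simp: D_def\<close>)
      fix m assume "m \<in> keys (a * p)"
      then obtain i j where ij: "i \<in> keys a" "j \<in> keys p" "m = i + j"
        using keys_mult_subset by blast
      have "v \<notin> keys i" using ij(1) a v by (auto simp: polys_def)
      then have "lookup i v = 0" by (simp add: in_keys_iff)
      then show "lookup m v < n" using ij p by (auto simp: D_def lookup_add)
    qed
    show "poly_var v * p \<in> D (Suc n)" if p: "p \<in> D n" for p n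
      unfolding D_def
    proof (intro CollectI conjI ballI)
      show "poly_var v * p \<in> polys (insert v V)"
        by (rule polys.mult_in[OF poly_var_in_polys]) (use p in \<open>auto simp: D_def\<close>)
      fix m assume "m \<in> keys (poly_var v * p)"
      then obtain i j where ij: "i \<in> keys (poly_var v :: ('v, 'k) mpoly)"
          "j \<in> keys p" "m = i + j"
        using keys_mult_subset by blast
      have "i = single v 1" using ij(1) by (simp add: poly_var_def split: if_splits)
      then show "lookup m v < Suc n"
        using ij p by (auto simp: D_def lookup_add lookup_single)
    qed
    show "\<exists>n. p \<in> D n" if p: "p \<in> polys (insert v V)" for p
    proof -
      let ?S = "(\<lambda>m. lookup m v) ` keys p"
      have "lookup m v < Suc (Max ?S)" if "m \<in> keys p" for m
        using Max_ge[of ?S "lookup m v"] that by (simp add: less_Suc_eq_le)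
      then show ?thesis using p unfolding D_def by blast
    qed
    fix p n assume p: "p \<in> D (Suc n)"
    define T where "T = {m \<in> keys p. lookup m v = n}"
    define B where "B = {m \<in> keys p. lookup m v < n}"
    define q where "q = (\<Sum>m\<in>T. single (m - single v n) (lookup p m))"
    define p' where "p' = (\<Sum>m\<in>B. single m (lookup p m))"
    have fin: "finite T" "finite B" by (auto simp: T_def B_def)
    have keys: "keys p = T \<union> B" "T \<inter> B = {}"
      using p by (auto simp: T_def B_def D_def less_Suc_eq)
    have sub: "keys m \<subseteq> insert v V" if "m \<in> T \<union> B" for m
      using p that keys(1) by (auto simp: D_def polys_def)
    have "q \<in> polys V"
      unfolding q_def
    proof (intro polys.sum_in single_in_polys subsetI)
      fix m w assume m: "m \<in> T" and w: "w \<in> keys (m - single v n)"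
      have "w \<noteq> v" using m w by (auto simp: T_def in_keys_iff lookup_minus lookup_single)
      moreover have "w \<in> keys m"
        using w by (auto simp: in_keys_iff lookup_minus)
      ultimately show "w \<in> V" using sub[of m] m by auto
    qed
    moreover have "p' \<in> D n"
    proof -
      have "p' \<in> polys (insert v V)"
        unfolding p'_def by (intro polys.sum_in single_in_polys sub) auto
      moreover have "m \<in> B" if "m \<in> keys p'" for m
        using that fin(2) by (auto simp: p'_def in_keys_iff lookup_sum lookup_single when_def split: if_splits)
      ultimately show ?thesis by (auto simp: D_def B_def)
    qed
    moreover have "p = q * poly_var v ^ n + p'"
    proof -
      have "q * poly_var v ^ n = (\<Sum>m\<in>T. single m (lookup p m))"
        unfolding q_def sum_distrib_right poly_var_power
      proof (rule sum.cong[OF refl])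
        fix m assume m: "m \<in> T"
        have "m - single v n + single v n = m"
          using m by (intro poly_mapping_eqI) (auto simp: T_def lookup_add lookup_minus lookup_single when_def)
        then show "single (m - single v n) (lookup p m) *
            single (single v n) 1 = single m (lookup p m)"
          by (simp add: mult_single)
      qed
      moreover have "p = (\<Sum>m\<in>T. single m (lookup p m)) + p'"
        unfolding p'_def sum.union_disjoint[OF fin keys(2), symmetric] keys(1)[symmetric]
        by (rule poly_eq_sum_singles)
      ultimately show ?thesis by simp
    qed
    ultimately show "\<exists>q\<in>polys V. \<exists>p'\<in>D n. p = q * poly_var v ^ n + p'" by blast
  qed
  show ?thesis by (rule noetherian_extension[OF assms(2)])
qed

lemma noetherian_polys:
  "finite V \<Longrightarrow> carrier_ring.noetherian (polys V :: ('v, 'k::field) mpoly set)"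
  by (induction V rule: finite_induct) (auto intro: noetherian_polys_empty noetherian_polys_insert)

section \<open>The Koszul complex of a Stanley-Reisner ring\<close>

text \<open>The Stanley-Reisner ideal described by its monomials, see
  \<open>stanley_reisner_ideal_eq\<close>. Membership is decided coefficient by coefficient, which
  lets the Koszul complex split by multidegree.\<close>

definition face_ideal :: "'v set set \<Rightarrow> ('v, 'k::field) mpoly set" where
  "face_ideal \<Delta> = {p \<in> polys (\<Union>\<Delta>). \<forall>m \<in> keys p. keys m \<notin> \<Delta>}"

lemma lookup_poly_var_mult:
  fixes p :: "('v, 'k::field) mpoly"
  shows "lookup (poly_var v * p) m =
    (if v \<in> keys m then lookup p (m - single v 1) else 0)"
proof -
  have e: "single v 1 + m' = m \<longleftrightarrow>
      v \<in> keys m \<and> m' = m - single v 1" for m' :: "'v \<Rightarrow>\<^sub>0 nat"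
  proof
    assume "v \<in> keys m \<and> m' = m - single v 1"
    then show "single v 1 + m' = m"
      by (intro poly_mapping_eqI) (auto simp: lookup_add lookup_minus lookup_single when_def in_keys_iff)
  qed (auto simp: keys_plus_nat)
  have "poly_var v * p = (\<Sum>m'\<in>keys p. poly_var v * single m' (lookup p m'))"
    by (subst (1) poly_eq_sum_singles[of p]) (simp add: sum_distrib_left)
  then have "lookup (poly_var v * p) m =
      (\<Sum>m'\<in>keys p. if single v 1 + m' = m then lookup p m' else 0)"
    by (simp add: poly_var_def mult_single lookup_sum lookup_single when_def)
  also have "\<dots> = (if v \<in> keys m then lookup p (m - single v 1) else 0)"
    unfolding e by (auto simp: in_keys_iff sum.delta')
  finally show ?thesis .
qed

lemma lookup_face_sign_mult:
  fixes p :: "'a::monoid_add \<Rightarrow>\<^sub>0 'k::field"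
  shows "lookup ((- 1) ^ n * p) m = (- 1) ^ n * lookup p m"
  by (induction n) (simp_all add: mult.assoc)

text \<open>Signs need an ordered vertex set and \<open>'v\<close> carries no order, so the vertices
  are numbered by \<open>\<phi>\<close>. The set \<open>N\<close> of numbers stays free, to be
  placed above the facet indices later.\<close>

locale enumerated_complex =
  fixes \<Delta> :: "'v set set" and N :: "nat set" and \<phi> :: "nat \<Rightarrow> 'v"
  assumes finN: "finite N" and bij: "bij_betw \<phi> N (\<Union>\<Delta>)"
    and empty_face: "{} \<in> \<Delta>" and down: "F \<in> \<Delta> \<Longrightarrow> H \<subseteq> F \<Longrightarrow> H \<in> \<Delta>"
begin

lemma inj: "inj_on \<phi> N" and img: "\<phi> ` N = \<Union>\<Delta>"
  using bij by (auto simp: bij_betw_def)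

lemma ideal_in_face_ideal: "polys.ideal_in (\<Union>\<Delta>) (face_ideal \<Delta> :: ('v, 'k::field) mpoly set)"
proof (rule polys.ideal_inI)
  fix a b :: "('v, 'k) mpoly"
  assume b: "b \<in> face_ideal \<Delta>"
  show "a + b \<in> face_ideal \<Delta>" if "a \<in> face_ideal \<Delta>"
    using that b keys_add[of a b] polys.add_in unfolding face_ideal_def by blast
  assume a: "a \<in> polys (\<Union>\<Delta>)"
  show "a * b \<in> face_ideal \<Delta>"
    unfolding face_ideal_def
  proof (intro CollectI conjI ballI)
    show "a * b \<in> polys (\<Union>\<Delta>)" using a b by (auto simp: face_ideal_def intro: polys.mult_in)
    fix m assume "m \<in> keys (a * b)"
    then obtain i j where ij: "i \<in> keys a" "j \<in> keys b" "m = i + j"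
      using keys_mult_subset by blast
    then have "keys j \<notin> \<Delta>" using b by (simp add: face_ideal_def)
    then show "keys m \<notin> \<Delta>" using down[of "keys m"] ij by (auto simp: keys_plus_nat)
  qed
qed (auto simp: face_ideal_def polys.zero_in)

abbreviation (input) var :: "nat \<Rightarrow> ('v, 'k::field) mpoly" where
  "var i \<equiv> poly_var (\<phi> i)"

lemma var_in: "i \<in> N \<Longrightarrow> var i \<in> polys (\<Union>\<Delta>)"
  using img by (intro poly_var_in_polys) blast

text \<open>The Koszul complex is graded by the exponent vectors \<open>c\<close> shifted by \<open>(1, \<dots>, 1)\<close>: in degree \<open>c\<close>,
  the component indexed by \<open>G\<close> is spanned by the monomial with exponent vector \<open>c\<close> minus the
  indicator function of \<open>N - G\<close>, provided that this difference is nonnegative.\<close>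

definition indicator_exp :: "nat set \<Rightarrow> 'v \<Rightarrow>\<^sub>0 nat" where
  "indicator_exp U = (\<Sum>i\<in>U. single (\<phi> i) 1)"

definition valid :: "('v \<Rightarrow>\<^sub>0 nat) \<Rightarrow> nat set \<Rightarrow> bool" where
  "valid c G \<longleftrightarrow> (\<forall>i\<in>N - G. \<phi> i \<in> keys c)"

definition expo :: "('v \<Rightarrow>\<^sub>0 nat) \<Rightarrow> nat set \<Rightarrow> 'v \<Rightarrow>\<^sub>0 nat" where
  "expo c G = c - indicator_exp (N - G)"

text \<open>The sets whose monomial in degree \<open>c\<close> exists and survives modulo
  \<open>face_ideal \<Delta>\<close>.\<close>

definition degree_cells :: "('v \<Rightarrow>\<^sub>0 nat) \<Rightarrow> nat set set" where
  "degree_cells c = {G. G \<subseteq> N \<and> valid c G \<and> keys (expo c G) \<in> \<Delta>}"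

definition part :: "('v \<Rightarrow>\<^sub>0 nat) \<Rightarrow> (nat set \<Rightarrow> ('v, 'k::field) mpoly) \<Rightarrow> nat set \<Rightarrow> 'k" where
  "part c z G = (if valid c G then lookup (z G) (expo c G) else 0)"

lemma lookup_indicator_exp:
  assumes "U \<subseteq> N"
  shows "i \<in> N \<Longrightarrow> lookup (indicator_exp U) (\<phi> i) = (if i \<in> U then 1 else 0)"
    and "v \<notin> \<Union>\<Delta> \<Longrightarrow> lookup (indicator_exp U) v = 0"
proof -
  have fU: "finite U" using assms finN by (rule finite_subset)
  { assume i: "i \<in> N"
    have "lookup (indicator_exp U) (\<phi> i) = (\<Sum>j\<in>U. if j = i then 1 else 0)"
      unfolding indicator_exp_def lookup_sum lookup_single when_def
      by (rule sum.cong[OF refl]) (use inj i assms in \<open>auto dest: inj_onD\<close>)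
    then show "lookup (indicator_exp U) (\<phi> i) = (if i \<in> U then 1 else 0)"
      using fU by simp }
  { assume v: "v \<notin> \<Union>\<Delta>"
    show "lookup (indicator_exp U) v = 0"
      unfolding indicator_exp_def lookup_sum lookup_single when_def
      by (rule sum.neutral) (use v assms img in auto) }
qed

lemma lookup_expo:
  shows "i \<in> N \<Longrightarrow> lookup (expo c G) (\<phi> i) =
      lookup c (\<phi> i) - (if i \<in> G then 0 else 1)"
    and "v \<notin> \<Union>\<Delta> \<Longrightarrow> lookup (expo c G) v = lookup c v"
  using lookup_indicator_exp[of "N - G"] by (auto simp: expo_def lookup_minus)

lemma exponent_eqI:
  assumes "\<And>i. i \<in> N \<Longrightarrow> lookup a (\<phi> i) = lookup b (\<phi> i)"
    and "\<And>v. v \<notin> \<Union>\<Delta> \<Longrightarrow> lookup a v = lookup b v"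
  shows "a = b"
proof (rule poly_mapping_eqI)
  fix v
  show "lookup a v = lookup b v"
  proof (cases "v \<in> \<phi> ` N")
    case False
    then show ?thesis using assms(2) unfolding img by blast
  qed (use assms(1) in auto)
qed

text \<open>Exponents are subtracted in \<open>nat\<close>; \<open>valid\<close> is the condition
  under which nothing is cut off.\<close>

lemma expo_plus: "valid c G \<Longrightarrow> expo c G + indicator_exp (N - G) = c"
  by (rule exponent_eqI)
    (auto simp: lookup_add lookup_expo lookup_indicator_exp valid_def in_keys_iff)

lemma expo_add_indicator: "expo (m + indicator_exp (N - G)) G = m"
  by (simp add: expo_def)

lemma valid_add_indicator: "valid (m + indicator_exp (N - G)) G"
  by (auto simp: valid_def in_keys_iff lookup_add lookup_indicator_exp)

lemma expo_remove:
  assumes "i \<in> G" "G \<subseteq> N"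
  shows "\<phi> i \<in> keys (expo c G) \<longleftrightarrow> \<phi> i \<in> keys c"
    and "expo c G - single (\<phi> i) 1 = expo c (G - {i})"
    and "valid c (G - {i}) \<longleftrightarrow> valid c G \<and> \<phi> i \<in> keys c"
proof -
  have i: "i \<in> N" using assms by auto
  show "\<phi> i \<in> keys (expo c G) \<longleftrightarrow> \<phi> i \<in> keys c"
    using i assms(1) by (simp add: in_keys_iff lookup_expo)
  show "expo c G - single (\<phi> i) 1 = expo c (G - {i})"
  proof (rule exponent_eqI)
    fix j assume j: "j \<in> N"
    then have "\<phi> i = \<phi> j \<longleftrightarrow> i = j" using inj i by (auto dest: inj_onD)
    then show "lookup (expo c G - single (\<phi> i) 1) (\<phi> j) =
        lookup (expo c (G - {i})) (\<phi> j)"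
      using j assms by (auto simp: lookup_minus lookup_expo lookup_single when_def)
  next
    fix v assume "v \<notin> \<Union>\<Delta>"
    moreover then have "\<phi> i \<noteq> v" using i img by auto
    ultimately show "lookup (expo c G - single (\<phi> i) 1) v =
        lookup (expo c (G - {i})) v"
      by (simp add: lookup_minus lookup_expo lookup_single when_def)
  qed
  show "valid c (G - {i}) \<longleftrightarrow> valid c G \<and> \<phi> i \<in> keys c"
    using i assms(1) by (auto simp: valid_def)
qed

text \<open>Multiplying by \<open>var i\<close> shifts exponents exactly as removing
  \<open>i\<close> from \<open>G\<close> shifts \<open>expo c G\<close>, so within one degree the
  variables disappear from the differential.\<close>

lemma lookup_koszul_diff:
  fixes z :: "nat set \<Rightarrow> ('v, 'k::field) mpoly"
  assumes "valid c G" "G \<subseteq> N"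
  shows "lookup (koszul_diff var z G) (expo c G) = coboundary (part c z) G"
  unfolding koszul_diff_def lookup_sum
proof (rule sum.cong[OF refl])
  fix i assume i: "i \<in> G"
  show "lookup (face_sign G i * var i * z (G - {i})) (expo c G) =
      face_sign G i * 1 * part c z (G - {i})"
    unfolding face_sign_def mult.assoc lookup_face_sign_mult lookup_poly_var_mult part_def
      expo_remove[OF i assms(2)]
    using assms(1) by simp
qed

lemma keys_expo_mono:
  assumes "H \<subseteq> G" "G \<subseteq> N"
  shows "keys (expo c H) \<subseteq> keys (expo c G)"
proof
  fix v assume v: "v \<in> keys (expo c H)"
  show "v \<in> keys (expo c G)"
  proof (cases "v \<in> \<phi> ` N")
    case True
    then obtain i where "i \<in> N" "v = \<phi> i" by auto
    then show ?thesis using v assms by (auto simp: in_keys_iff lookup_expo split: if_splits)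
  next
    case False
    then show ?thesis using v img by (simp add: in_keys_iff lookup_expo)
  qed
qed

text \<open>A set \<open>G - {i}\<close> can fail to be a cell only by being invalid, since the
  support of its exponent vector is contained in a face; and \<open>part\<close> is zero at invalid
  sets.\<close>

lemma coboundary_restrict_degree_cells:
  assumes "G \<in> degree_cells c"
  shows "coboundary (restrict0 (degree_cells c) (part c z)) G = coboundary (part c z) G"
proof (rule koszul_diff_cong)
  fix i assume i: "i \<in> G"
  show "restrict0 (degree_cells c) (part c z) (G - {i}) = part c z (G - {i})"
  proof (cases "valid c (G - {i})")
    case True
    have "keys (expo c (G - {i})) \<in> \<Delta>"
      by (rule down[OF _ keys_expo_mono[of _ G]]) (use assms in \<open>auto simp: degree_cells_def\<close>)
    then have "G - {i} \<in> degree_cells c" using True assms by (auto simp: degree_cells_def)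
    then show ?thesis by simp
  qed (simp add: restrict0_def part_def)
qed

lemma face_ideal_lookup: "p \<in> face_ideal \<Delta> \<Longrightarrow> keys m \<in> \<Delta> \<Longrightarrow> lookup p m = 0"
  by (auto simp: face_ideal_def in_keys_iff)

lemma koszul_exact_imp_degree_cells_exact:
  assumes ex: "carrier_ring.koszul_exact (polys (\<Union>\<Delta>) :: ('v, 'k::field) mpoly set)
      var N (face_ideal \<Delta>) i"
  shows "cochain_exact (k :: 'k itself) (degree_cells c) i"
  unfolding cochain_exact_def
proof (intro allI impI)
  fix \<zeta> :: "nat set \<Rightarrow> 'k"
  assume \<zeta>: "supported_on (degree_cells c) \<zeta>"
    and d\<zeta>: "\<forall>G\<in>degree_cells c. card G = Suc i \<longrightarrow> coboundary \<zeta> G = 0"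
  \<comment> \<open>The cochain is spread out into monomials of degree \<open>c\<close>; a primitive
    of the result is projected back to this degree at the end.\<close>
  define z where "z G = single (expo c G) (\<zeta> G)" for G
  have zin: "z G \<in> polys (\<Union>\<Delta>)" for G
  proof (cases "G \<in> degree_cells c")
    case True
    then show ?thesis unfolding z_def by (intro single_in_polys) (auto simp: degree_cells_def)
  next
    case False
    then show ?thesis using \<zeta> by (simp add: z_def supported_on_def polys.zero_in)
  qed
  have part_z: "part c z G = \<zeta> G" for G
    using \<zeta> by (auto simp: part_def z_def degree_cells_def supported_on_def lookup_single)
  have "koszul_diff var z G \<in> face_ideal \<Delta>" if G: "G \<subseteq> N" "card G = Suc i" for G
    unfolding face_ideal_def
  proof (intro CollectI conjI ballI)
    show "koszul_diff var z G \<in> polys (\<Union>\<Delta>)"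
      by (rule polys.koszul_diff_in_ideal[OF polys.ideal_in_carrier])
        (use G zin in \<open>auto intro: var_in\<close>)
    fix m assume m: "m \<in> keys (koszul_diff var z G)"
    \<comment> \<open>Every monomial that occurs is \<open>expo c G\<close>. If its support were a
      face, its coefficient would be a value of the coboundary of \<open>\<zeta>\<close> at a cell,
      which is zero.\<close>
    have "\<exists>j\<in>G. lookup (face_sign G j * var j * z (G - {j})) m \<noteq> 0"
    proof (rule ccontr)
      assume "\<not> ?thesis"
      then have "lookup (koszul_diff var z G) m = 0"
        unfolding koszul_diff_def lookup_sum by (intro sum.neutral) auto
      then show False using m by (simp add: in_keys_iff)
    qed
    then obtain j where j: "j \<in> G" "lookup (face_sign G j * var j * z (G - {j})) m \<noteq> 0" by blast
    then have nz: "\<phi> j \<in> keys m" "m - single (\<phi> j) 1 = expo c (G - {j})" "\<zeta> (G - {j}) \<noteq> 0"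
      unfolding face_sign_def mult.assoc lookup_face_sign_mult lookup_poly_var_mult z_def lookup_single
      by (auto split: if_splits simp: when_def)
    have cell: "G - {j} \<in> degree_cells c" using nz(3) \<zeta> by (auto simp: supported_on_def)
    then have v: "valid c (G - {j})" by (simp add: degree_cells_def)
    then have vG: "valid c G" "\<phi> j \<in> keys c" using expo_remove(3)[OF j(1) G(1)] by auto
    have "m = (m - single (\<phi> j) 1) + single (\<phi> j) 1"
      using nz(1) by (intro poly_mapping_eqI) (auto simp: lookup_add lookup_minus lookup_single when_def in_keys_iff)
    also have "\<dots> = (expo c G - single (\<phi> j) 1) + single (\<phi> j) 1"
      using nz(2) expo_remove(2)[OF j(1) G(1)] by simp
    also have "\<dots> = expo c G"
      using vG(2) expo_remove(1)[OF j(1) G(1)]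
      by (intro poly_mapping_eqI) (auto simp: lookup_add lookup_minus lookup_single when_def in_keys_iff)
    finally have me: "m = expo c G" .
    show "keys m \<notin> \<Delta>"
    proof
      assume "keys m \<in> \<Delta>"
      then have "G \<in> degree_cells c" using G(1) vG(1) me by (simp add: degree_cells_def)
      moreover have "part c z = \<zeta>" using part_z by blast
      ultimately have "lookup (koszul_diff var z G) m = 0"
        using d\<zeta> G(2) by (simp add: me lookup_koszul_diff[OF vG(1) G(1)])
      then show False using m by (simp add: in_keys_iff)
    qed
  qed
  from polys.koszul_exactD[OF ex zin this]
  obtain u :: "nat set \<Rightarrow> ('v, 'k) mpoly"
    where u: "\<And>G. G \<subseteq> N \<Longrightarrow> card G = i \<Longrightarrow> z G - koszul_diff var u G \<in> face_ideal \<Delta>"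
    by blast
  show "\<exists>u. supported_on (degree_cells c) u \<and> (\<forall>G\<in>degree_cells c. card G = i \<longrightarrow> \<zeta> G = coboundary u G)"
  proof (intro exI conjI ballI impI)
    show "supported_on (degree_cells c) (restrict0 (degree_cells c) (part c u))" by simp
    fix G assume G: "G \<in> degree_cells c" "card G = i"
    then have GN: "G \<subseteq> N" "valid c G" "keys (expo c G) \<in> \<Delta>" by (auto simp: degree_cells_def)
    have "lookup (z G - koszul_diff var u G) (expo c G) = 0"
      by (rule face_ideal_lookup[OF u[OF GN(1) G(2)] GN(3)])
    then have "\<zeta> G = coboundary (part c u) G"
      using lookup_koszul_diff[OF GN(2,1), of u] by (simp add: lookup_minus z_def)
    then show "\<zeta> G = coboundary (restrict0 (degree_cells c) (part c u)) G"
      by (simp add: coboundary_restrict_degree_cells[OF G(1)])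
  qed
qed

lemma degree_cells_exact_imp_koszul_exact:
  assumes ex: "\<And>c. cochain_exact (k :: 'k itself) (degree_cells c) i"
  shows "carrier_ring.koszul_exact (polys (\<Union>\<Delta>) :: ('v, 'k::field) mpoly set)
      var N (face_ideal \<Delta>) i"
  unfolding polys.koszul_exact_def
proof (intro allI impI)
  fix z :: "nat set \<Rightarrow> ('v, 'k) mpoly"
  assume zin: "\<forall>G. z G \<in> polys (\<Union>\<Delta>)"
    and dz: "\<forall>G. G \<subseteq> N \<longrightarrow> card G = Suc i \<longrightarrow> koszul_diff var z G \<in> face_ideal \<Delta>"
  \<comment> \<open>The finitely many degrees in which \<open>z\<close> has a component; primitives
    are chosen degree by degree and added up over \<open>C\<close>.\<close>
  define C where "C = (\<Union>G\<in>Pow N. (\<lambda>m. m + indicator_exp (N - G)) ` keys (z G))"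
  have finC: "finite C" using finN by (simp add: C_def)
  have C0: "part c z G = 0" if "c \<notin> C" "G \<subseteq> N" for c G
  proof (rule ccontr)
    assume "part c z G \<noteq> 0"
    then have "valid c G" "expo c G \<in> keys (z G)"
      by (auto simp: part_def in_keys_iff split: if_splits)
    then have "c \<in> C" using expo_plus[of c G] that(2) unfolding C_def by force
    then show False using that(1) by simp
  qed
  have "\<exists>u. supported_on (degree_cells c) u \<and>
      (\<forall>G. G \<in> degree_cells c \<longrightarrow> card G = i \<longrightarrow> part c z G = coboundary u G)" for c
  proof -
    have "coboundary (restrict0 (degree_cells c) (part c z)) G = 0"
      if G: "G \<in> degree_cells c" "card G = Suc i" for G
    proof -
      have GN: "G \<subseteq> N" "valid c G" "keys (expo c G) \<in> \<Delta>" using G by (auto simp: degree_cells_def)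
      have "lookup (koszul_diff var z G) (expo c G) = 0"
        by (rule face_ideal_lookup[OF _ GN(3)]) (use dz GN G in auto)
      then show ?thesis
        by (simp add: coboundary_restrict_degree_cells[OF G(1)] lookup_koszul_diff[OF GN(2,1)])
    qed
    from cochain_exactD[OF ex supported_on_restrict0 this] show ?thesis by force
  qed
  then obtain \<upsilon> where \<upsilon>: "\<And>c. supported_on (degree_cells c) (\<upsilon> c)"
      "\<And>c G. G \<in> degree_cells c \<Longrightarrow> card G = i \<Longrightarrow> part c z G = coboundary (\<upsilon> c) G"
    by metis
  define u where "u H = (\<Sum>c\<in>C. single (expo c H) (\<upsilon> c H))" for H
  have uin: "u H \<in> polys (\<Union>\<Delta>)" for H
    unfolding u_def
  proof (rule polys.sum_in)
    fix c
    show "single (expo c H) (\<upsilon> c H) \<in> polys (\<Union>\<Delta>)"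
    proof (cases "H \<in> degree_cells c")
      case True
      then show ?thesis by (intro single_in_polys) (auto simp: degree_cells_def)
    next
      case False
      then show ?thesis using \<upsilon>(1)[of c] by (simp add: supported_on_def polys.zero_in)
    qed
  qed
  have part_u: "part c u H = (if c \<in> C then \<upsilon> c H else 0)" for c H
  proof (cases "valid c H")
    case True
    have "lookup (u H) (expo c H) = (\<Sum>c'\<in>C. if c' = c then \<upsilon> c' H else 0)"
      unfolding u_def lookup_sum lookup_single when_def
    proof (rule sum.cong[OF refl])
      fix c'
      \<comment> \<open>Different degrees contribute different monomials, since a valid
        \<open>H\<close> allows \<open>c'\<close> to be recovered from
        \<open>expo c' H\<close>.\<close>
      have "c' = c" if "expo c' H = expo c H" "\<upsilon> c' H \<noteq> 0"
      proof -
        have "valid c' H" using that(2) \<upsilon>(1)[of c'] by (auto simp: supported_on_def degree_cells_def)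
        then show ?thesis using expo_plus[of c' H] expo_plus[OF True] that(1) by metis
      qed
      then show "(if expo c' H = expo c H then \<upsilon> c' H else 0) = (if c' = c then \<upsilon> c' H else 0)" by auto
    qed
    then show ?thesis using True finC by (simp add: part_def)
  next
    case False
    then have "\<upsilon> c H = 0" using \<upsilon>(1)[of c] by (auto simp: supported_on_def degree_cells_def)
    then show ?thesis using False by (simp add: part_def)
  qed
  have "z G - koszul_diff var u G \<in> face_ideal \<Delta>" if G: "G \<subseteq> N" "card G = i" for G
    unfolding face_ideal_def
  proof (intro CollectI conjI ballI)
    have "koszul_diff var u G \<in> polys (\<Union>\<Delta>)"
      by (rule polys.koszul_diff_in_ideal[OF polys.ideal_in_carrier])
        (use G uin in \<open>auto intro: var_in\<close>)
    then show "z G - koszul_diff var u G \<in> polys (\<Union>\<Delta>)" using zin polys.minus_in by blast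
    fix m assume m: "m \<in> keys (z G - koszul_diff var u G)"
    show "keys m \<notin> \<Delta>"
    proof
      assume face: "keys m \<in> \<Delta>"
      define c where "c = m + indicator_exp (N - G)"
      have c: "valid c G" "expo c G = m"
        by (simp_all add: c_def valid_add_indicator expo_add_indicator)
      then have cell: "G \<in> degree_cells c" using G face by (simp add: degree_cells_def)
      have zG: "lookup (z G) m = part c z G" using c by (simp add: part_def)
      have uG: "lookup (koszul_diff var u G) m = coboundary (part c u) G"
        using lookup_koszul_diff[OF c(1) G(1), of u] c(2) by simp
      have "part c z G = coboundary (part c u) G"
      proof (cases "c \<in> C")
        case True
        then have "part c u = \<upsilon> c" using part_u by auto
        then show ?thesis using \<upsilon>(2)[OF cell G(2)] by simp
      next
        case False
        then have "part c u = (\<lambda>_. 0)" using part_u by auto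
        then show ?thesis using C0[OF False G(1)] by simp
      qed
      then show False using m zG uG by (simp add: in_keys_iff lookup_minus)
    qed
  qed
  then show "\<exists>u. (\<forall>G. u G \<in> polys (\<Union>\<Delta>)) \<and>
      (\<forall>G. G \<subseteq> N \<longrightarrow> card G = i \<longrightarrow> z G - koszul_diff var u G \<in> face_ideal \<Delta>)"
    using uin by blast
qed

definition star_family :: "nat set \<Rightarrow> nat set set" where
  "star_family W = {G. W \<subseteq> G \<and> G \<subseteq> N \<and> \<phi> ` (G - W) \<in> \<Delta>}"

text \<open>Here \<open>c\<close> is the indicator vector of the complement of
  \<open>W = {i \<in> N. \<phi> i \<notin> keys c}\<close>, so validity of \<open>G\<close> means
  \<open>W \<subseteq> G\<close>, and the exponent vector has support \<open>G - W\<close>.\<close>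

lemma degree_cells_le_1:
  assumes "keys c \<subseteq> \<Union>\<Delta>" "\<And>i. i \<in> N \<Longrightarrow> lookup c (\<phi> i) \<le> 1"
  shows "degree_cells c = star_family {i \<in> N. \<phi> i \<notin> keys c}"
proof -
  have v: "valid c G \<longleftrightarrow> {i \<in> N. \<phi> i \<notin> keys c} \<subseteq> G" for G
    by (auto simp: valid_def)
  have k: "keys (expo c G) = \<phi> ` (G - {i \<in> N. \<phi> i \<notin> keys c})"
    if G: "G \<subseteq> N" for G
  proof (intro equalityI subsetI)
    fix w assume w: "w \<in> keys (expo c G)"
    have "w \<in> \<Union>\<Delta>"
    proof (rule ccontr)
      assume out: "w \<notin> \<Union>\<Delta>"
      then have "w \<in> keys c" using w lookup_expo(2)[OF out, of c G] by (simp add: in_keys_iff)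
      then show False using assms(1) out by blast
    qed
    then obtain i where i: "i \<in> N" "w = \<phi> i" using img by auto
    then show "w \<in> \<phi> ` (G - {i \<in> N. \<phi> i \<notin> keys c})"
      using w assms(2)[OF i(1)] by (auto simp: in_keys_iff lookup_expo split: if_splits)
  next
    fix w assume "w \<in> \<phi> ` (G - {i \<in> N. \<phi> i \<notin> keys c})"
    then show "w \<in> keys (expo c G)"
      using G by (auto simp: in_keys_iff lookup_expo)
  qed
  show ?thesis unfolding degree_cells_def star_family_def using v k by auto
qed

text \<open>The exponent at \<open>i\<close> stays positive whether or not \<open>i\<close> belongs
  to \<open>G\<close>, so neither validity nor the support depends on \<open>i\<close>, and the
  cells form a cone.\<close>

lemma degree_cells_ge_2_exact:
  assumes "i \<in> N" "lookup c (\<phi> i) \<ge> 2"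
  shows "cochain_exact k (degree_cells c) n"
proof (rule cochain_exact_cone[of _ i])
  fix G assume G: "G \<in> degree_cells c"
  then show "finite G" using finN finite_subset by (auto simp: degree_cells_def)
  have keys: "keys (expo c H) = keys (expo c G)" if H: "H - {i} = G - {i}" for H
  proof -
    have "(v \<in> keys (expo c H)) = (v \<in> keys (expo c G))" for v
    proof (cases "v \<in> \<phi> ` N")
      case True
      then obtain j where j: "j \<in> N" "v = \<phi> j" by auto
      have "j \<in> H \<longleftrightarrow> j \<in> G" if "j \<noteq> i" using H that by blast
      then show ?thesis using j assms by (cases "j = i") (auto simp: in_keys_iff lookup_expo)
    next
      case False
      then show ?thesis using img by (simp add: in_keys_iff lookup_expo)
    qed
    then show ?thesis by blast
  qed
  have ic: "\<phi> i \<in> keys c" using assms(2) by (simp add: in_keys_iff)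
  show "insert i G \<in> degree_cells c" "G - {i} \<in> degree_cells c"
    using G assms(1) ic keys[of "insert i G"] keys[of "G - {i}"] by (auto simp: degree_cells_def valid_def)
qed

text \<open>Only indicator vectors of sets \<open>N - W\<close> matter as degrees: an exponent of at
  least 2 at a vertex gives a cone, and support outside the vertex set leaves no cells.\<close>

lemma koszul_exact_face_ideal_iff:
  "carrier_ring.koszul_exact (polys (\<Union>\<Delta>) :: ('v, 'k::field) mpoly set) var N (face_ideal \<Delta>) i
   \<longleftrightarrow> (\<forall>W\<subseteq>N. cochain_exact (k :: 'k itself) (star_family W) i)"
proof (intro iffI allI impI)
  fix W
  assume ex: "carrier_ring.koszul_exact (polys (\<Union>\<Delta>) :: ('v, 'k) mpoly set) var N (face_ideal \<Delta>) i"
    and W: "W \<subseteq> N"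
  let ?c = "indicator_exp (N - W)"
  have "keys ?c \<subseteq> \<Union>\<Delta>" using lookup_indicator_exp(2)[of "N - W"] by (auto simp: in_keys_iff)
  then have "degree_cells ?c = star_family {i \<in> N. \<phi> i \<notin> keys ?c}"
    by (rule degree_cells_le_1) (simp add: lookup_indicator_exp)
  also have "{i \<in> N. \<phi> i \<notin> keys ?c} = W"
    using W by (auto simp: in_keys_iff lookup_indicator_exp split: if_splits)
  finally show "cochain_exact k (star_family W) i"
    using koszul_exact_imp_degree_cells_exact[OF ex, of k ?c] by simp
next
  assume ex: "\<forall>W\<subseteq>N. cochain_exact k (star_family W) i"
  show "carrier_ring.koszul_exact (polys (\<Union>\<Delta>) :: ('v, 'k) mpoly set) var N (face_ideal \<Delta>) i"
  proof (rule degree_cells_exact_imp_koszul_exact)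
    fix c
    show "cochain_exact k (degree_cells c) i"
    proof (cases "keys c \<subseteq> \<Union>\<Delta>")
      case False
      then obtain v where v: "v \<in> keys c" "v \<notin> \<Union>\<Delta>" by blast
      then have "v \<in> keys (expo c G)" for G by (simp add: in_keys_iff lookup_expo)
      then have "degree_cells c = {}" using v(2) by (auto simp: degree_cells_def)
      then show ?thesis by (auto intro: cochain_exact_empty_level)
    next
      case True
      show ?thesis
      proof (cases "\<exists>i\<in>N. lookup c (\<phi> i) \<ge> 2")
        case True
        then show ?thesis using degree_cells_ge_2_exact by blast
      next
        case False
        then have "degree_cells c = star_family {i \<in> N. \<phi> i \<notin> keys c}"
          by (intro degree_cells_le_1[OF True]) force
        then show ?thesis using ex by simp
      qed
    qed
  qed
qed

end

section \<open>Depth of a Stanley-Reisner ring\<close>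

lemma (in ring) Idl_quotient_image:
  assumes I: "ideal I R" and S: "S \<subseteq> carrier R"
  shows "Idl\<^bsub>R Quot I\<^esub> ((+>) I ` S) = (+>) I ` (Idl (I \<union> S))"
proof -
  interpret I: ideal I R by (rule I)
  interpret Q: ring "R Quot I" by (rule I.quotient_is_ring)
  have IS: "I \<union> S \<subseteq> carrier R" using S I.a_subset by blast
  have hom: "ring_hom_ring R (R Quot I) ((+>) I)" by (rule I.rcos_ring_hom_ring)
  have Sim: "(+>) I ` S \<subseteq> carrier (R Quot I)"
    using S ring_hom_closed[OF I.rcos_ring_hom] by blast
  show ?thesis
  proof
    show "Idl\<^bsub>R Quot I\<^esub> ((+>) I ` S) \<subseteq> (+>) I ` (Idl (I \<union> S))"
      by (rule Q.genideal_minimal[OF ring_ideal_imp_quot_ideal[OF I genideal_ideal[OF IS]]])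
        (use genideal_self[OF IS] in blast)
    let ?K = "{a \<in> carrier R. I +> a \<in> Idl\<^bsub>R Quot I\<^esub> ((+>) I ` S)}"
    have K: "ideal ?K R"
      by (rule ring_hom_ring.ideal_vimage[OF hom Q.genideal_ideal[OF Sim]])
    have "I \<union> S \<subseteq> ?K"
    proof
      fix a assume a: "a \<in> I \<union> S"
      show "a \<in> ?K"
      proof (cases "a \<in> S")
        case True
        then show ?thesis using S Q.genideal_self[OF Sim] by blast
      next
        case False
        then have "I +> a = \<zero>\<^bsub>R Quot I\<^esub>" using a by (simp add: FactRing_def I.a_rcos_const)
        moreover have "\<zero>\<^bsub>R Quot I\<^esub> \<in> Idl\<^bsub>R Quot I\<^esub> ((+>) I ` S)"
          using Q.genideal_ideal[OF Sim] additive_subgroup.zero_closed[OF ideal.axioms(1)] by blast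
        ultimately show ?thesis using a IS by auto
      qed
    qed
    then show "(+>) I ` (Idl (I \<union> S)) \<subseteq> Idl\<^bsub>R Quot I\<^esub> ((+>) I ` S)"
      using genideal_minimal[OF K] by blast
  qed
qed

lemma (in ring) quotient_image_mem_iff:
  assumes I: "ideal I R" and K: "ideal K R" and "I \<subseteq> K" and a: "a \<in> carrier R"
  shows "I +> a \<in> (+>) I ` K \<longleftrightarrow> a \<in> K"
proof
  assume "I +> a \<in> (+>) I ` K"
  then obtain b where b: "b \<in> K" "I +> a = I +> b" by blast
  have "a \<in> I +> a"
    using abelian_subgroup.a_rcos_self[OF abelian_subgroupI3[OF ideal.axioms(1)[OF I] is_abelian_group] a] .
  then have "a \<in> I +> b" using b(2) by simp
  then obtain i where "i \<in> I" "a = i \<oplus> b" by (auto simp: a_r_coset_def')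
  then show "a \<in> K"
    using assms(3) b(1) additive_subgroup.a_closed[OF ideal.axioms(1)[OF K], of i b] by auto
qed blast

text \<open>Ideals generated by residue classes are images of ideals containing \<open>I\<close>, so
  regularity can be tested on representatives.\<close>

lemma (in ring) regular_sequence_quotient_iff:
  assumes I: "ideal I R" and fs: "set fs \<subseteq> carrier R"
  shows "regular_sequence (R Quot I) (map ((+>) I) fs) \<longleftrightarrow>
    (\<forall>i<length fs. \<forall>a\<in>carrier R.
       fs ! i \<otimes> a \<in> Idl (I \<union> set (take i fs)) \<longrightarrow> a \<in> Idl (I \<union> set (take i fs))) \<and>
    Idl (I \<union> set fs) \<noteq> carrier R"
proof -
  interpret I: ideal I R by (rule I)
  have car: "carrier (R Quot I) = (+>) I ` carrier R"
    by (auto simp: FactRing_def A_RCOSETS_def')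
  have mem: "I +> a \<in> Idl\<^bsub>R Quot I\<^esub> ((+>) I ` S) \<longleftrightarrow> a \<in> Idl (I \<union> S)"
    if "a \<in> carrier R" "S \<subseteq> carrier R" for a S
  proof -
    have IS: "I \<union> S \<subseteq> carrier R" using that I.a_subset by blast
    show ?thesis
      unfolding Idl_quotient_image[OF I that(2)]
      by (rule quotient_image_mem_iff[OF I genideal_ideal[OF IS] _ that(1)])
        (use genideal_self[OF IS] in blast)
  qed
  have take: "set (take i (map ((+>) I) fs)) = (+>) I ` set (take i fs)" "set (take i fs) \<subseteq> carrier R" for i
    using fs set_take_subset[of i fs] by (auto simp: take_map)
  have nth: "(I +> fs ! i) \<otimes>\<^bsub>R Quot I\<^esub> (I +> a) = I +> (fs ! i \<otimes> a)" "fs ! i \<otimes> a \<in> carrier R"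
    if "i < length fs" "a \<in> carrier R" for i a
    using that fs by (auto simp: ring_hom_mult[OF I.rcos_ring_hom] subset_iff)
  have proper: "Idl\<^bsub>R Quot I\<^esub> ((+>) I ` set fs) = (+>) I ` carrier R \<longleftrightarrow> Idl (I \<union> set fs) = carrier R"
  proof
    assume *: "Idl\<^bsub>R Quot I\<^esub> ((+>) I ` set fs) = (+>) I ` carrier R"
    have "a \<in> Idl (I \<union> set fs)" if "a \<in> carrier R" for a
      using mem[OF that fs] that unfolding * by blast
    moreover have "Idl (I \<union> set fs) \<subseteq> carrier R"
      using ideal.axioms(1)[OF genideal_ideal, of "I \<union> set fs"] additive_subgroup.a_subset I.a_subset fs
      by blast
    ultimately show "Idl (I \<union> set fs) = carrier R" by blast
  qed (simp add: Idl_quotient_image[OF I fs])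
  show ?thesis
    unfolding regular_sequence_def length_map set_map take(1) car proper
    using fs by (simp add: image_mono nth mem take(2))
qed

section \<open>Matching the algebraic structures with the concrete ideals\<close>

lemma (in carrier_ring) gen_ideal_in: "ideal_in J \<Longrightarrow> gen J = J"
  using gen_least[of J J] gen_subset[of J] by blast

lemma (in carrier_ring) gen_adjoin:
  assumes J: "ideal_in J" and f: "f \<in> A" and S: "S \<subseteq> A"
  shows "gen (adjoin J f \<union> S) = gen (J \<union> insert f S)"
proof
  have JA: "J \<subseteq> A" using J by (simp add: ideal_in_def)
  have fJ: "adjoin J f \<subseteq> A" using ideal_in_adjoin[OF J f] by (simp add: ideal_in_def)
  have id: "ideal_in (gen (J \<union> insert f S))" by (rule ideal_in_gen) (use JA f S in auto)
  have sub: "J \<union> insert f S \<subseteq> gen (J \<union> insert f S)" by (rule gen_subset)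
  have "adjoin J f \<subseteq> gen (J \<union> insert f S)" by (rule adjoin_least[OF id]) (use sub in auto)
  then show "gen (adjoin J f \<union> S) \<subseteq> gen (J \<union> insert f S)"
    by (intro gen_least[OF id]) (use sub in auto)
  have "ideal_in (gen (adjoin J f \<union> S))" by (rule ideal_in_gen) (use fJ S in auto)
  then show "gen (J \<union> insert f S) \<subseteq> gen (adjoin J f \<union> S)"
    using gen_subset[of "adjoin J f \<union> S"] adjoin_superset[OF J, of f] adjoin_mem[OF J, of f]
    by (intro gen_least) blast+
qed

lemma (in carrier_ring) regular_mod_iff:
  assumes "ideal_in J" "set fs \<subseteq> A"
  shows "regular_mod J fs \<longleftrightarrow>
    (\<forall>i<length fs. nonzerodivisor_mod (gen (J \<union> set (take i fs))) (fs ! i))"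
  using assms
proof (induction fs arbitrary: J)
  case (Cons f fs)
  have f: "f \<in> A" and fs: "set fs \<subseteq> A" using Cons.prems(2) by auto
  have "gen (adjoin J f \<union> set (take i fs)) = gen (J \<union> set (take (Suc i) (f # fs)))" for i
    using gen_adjoin[OF Cons.prems(1) f, of "set (take i fs)"] fs set_take_subset[of i fs] by auto
  then show ?case
    using Cons.IH[OF ideal_in_adjoin[OF Cons.prems(1) f] fs]
    by (simp add: All_less_Suc2 gen_ideal_in[OF Cons.prems(1)])
qed simp

lemma polynomial_ring_simps [simp]:
  "carrier (polynomial_ring k V) = polys V"
  "monoid.mult (polynomial_ring k V) = (*)" "one (polynomial_ring k V) = 1"
  "ring.zero (polynomial_ring k V) = 0" "add (polynomial_ring k V) = (+)"
  by (simp_all add: polynomial_ring_def polys_def)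

lemma cring_polynomial_ring: "cring (polynomial_ring k V)"
proof (rule cringI)
  show "abelian_group (polynomial_ring k V)"
  proof (rule abelian_groupI)
    fix x assume "x \<in> carrier (polynomial_ring k V)"
    then show "\<exists>y\<in>carrier (polynomial_ring k V). y \<oplus>\<^bsub>polynomial_ring k V\<^esub> x = \<zero>\<^bsub>polynomial_ring k V\<^esub>"
      by (intro bexI[of _ "- x"]) (auto intro: polys.uminus_in)
  qed (auto simp: polys.add_in polys.zero_in algebra_simps)
  show "comm_monoid (polynomial_ring k V)"
    by (rule comm_monoidI) (auto simp: polys.mult_in polys.one_in algebra_simps)
qed (auto simp: algebra_simps)

lemma ideal_polynomial_ring_iff: "ideal J (polynomial_ring k V) \<longleftrightarrow> polys.ideal_in V J"
proof
  interpret R: cring "polynomial_ring k V" by (rule cring_polynomial_ring)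
  {
    assume J: "ideal J (polynomial_ring k V)"
    note add = ideal.axioms(1)[OF J]
    show "polys.ideal_in V J"
    proof (rule polys.ideal_inI)
      show "J \<subseteq> polys V" using additive_subgroup.a_subset[OF add] by simp
      show "0 \<in> J" using additive_subgroup.zero_closed[OF add] by simp
      show "a + b \<in> J" if "a \<in> J" "b \<in> J" for a b
        using additive_subgroup.a_closed[OF add that] by simp
      show "a * b \<in> J" if "a \<in> polys V" "b \<in> J" for a b
        using ideal.I_l_closed[OF J that(2), of a] that(1) by simp
    qed
  next
    assume J: "polys.ideal_in V J"
    have inv: "inv\<^bsub>add_monoid (polynomial_ring k V)\<^esub> a = - a" if "a \<in> polys V" for a
      by (rule group.inv_equality[OF R.a_group]) (use that in \<open>auto intro: polys.uminus_in\<close>)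
    show "ideal J (polynomial_ring k V)"
    proof (rule idealI)
      show "ring (polynomial_ring k V)" by (rule R.ring_axioms)
      show "subgroup J (add_monoid (polynomial_ring k V))"
      proof
        show "J \<subseteq> carrier (add_monoid (polynomial_ring k V))"
          using polys.ideal_inD(1)[OF J] by auto
        fix a assume a: "a \<in> J"
        show "inv\<^bsub>add_monoid (polynomial_ring k V)\<^esub> a \<in> J"
          using inv[OF polys.ideal_inD(1)[OF J a]] polys.ideal_inD(5)[OF J a] by simp
      qed (use polys.ideal_inD(2,3)[OF J] in auto)
    qed (use polys.ideal_inD(4,7)[OF J] in auto)
  }
qed

lemma genideal_polynomial_ring: "Idl\<^bsub>polynomial_ring k V\<^esub> S = polys.gen V S"
  unfolding genideal_def polys.gen_def ideal_polynomial_ring_iff ..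

lemma prod_poly_var:
  "finite F \<Longrightarrow> (\<Prod>v\<in>F. poly_var v :: ('v, 'k::field) mpoly) =
    single (\<Sum>v\<in>F. single v 1) 1"
  by (induction F rule: finite_induct) (simp_all add: poly_var_def mult_single)

lemma keys_sum_single: "finite F \<Longrightarrow> keys (\<Sum>v\<in>F. single v (1::nat)) = F"
  by (induction F rule: finite_induct) (auto simp: keys_plus_nat)

context enumerated_complex
begin

lemma finite_vertices: "finite (\<Union>\<Delta>)"
  using finN img by (metis finite_imageI)

text \<open>A monomial whose support is not a face is a multiple of the squarefree generator
  belonging to its support; conversely these generators satisfy the monomial condition.\<close>

lemma stanley_reisner_ideal_eq: "stanley_reisner_ideal (k :: 'k::field itself) \<Delta> = face_ideal \<Delta>"
proof -
  define S :: "('v, 'k) mpoly set"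
    where "S = {\<Prod>v\<in>F. poly_var v | F. F \<subseteq> \<Union>\<Delta> \<and> F \<notin> \<Delta>}"
  have prod: "(\<Prod>v\<in>F. poly_var v) = (single (\<Sum>v\<in>F. single v 1) 1 :: ('v, 'k) mpoly)"
    and keys: "keys (\<Sum>v\<in>F. single v (1::nat)) = F" if "F \<subseteq> \<Union>\<Delta>" for F
    using finite_subset[OF that finite_vertices] by (rule prod_poly_var, rule keys_sum_single)
  have S: "S \<subseteq> face_ideal \<Delta>"
  proof
    fix p assume "p \<in> S"
    then obtain F where F: "p = (\<Prod>v\<in>F. poly_var v)" "F \<subseteq> \<Union>\<Delta>" "F \<notin> \<Delta>"
      unfolding S_def by blast
    then show "p \<in> face_ideal \<Delta>"
      using keys[OF F(2)] by (simp add: prod face_ideal_def polys_def del: One_nat_def)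
  qed
  then have SP: "S \<subseteq> polys (\<Union>\<Delta>)" by (auto simp: face_ideal_def)
  have "face_ideal \<Delta> \<subseteq> polys.gen (\<Union>\<Delta>) S"
  proof
    fix p :: "('v, 'k) mpoly" assume p: "p \<in> face_ideal \<Delta>"
    have id: "polys.ideal_in (\<Union>\<Delta>) (polys.gen (\<Union>\<Delta>) S)" by (rule polys.ideal_in_gen[OF SP])
    have "single m c \<in> polys.gen (\<Union>\<Delta>) S" if m: "m \<in> keys p" for m c
    proof -
      let ?F = "keys m" and ?e = "\<Sum>v\<in>keys m. single v (1::nat)"
      have F: "?F \<subseteq> \<Union>\<Delta>" "?F \<notin> \<Delta>" using p m by (auto simp: face_ideal_def polys_def)
      have "(\<Prod>v\<in>?F. poly_var v) \<in> S" unfolding S_def using F by blast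
      then have "(\<Prod>v\<in>?F. poly_var v) \<in> polys.gen (\<Union>\<Delta>) S"
        by (rule subsetD[OF polys.gen_subset])
      moreover have "single (m - ?e) c \<in> polys (\<Union>\<Delta>)"
        using F(1) by (intro single_in_polys) (auto simp: in_keys_iff lookup_minus)
      ultimately have "single (m - ?e) c * (\<Prod>v\<in>?F. poly_var v) \<in> polys.gen (\<Union>\<Delta>) S"
        by (intro polys.ideal_inD(4)[OF id])
      moreover have "m - ?e + ?e = m"
      proof (rule poly_mapping_eqI)
        fix v
        have "lookup ?e v = (if v \<in> ?F then 1 else 0)"
          by (simp add: lookup_sum lookup_single when_def)
        then show "lookup (m - ?e + ?e) v = lookup m v"
          by (auto simp: lookup_add lookup_minus in_keys_iff)
      qed
      ultimately show ?thesis by (simp add: prod[OF F(1)] mult_single)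
    qed
    then have "(\<Sum>m\<in>keys p. single m (lookup p m)) \<in> polys.gen (\<Union>\<Delta>) S"
      by (intro polys.ideal_in_sum[OF id])
    then show "p \<in> polys.gen (\<Union>\<Delta>) S" using poly_eq_sum_singles[of p] by simp
  qed
  then show ?thesis
    unfolding stanley_reisner_ideal_def genideal_polynomial_ring S_def[symmetric]
    using polys.gen_least[OF ideal_in_face_ideal S] by blast
qed

definition irrelevant_ideal :: "('v, 'k::field) mpoly set" where
  "irrelevant_ideal = polys.gen (\<Union>\<Delta>) (var ` N)"

lemma var_image: "var ` N = (poly_var ` \<Union>\<Delta> :: ('v, 'k::field) mpoly set)"
  using img by (metis image_image)

lemma ideal_in_irrelevant_ideal: "polys.ideal_in (\<Union>\<Delta>) irrelevant_ideal"
  unfolding irrelevant_ideal_def by (rule polys.ideal_in_gen) (use var_in in auto)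

text \<open>The variables lie in the ideal of polynomials without constant term.\<close>

lemma one_notin_irrelevant_ideal: "1 \<notin> (irrelevant_ideal :: ('v, 'k::field) mpoly set)"
proof -
  let ?K = "{p \<in> polys (\<Union>\<Delta>). 0 \<notin> keys p} :: ('v, 'k) mpoly set"
  have K: "polys.ideal_in (\<Union>\<Delta>) ?K"
  proof (rule polys.ideal_inI)
    fix a b :: "('v, 'k) mpoly"
    show "a + b \<in> ?K" if "a \<in> ?K" "b \<in> ?K"
      using that keys_add[of a b] by (auto intro: polys.add_in)
    show "a * b \<in> ?K" if "a \<in> polys (\<Union>\<Delta>)" "b \<in> ?K"
    proof -
      have "0 \<notin> keys (a * b)"
      proof
        assume "0 \<in> keys (a * b)"
        then obtain i j where ij: "i \<in> keys a" "j \<in> keys b" "0 = i + j"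
          using keys_mult_subset by blast
        then have "keys j = {}" using keys_plus_nat[of i j] by simp
        then show False using ij that by simp
      qed
      then show ?thesis using that polys.mult_in by blast
    qed
  qed (auto simp: polys.zero_in)
  have "var ` N \<subseteq> ?K"
  proof (intro subsetI)
    fix p :: "('v, 'k) mpoly" assume "p \<in> var ` N"
    then obtain i where i: "i \<in> N" "p = var i" by blast
    have "keys (single (\<phi> i) (1::nat)) \<noteq> {}" by simp
    then have "single (\<phi> i) (1::nat) \<noteq> 0" by (metis keys_zero)
    then have "0 \<notin> keys p" by (simp add: i(2) poly_var_def)
    then show "p \<in> ?K" using var_in[OF i(1)] i(2) by simp
  qed
  then have "irrelevant_ideal \<subseteq> ?K" unfolding irrelevant_ideal_def by (rule polys.gen_least[OF K])
  then show ?thesis by auto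
qed

text \<open>As \<open>{}\<close> is a face, a monomial whose support is not a face has nonempty
  support and is divisible by a variable.\<close>

lemma face_ideal_sub_irrelevant_ideal: "face_ideal \<Delta> \<subseteq> (irrelevant_ideal :: ('v, 'k::field) mpoly set)"
proof
  fix p :: "('v, 'k) mpoly" assume p: "p \<in> face_ideal \<Delta>"
  have "single m c \<in> (irrelevant_ideal :: ('v, 'k) mpoly set)"
    if m: "m \<in> keys p" for m c
  proof -
    have k: "keys m \<subseteq> \<Union>\<Delta>" "keys m \<notin> \<Delta>"
      using p m by (auto simp: face_ideal_def polys_def)
    then obtain v where v: "v \<in> keys m" using empty_face by (metis equals0I)
    have "poly_var v \<in> (irrelevant_ideal :: ('v, 'k) mpoly set)"
      unfolding irrelevant_ideal_def var_image
      by (rule subsetD[OF polys.gen_subset]) (use v k(1) in blast)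
    moreover have "single (m - single v 1) c \<in> polys (\<Union>\<Delta>)"
      using k(1) by (intro single_in_polys) (auto simp: in_keys_iff lookup_minus)
    ultimately have "single (m - single v 1) c * poly_var v
        \<in> (irrelevant_ideal :: ('v, 'k) mpoly set)"
      by (intro polys.ideal_inD(4)[OF ideal_in_irrelevant_ideal])
    moreover have "m - single v 1 + single v 1 = m"
      using v by (intro poly_mapping_eqI) (auto simp: lookup_add lookup_minus lookup_single when_def in_keys_iff)
    ultimately show ?thesis by (simp add: poly_var_def mult_single)
  qed
  then have "(\<Sum>m\<in>keys p. single m (lookup p m)) \<in> irrelevant_ideal"
    by (intro polys.ideal_in_sum[OF ideal_in_irrelevant_ideal])
  then show "p \<in> irrelevant_ideal" using poly_eq_sum_singles[of p] by simp
qed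

lemma homogeneous_maximal_ideal_eq:
  "homogeneous_maximal_ideal (k :: 'k::field itself) \<Delta> =
    (\<lambda>p. face_ideal \<Delta> +>\<^bsub>polynomial_ring k (\<Union>\<Delta>)\<^esub> p) ` irrelevant_ideal"
proof -
  interpret R: cring "polynomial_ring k (\<Union>\<Delta>)" by (rule cring_polynomial_ring)
  have I: "ideal (face_ideal \<Delta>) (polynomial_ring k (\<Union>\<Delta>))"
    by (simp add: ideal_polynomial_ring_iff ideal_in_face_ideal)
  have vars: "var ` N \<subseteq> (polys (\<Union>\<Delta>) :: ('v, 'k) mpoly set)" using var_in by auto
  have "polys.gen (\<Union>\<Delta>) (face_ideal \<Delta> \<union> var ` N) = (irrelevant_ideal :: ('v, 'k) mpoly set)"
  proof
    show "polys.gen (\<Union>\<Delta>) (face_ideal \<Delta> \<union> var ` N) \<subseteq> (irrelevant_ideal :: ('v, 'k) mpoly set)"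
    proof (rule polys.gen_least[OF ideal_in_irrelevant_ideal])
      have "var ` N \<subseteq> (irrelevant_ideal :: ('v, 'k) mpoly set)"
        unfolding irrelevant_ideal_def by (rule polys.gen_subset)
      then show "face_ideal \<Delta> \<union> var ` N \<subseteq> (irrelevant_ideal :: ('v, 'k) mpoly set)"
        using face_ideal_sub_irrelevant_ideal by blast
    qed
    show "(irrelevant_ideal :: ('v, 'k) mpoly set) \<subseteq> polys.gen (\<Union>\<Delta>) (face_ideal \<Delta> \<union> var ` N)"
      unfolding irrelevant_ideal_def by (rule polys.gen_mono) auto
  qed
  then show ?thesis
    unfolding homogeneous_maximal_ideal_def stanley_reisner_ring_def stanley_reisner_ideal_eq
    using R.Idl_quotient_image[OF I, of "var ` N"] vars
    by (simp add: genideal_polynomial_ring var_image image_image)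
qed

text \<open>Rees' theorem for this ring: sequences in the maximal ideal are lifted to the irrelevant
  ideal, where \<open>regular_mod\<close> and \<open>koszul_exact\<close> have been compared in both
  directions.\<close>

lemma depth_eq_Sup_koszul_exact:
  "depth (stanley_reisner_ring (k :: 'k::field itself) \<Delta>) (homogeneous_maximal_ideal k \<Delta>) =
    Sup {enat t | t. \<forall>i<t. carrier_ring.koszul_exact
      (polys (\<Union>\<Delta>) :: ('v, 'k) mpoly set) var N (face_ideal \<Delta>) i}"
proof -
  let ?R = "polynomial_ring k (\<Union>\<Delta>)" and ?I = "face_ideal \<Delta> :: ('v, 'k) mpoly set"
  let ?M = "irrelevant_ideal :: ('v, 'k) mpoly set"
  let ?\<pi> = "\<lambda>p. ?I +>\<^bsub>?R\<^esub> p"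
  interpret R: cring ?R by (rule cring_polynomial_ring)
  have I: "ideal ?I ?R" by (simp add: ideal_polynomial_ring_iff ideal_in_face_ideal)
  have M: "?M \<subseteq> polys (\<Union>\<Delta>)" using polys.ideal_inD(1)[OF ideal_in_irrelevant_ideal] by blast
  have reg: "regular_sequence (?R Quot ?I) (map ?\<pi> fs) \<longleftrightarrow> carrier_ring.regular_mod (polys (\<Union>\<Delta>)) ?I fs"
    if fs: "set fs \<subseteq> ?M" for fs
  proof -
    have fsA: "set fs \<subseteq> carrier ?R" using fs M by simp
    \<comment> \<open>Properness is automatic: the face ideal and the sequence stay inside the
      irrelevant ideal, which omits \<open>1\<close>.\<close>
    have sub: "polys.gen (\<Union>\<Delta>) (?I \<union> set fs) \<subseteq> ?M"
      using fs face_ideal_sub_irrelevant_ideal by (intro polys.gen_least[OF ideal_in_irrelevant_ideal]) auto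
    have "polys.gen (\<Union>\<Delta>) (?I \<union> set fs) \<noteq> polys (\<Union>\<Delta>)"
      using sub one_notin_irrelevant_ideal polys.one_in by blast
    then show ?thesis
      unfolding R.regular_sequence_quotient_iff[OF I fsA] genideal_polynomial_ring
      using fs M by (simp add: polys.regular_mod_iff[OF ideal_in_face_ideal] polys.nonzerodivisor_mod_def)
  qed
  have "(\<exists>gs. length gs = t \<and> set gs \<subseteq> ?\<pi> ` ?M \<and> regular_sequence (?R Quot ?I) gs) \<longleftrightarrow>
      (\<forall>i<t. carrier_ring.koszul_exact (polys (\<Union>\<Delta>)) var N ?I i)" for t
  proof
    assume "\<exists>gs. length gs = t \<and> set gs \<subseteq> ?\<pi> ` ?M \<and> regular_sequence (?R Quot ?I) gs"
    then obtain gs where gs: "length gs = t" "set gs \<subseteq> ?\<pi> ` ?M" "regular_sequence (?R Quot ?I) gs" by blast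
    then have "gs \<in> lists (?\<pi> ` ?M)" by auto
    then obtain fs where fs: "gs = map ?\<pi> fs" "set fs \<subseteq> ?M" unfolding lists_image by auto
    show "\<forall>i<t. carrier_ring.koszul_exact (polys (\<Union>\<Delta>)) var N ?I i"
    proof (intro allI impI)
      fix i assume "i < t"
      then show "carrier_ring.koszul_exact (polys (\<Union>\<Delta>)) var N ?I i"
        using gs fs reg[OF fs(2)] unfolding irrelevant_ideal_def
        by (intro polys.regular_mod_imp_koszul_exact[OF ideal_in_face_ideal finN var_in, where fs = fs]) auto
    qed
  next
    assume ex: "\<forall>i<t. carrier_ring.koszul_exact (polys (\<Union>\<Delta>)) var N ?I i"
    have "\<exists>fs. length fs = t \<and> set fs \<subseteq> ?M \<and> carrier_ring.regular_mod (polys (\<Union>\<Delta>)) ?I fs"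
      unfolding irrelevant_ideal_def
      by (rule polys.koszul_exact_imp_regular_mod[OF noetherian_polys[OF finite_vertices] ideal_in_face_ideal])
        (use ex var_in in auto)
    then obtain fs where fs: "length fs = t" "set fs \<subseteq> ?M"
        "carrier_ring.regular_mod (polys (\<Union>\<Delta>)) ?I fs"
      by blast
    then show "\<exists>gs. length gs = t \<and> set gs \<subseteq> ?\<pi> ` ?M \<and> regular_sequence (?R Quot ?I) gs"
      using reg by (intro exI[of _ "map ?\<pi> fs"]) auto
  qed
  moreover have "{enat (length gs) | gs. set gs \<subseteq> ?\<pi> ` ?M \<and> regular_sequence (?R Quot ?I) gs} =
      {enat t | t. \<exists>gs. length gs = t \<and> set gs \<subseteq> ?\<pi> ` ?M \<and> regular_sequence (?R Quot ?I) gs}"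
    by blast
  ultimately show ?thesis
    unfolding depth_def stanley_reisner_ring_def stanley_reisner_ideal_eq homogeneous_maximal_ideal_eq
    by simp
qed

end

section \<open>Passage to the given facets and comparison of the two extrema\<close>

lemma ex_facet:
  assumes "finite \<Delta>" "F \<in> \<Delta>"
  shows "\<exists>G\<in>facets \<Delta>. F \<subseteq> G"
proof -
  obtain G where "G \<in> \<Delta>" "F \<subseteq> G" "\<forall>H\<in>\<Delta>. G \<subseteq> H \<longrightarrow> G = H"
    using finite_has_maximal2[OF assms] by blast
  then show ?thesis unfolding facets_def by blast
qed

text \<open>The natural lower bounds of \<open>Y\<close> are the numbers up to its minimum, so the
  supremum of the bounds and the infimum of the set meet there.\<close>

lemma Inf_image_nat:
  assumes "(m0::nat) \<in> Y" "\<forall>m\<in>Y. m0 \<le> m"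
  shows "Inf ((\<lambda>m. ereal (real m)) ` Y) = ereal (real m0)"
    and "Sup {enat t | t. \<forall>m\<in>Y. t \<le> m} = enat m0"
proof -
  show "Inf ((\<lambda>m. ereal (real m)) ` Y) = ereal (real m0)"
    by (rule antisym) (use assms in \<open>auto intro!: INF_lower2 INF_greatest\<close>)
  have "{enat t | t. \<forall>m\<in>Y. t \<le> m} = {enat t | t. t \<le> m0}"
    using assms by (metis order_trans)
  moreover have "Sup {enat t | t. t \<le> m0} = enat m0"
    by (rule antisym) (auto intro!: Sup_least Sup_upper)
  ultimately show "Sup {enat t | t. \<forall>m\<in>Y. t \<le> m} = enat m0" by simp
qed

theorem theorem5p2:
  fixes k :: "'k::field itself"
    and \<Delta> :: "'v set set"
    and r :: nat
    and A :: "nat \<Rightarrow> 'v set"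
  assumes "abstract_simplicial_complex \<Delta>"
    and "\<Union>\<Delta> \<noteq> {}"
    and "bij_betw A {1..r} (facets \<Delta>)"
  shows "ereal_of_enat (depth (stanley_reisner_ring k \<Delta>) (homogeneous_maximal_ideal k \<Delta>)) =
    Inf {ereal (of_int (i + j)) | i j :: int. i \<ge> - 1 \<and> j \<ge> 1 \<and>
      carrier (reduced_homology k (nerve_complex r A j) i)
        \<noteq> {\<one>\<^bsub>reduced_homology k (nerve_complex r A j) i\<^esub>}}"
proof -
  have fin: "finite (\<Union>\<Delta>)" and empty: "{} \<in> \<Delta>"
    and down: "\<And>F H. F \<in> \<Delta> \<Longrightarrow> H \<subseteq> F \<Longrightarrow> H \<in> \<Delta>"
    using assms(1) by (auto simp: abstract_simplicial_complex_def)
  have fin\<Delta>: "finite \<Delta>" by (rule finite_UnionD[OF fin])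
  \<comment> \<open>Numbering starts at \<open>r + 1\<close>, so that the vertices come after the
    facet indices.\<close>
  define N where "N = {r + 1..r + card (\<Union>\<Delta>)}"
  obtain \<phi> where \<phi>: "bij_betw \<phi> N (\<Union>\<Delta>)"
    using finite_same_card_bij[of N "\<Union>\<Delta>"] fin by (auto simp: N_def)
  interpret E: enumerated_complex \<Delta> N \<phi>
    by unfold_locales (use \<phi> empty down in \<open>auto simp: N_def\<close>)
  \<comment> \<open>The facets transported along \<open>\<phi>\<close>; the complex
    \<open>\<Delta>'\<close> they generate corresponds to \<open>\<Delta>\<close>.\<close>
  define B where "B j = {i \<in> N. \<phi> i \<in> A j}" for j
  define \<Delta>' where "\<Delta>' = {U. \<exists>j\<in>{1..r}. U \<subseteq> B j}"
  have A: "A j \<in> \<Delta>" "A j \<subseteq> \<Union>\<Delta>" if "j \<in> {1..r}" for j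
    using assms(3) that by (auto simp: bij_betw_def facets_def)
  have facet: "\<exists>j\<in>{1..r}. F \<subseteq> A j" if F: "F \<in> \<Delta>" for F
  proof -
    obtain G where G: "G \<in> facets \<Delta>" "F \<subseteq> G" using ex_facet[OF fin\<Delta> F] by blast
    then have "G \<in> A ` {1..r}" using assms(3) by (simp add: bij_betw_def)
    then show ?thesis using G(2) by blast
  qed
  have r: "r \<ge> 1" using facet[OF empty] by auto
  interpret C: covered_complex r N \<Delta>' B
    by unfold_locales (use r in \<open>auto simp: N_def B_def \<Delta>'_def\<close>)
  have face: "\<phi> ` U \<in> \<Delta> \<longleftrightarrow> U \<in> \<Delta>'" if "U \<subseteq> N" for U
  proof
    assume "\<phi> ` U \<in> \<Delta>"
    then obtain j where "j \<in> {1..r}" "\<phi> ` U \<subseteq> A j" using facet by blast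
    then show "U \<in> \<Delta>'" using that unfolding \<Delta>'_def B_def by blast
  next
    assume "U \<in> \<Delta>'"
    then obtain j where "j \<in> {1..r}" "\<phi> ` U \<subseteq> A j" unfolding \<Delta>'_def B_def by blast
    then show "\<phi> ` U \<in> \<Delta>" using A(1) down by blast
  qed
  have stars: "E.star_family W = C.stars W" for W
    unfolding E.star_family_def C.stars_def using face[of "_ - W"] by blast
  have nerve: "nerve_complex r A (int j) = C.higher_nerve j" for j
  proof -
    have card: "card (\<Inter>j\<in>F. A j) = card (C.common F)" if F: "F \<subseteq> {1..r}" "F \<noteq> {}" for F
    proof -
      have "\<phi> ` C.common F = (\<Inter>j\<in>F. A j)"
      proof
        show "\<phi> ` C.common F \<subseteq> (\<Inter>j\<in>F. A j)" by (auto simp: C.common_def B_def)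
        show "(\<Inter>j\<in>F. A j) \<subseteq> \<phi> ` C.common F"
        proof
          fix v assume v: "v \<in> (\<Inter>j\<in>F. A j)"
          then have "v \<in> \<Union>\<Delta>" using F A(2) by blast
          then obtain i where "i \<in> N" "v = \<phi> i" using E.img by blast
          then show "v \<in> \<phi> ` C.common F" using v by (auto simp: C.common_def B_def)
        qed
      qed
      moreover have "inj_on \<phi> (C.common F)" using C.common_sub[OF F] E.inj by (rule inj_on_subset[rotated])
      ultimately show ?thesis by (metis card_image)
    qed
    show ?thesis
      unfolding nerve_complex_def C.higher_nerve_def of_nat_le_iff
    proof (rule Collect_cong)
      fix F
      show "F \<subseteq> {1..r} \<and> (F = {} \<or> j \<le> card (\<Inter>j\<in>F. A j)) \<longleftrightarrow>
          F \<subseteq> {1..r} \<and> (F = {} \<or> j \<le> card (C.common F))"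
      proof (cases "F \<subseteq> {1..r} \<and> F \<noteq> {}")
        case True
        then have "card (\<Inter>j\<in>F. A j) = card (C.common F)" by (intro card) auto
        then show ?thesis by presburger
      qed blast
    qed
  qed
  \<comment> \<open>With \<open>n\<close> the homological degree plus one, \<open>n + j - 1\<close>
    is the sum of degree and nerve index; since \<open>1 \<le> j\<close>, the subtraction cuts
    nothing off.\<close>
  define Y where "Y = {n + j - 1 | n j. 1 \<le> j \<and> \<not> cochain_exact k (C.higher_nerve j) n}"
  have koszul: "(\<forall>i<t. carrier_ring.koszul_exact (polys (\<Union>\<Delta>) :: ('v, 'k) mpoly set)
      (\<lambda>i. poly_var (\<phi> i)) N (face_ideal \<Delta>) i) \<longleftrightarrow> (\<forall>m\<in>Y. t \<le> m)" for t
  proof -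
    have "(\<forall>m\<in>Y. t \<le> m) \<longleftrightarrow> (\<forall>j n. 1 \<le> j \<longrightarrow> n + j \<le> t \<longrightarrow> cochain_exact k (C.higher_nerve j) n)"
    proof (intro iffI allI impI ballI)
      fix j n assume *: "\<forall>m\<in>Y. t \<le> m" and j: "1 \<le> j" "n + j \<le> t"
      show "cochain_exact k (C.higher_nerve j) n"
      proof (rule ccontr)
        assume "\<not> ?thesis"
        then have "n + j - 1 \<in> Y" unfolding Y_def using j(1) by blast
        then have "t \<le> n + j - 1" using * by blast
        then show False using j by linarith
      qed
    next
      fix m assume *: "\<forall>j n. 1 \<le> j \<longrightarrow> n + j \<le> t \<longrightarrow> cochain_exact k (C.higher_nerve j) n" and "m \<in> Y"
      then obtain n j where nj: "m = n + j - 1" "1 \<le> j" "\<not> cochain_exact k (C.higher_nerve j) n"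
        unfolding Y_def by blast
      then have "\<not> n + j \<le> t" using * by blast
      then show "t \<le> m" using nj(1) by linarith
    qed
    then show ?thesis
      unfolding E.koszul_exact_face_ideal_iff[where k = k] stars
      using C.stars_exact_iff_higher_nerve[of t k] by blast
  qed
  have nerve_Pow: "C.higher_nerve j \<subseteq> Pow {1..r}" for j
    by (auto simp: C.higher_nerve_def)
  have fin_nerve: "finite (C.higher_nerve j)" "F \<in> C.higher_nerve j \<Longrightarrow> finite F" for j F
    using nerve_Pow[of j] finite_subset[of _ "Pow {1..r}"] finite_subset[of F "{1..r}"] by blast+
  have hom: "carrier (reduced_homology k (nerve_complex r A (int j)) (int n - 1)) =
      {\<one>\<^bsub>reduced_homology k (nerve_complex r A (int j)) (int n - 1)\<^esub>} \<longleftrightarrow>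
      cochain_exact k (C.higher_nerve j) n" for j n
    unfolding nerve by (rule reduced_homology_trivial_iff_cochain_exact[OF fin_nerve C.higher_nerve_down])
  have set: "{ereal (of_int (i + j)) | i j :: int. i \<ge> - 1 \<and> j \<ge> 1 \<and>
      carrier (reduced_homology k (nerve_complex r A j) i)
        \<noteq> {\<one>\<^bsub>reduced_homology k (nerve_complex r A j) i\<^esub>}} = (\<lambda>m. ereal (real m)) ` Y"
    (is "?L = _")
  proof (intro equalityI subsetI)
    fix a assume "a \<in> ?L"
    then obtain i j :: int where ij: "a = ereal (of_int (i + j))" "i \<ge> - 1" "j \<ge> 1"
        "carrier (reduced_homology k (nerve_complex r A j) i)
          \<noteq> {\<one>\<^bsub>reduced_homology k (nerve_complex r A j) i\<^esub>}"
      by blast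
    define n m where "n = nat (i + 1)" and "m = nat j"
    have e: "i = int n - 1" "j = int m" "1 \<le> m" using ij by (auto simp: n_def m_def)
    have "\<not> cochain_exact k (C.higher_nerve m) n" using ij(4) hom unfolding e by blast
    then have "n + m - 1 \<in> Y" using e(3) unfolding Y_def by blast
    moreover have "a = ereal (real (n + m - 1))" using e by (simp add: ij(1) of_nat_diff)
    ultimately show "a \<in> (\<lambda>m. ereal (real m)) ` Y" by blast
  next
    fix a assume "a \<in> (\<lambda>m. ereal (real m)) ` Y"
    then obtain n j where nj: "a = ereal (real (n + j - 1))" "1 \<le> j" "\<not> cochain_exact k (C.higher_nerve j) n"
      unfolding Y_def by blast
    have "a = ereal (of_int ((int n - 1) + int j))" using nj by (simp add: of_nat_diff)
    moreover have "int n - 1 \<ge> - 1" "int j \<ge> 1" using nj by auto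
    ultimately show "a \<in> ?L" using nj(3) hom[of j n] by blast
  qed
  \<comment> \<open>A witness that the infimum is over a nonempty set: for an index exceeding the
    number of vertices the nerve is \<open>{{}}\<close>, with nonzero reduced homology in degree
    \<open>- 1\<close>.\<close>
  have "\<not> cochain_exact k (C.higher_nerve (Suc (card N))) 0"
  proof
    assume ex: "cochain_exact k (C.higher_nerve (Suc (card N))) 0"
    have "card (C.common F) \<le> card N" if "F \<subseteq> {1..r}" "F \<noteq> {}" for F
      using C.common_sub[OF that] C.finN by (rule card_mono[rotated])
    then have eq: "C.higher_nerve (Suc (card N)) = {{}}"
      unfolding C.higher_nerve_def by (auto simp: not_less_eq_eq[symmetric])
    \<comment> \<open>Every coboundary is zero at \<open>{}\<close>, so the value 1 there has no
      primitive.\<close>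
    have "supported_on {{}} (restrict0 {{}} (\<lambda>_. 1 :: 'k))" by simp
    from cochain_exactD[OF ex[unfolded eq] this] show False by simp
  qed
  then have "card N \<in> Y" unfolding Y_def by force
  then obtain m0 where m0: "m0 \<in> Y" "\<forall>m\<in>Y. m0 \<le> m"
    using exists_least_iff[of "\<lambda>m. m \<in> Y"] by (metis not_less)
  show ?thesis
    unfolding set E.depth_eq_Sup_koszul_exact koszul Inf_image_nat[OF m0] by simp
qed

end
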